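(* There exists a 1-to-1 correspondence between Lie 3-algebras and 3-term Lie infinity algebras $(V,\ell_p)$ whose structure maps $\ell_2$ and $\ell_3$ vanish on $V_1\times V_1$ and on triplets of total degree $1$, respectively.
   Context: All vector spaces are over a fixed ground field $\mathbb K$. **Linear 2-categories.** A linear 2-category $L$ consists of vector spaces $L_0,L_1,L_2$ ($m$-cells are elements of $L_m$), linear source and target maps $s,t:L_m\to L_{m-1}$ ($L_{-1}=0$; $s_m$ denotes the source map on $L_m$) with $ss=st$, $ts=tt$; linear identity maps $1:L_m\to L_{m+1}$ for $m=0,1$ ($1^2$ is the iterated identity); and, for $0\le p<m\le 2$, linear composition maps $\circ_p:L_m\times_{L_p}L_m\to L_m$, where $L_m\times_{L_p}L_m=\{(a,b)\in L_m\times L_m: t^{m-p}a=s^{m-p}b\}$, such that: $s(a\circ_{m-1}b)=s(a)$, $t(a\circ_{m-1}b)=t(b)$; for $p\le m-2$, $s(a\circ_pb)=s(a)\circ_ps(b)$ and $t(a\circ_pb)=t(a)\circ_pt(b)$; $s(1_a)=t(1_a)=a$; $\circ_p$ is associative; $1^{m-p}_{s^{m-p}a}\circ_pa=a=a\circ_p1^{m-p}_{t^{m-p}a}$; for $q<p$, $(a\circ_pb)\circ_q(c\circ_pd)=(a\circ_qc)\circ_p(b\circ_qd)$ whenever $(a,b),(c,d)$ are composable along a $p$-cell and $(a,c),(b,d)$ along a $q$-cell; $1_{a\circ_pb}=1_a\circ_p1_b$ for $m<2$. **Standing identification.** With $V_m=\ker s_m\subset L_m$ ($V_0=L_0$), the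 space $L_m$ is systematically identified with $\oplus_{i=0}^mV_i$ via $(v_0,\dots,v_m)\mapsto 1^m_{v_0}+\dots+1_{v_{m-1}}+v_m$. Then $s(v_0,\dots,v_m)=(v_0,\dots,v_{m-1})$, $t(v_0,\dots,v_m)=(v_0,\dots,v_{m-1}+tv_m)$, $1_{(v_0,\dots,v_m)}=(v_0,\dots,v_m,0)$, $(v_0,\dots,v_m)\circ_p(v_0',\dots,v_m')=(v_0,\dots,v_p,v_{p+1}+v'_{p+1},\dots,v_m+v'_m)$ for composable cells. **Multilinear cells.** The product of linear 2-categories is formed componentwise. A $k$-linear 2-functor $F:L^{\times k}\to L$ is a family of $k$-linear maps $F:L_m^{\times k}\to L_m$, $m=0,1,2$, that respects sources, targets, identities and compositions. A $k$-linear natural 2-transformation $\theta:F\Rightarrow G$ between $k$-linear 2-functors assigns to $a\in L_0^{\times k}$ a 1-cell $\theta_a:F(a)\to G(a)$ in $L_1$, $k$-linear in $a$, with $F(\alpha)\circ_01_{\theta_{t^2\alpha}}=1_{\theta_{s^2\alpha}}\circ_0G(\alpha)$ for all $\alpha\in L_2^{\times k}$. A $k$-linear 2-modification $\mu:\eta\Rrightarrow\varepsilon$ between $k$-linear natural 2-transformations $\eta,\varepsilon:F\Rightarrow G$ assigns to $a\in L_0^{\times k}$ a 2-cell $\mu_a:\eta_a\Rightarrow\varepsilon_a$ in $L_2$, $k$-linear in $a$, with $F(\alpha)\circ_0\mu_{t^2\alpha}=\mu_{s^2\alpha}\circ_0G(\alpha)$ for all $\alpha\in L_2^{\times k}$.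 A 2-transformation $J$ (resp. 2-modification $\mu$) is skew-symmetric if the $V_1$-component of $J_a\in L_1$ (resp. the $V_2$-component of $\mu_a\in L_2$) is antisymmetric in its arguments. **Lie 3-algebras.** A Lie 3-algebra is a linear 2-category $L$ with (i) an antisymmetric bilinear 2-functor $[-,-]:L\times L\to L$; (ii) a skew-symmetric trilinear natural 2-transformation (Jacobiator) $J_{xyz}:[[x,y],z]\to[[x,z],y]+[x,[y,z]]$, $x,y,z\in L_0$; (iii) a skew-symmetric quadrilinear 2-modification (Identiator) $\mu_{xyzu}:\eta_{xyzu}\Rightarrow\varepsilon_{xyzu}$, $x,y,z,u\in L_0$, where $$\eta_{xyzu}=[J_{x,y,z},1_u]\circ_0(J_{[x,z],y,u}+J_{x,[y,z],u})\circ_0([J_{xzu},1_y]+1)\circ_0([1_x,J_{yzu}]+1),$$ $$\varepsilon_{xyzu}=J_{[x,y],z,u}\circ_0([J_{xyu},1_z]+1)\circ_0(J_{x,[y,u],z}+J_{[x,u],y,z}+J_{x,y,[z,u]}),$$ viewed as natural 2-transformations from the 2-functor $F(x,y,z,u)=[[[x,y],z],u]$ to the 2-functor $G(x,y,z,u)=[[x,z],[y,u]]+[x,[[y,u],z]]+[[[x,u],z],y]+[[x,u],[y,z]]+[[x,[z,u]],y]+[x,[y,[z,u]]]$; (iv) such that, for all $x,y,z,u,v\in L_0$, the coherence law $\alpha_1+\alpha_4^{-1}=\alpha_3+\alpha_2^{-1}$ holds, where $^{-1}$ is the inverse for composition along a 1-cell (if $\alpha=(A,\mathbf s,\mathbf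 a)\in L_2$ has target $(A,\mathbf t)\in L_1$, then $\alpha^{-1}=(A,\mathbf t,-\mathbf a)$) and $$\alpha_1=1_{11}\circ_0(\mu_{x,y,z,[u,v]}+[\mu_{xyzv},1^2_u])\circ_01_{12}\circ_0(\mu_{[x,v],y,z,u}+\mu_{x,[y,v],z,u}+\mu_{x,y,[z,v],u}+1^2),$$ $1_{11}=1_{J_{[[x,y],z],u,v}}$, $1_{12}=1_{[J_{x,[z,v],y},1_u]+[J_{[x,v],z,y},1_u]+[J_{x,z,[y,v]},1_u]}+1^2$; $$\alpha_4=[\mu_{xyzu},1^2_v]\circ_01_{41}\circ_0(\mu_{[x,u],y,z,v}+\mu_{x,[y,u],z,v}+\mu_{x,y,[z,u],v})\circ_01_{42},$$ $1_{41}=1_{[J_{[x,u],z,y},1_v]+[J_{x,z,[y,u]},1_v]+[J_{x,[z,u],y},1_v]}+1^2$, $1_{42}=1_{[[J_{xuv},1_z],1_y]+[J_{xuv},1_{[y,z]}]+[1_x,[J_{yuv},1_z]]+[[1_x,J_{zuv}],1_y]+[1_x,[1_y,J_{zuv}]]+[1_{[x,z]},J_{yuv}]}+1^2$; $$\alpha_3=\mu_{[x,y],z,u,v}\circ_01_{31}\circ_0([\mu_{xyuv},1^2_z]+1^2)\circ_01_{32}\circ_01_{33},$$ $1_{31}=1_{[J_{[x,y],v,u},1_z]}+1^2$; $1_{32}=1_{h}$ with $h=[J_{xyv},1_{[z,u]}]+J_{x,y,[[z,v],u]}+J_{x,y,[z,[u,v]]}+J_{[[x,v],u],y,z}+J_{[x,v],[y,u],z}+J_{[x,u],[y,v],z}+J_{x,[[y,v],u],z}+J_{[x,[u,v]],y,z}+J_{x,[y,[u,v]],z}+[J_{xyu},1_{[z,v]}]$;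 $1_{33}=1_{J_{x,[y,v],[z,u]}+J_{[x,v],y,[z,u]}+J_{x,[y,u],[z,v]}+J_{[x,u],y,[z,v]}}+1^2$; $$\alpha_2=1_{21}\circ_0(\mu_{[x,z],y,u,v}+\mu_{x,[y,z],u,v})\circ_01_{22}\circ_0([1^2_x,\mu_{yzuv}]+[\mu_{xzuv},1^2_y]+1^2)\circ_01_{23},$$ $1_{21}=1_{[[J_{xyz},1_u],1_v]}$, $1_{22}=1_{[1_x,J_{[y,z],v,u}]+[J_{[x,z],v,u},1_y]}+1^2$, $1_{23}=1_{[J_{xzv},1_{[y,u]}]+[J_{xzu},1_{[y,v]}]+[1_{[x,v]},J_{yzu}]+[1_{[x,u]},J_{yzv}]}+1^2$. Bare symbols $1$ (in 1-cells) and $1^2$ (in 2-cells) denote the identity 1-cells, resp. twice iterated identity 2-cells, of the elements of $L_0$ determined by composability of the factors. **3-term Lie infinity algebras.** These are graded vector spaces $V=V_0\oplus V_1\oplus V_2$ with graded antisymmetric $p$-linear maps $\ell_p$, $1\le p\le 4$, on $V$ of weight $p-2$ (i.e. raising total degree by $p-2$; $\ell_p=0$ for $p>4$), such that for all $n\ge1$ and homogeneous $a_1,\dots,a_n\in V$ $$\sum_{i+j=n+1}\ \sum_{(i,n-i)\text{-shuffles }\sigma}\chi(\sigma)(-1)^{i(j-1)}\ell_j(\ell_i(a_{\sigma_1},\dots,a_{\sigma_i}),a_{\sigma_{i+1}},\dots,a_{\sigma_n})=0,$$ where $\chi(\sigma)$ is the product of the signature of $\sigma$ and the Koszul sign determined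 by $\sigma$ and $a_1,\dots,a_n$. Graded antisymmetric: exchanging two adjacent homogeneous arguments $a,b$ produces the sign $-(-1)^{|a||b|}$. *)

theory Defs
  imports Complex_Main "HOL-Combinatorics.Permutations" "HOL-Library.Product_Plus"
begin

section \<open>Linear 2-categories\<close>

text \<open>
  \<open>comp10\<close> is composition of 1-cells along 0-cells; \<open>comp20\<close> and \<open>comp21\<close> are composition of
  2-cells along 0-cells and 1-cells. All composites are written in diagrammatic order.
\<close>

record ('a, 'b, 'c) two_cat =
  src1 :: "'b \<Rightarrow> 'a"
  src2 :: "'c \<Rightarrow> 'b"
  tgt1 :: "'b \<Rightarrow> 'a"
  tgt2 :: "'c \<Rightarrow> 'b"
  id0 :: "'a \<Rightarrow> 'b"
  id1 :: "'b \<Rightarrow> 'c"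
  comp10 :: "'b \<Rightarrow> 'b \<Rightarrow> 'b"
  comp20 :: "'c \<Rightarrow> 'c \<Rightarrow> 'c"
  comp21 :: "'c \<Rightarrow> 'c \<Rightarrow> 'c"

abbreviation ssrc :: "('a, 'b, 'c, 'm) two_cat_scheme \<Rightarrow> 'c \<Rightarrow> 'a" where
  "ssrc C \<alpha> \<equiv> src1 C (src2 C \<alpha>)"

abbreviation ttgt :: "('a, 'b, 'c, 'm) two_cat_scheme \<Rightarrow> 'c \<Rightarrow> 'a" where
  "ttgt C \<alpha> \<equiv> tgt1 C (tgt2 C \<alpha>)"

abbreviation iid :: "('a, 'b, 'c, 'm) two_cat_scheme \<Rightarrow> 'a \<Rightarrow> 'c" where
  "iid C x \<equiv> id1 C (id0 C x)"

abbreviation composable10 :: "('a, 'b, 'c, 'm) two_cat_scheme \<Rightarrow> 'b \<Rightarrow> 'b \<Rightarrow> bool" where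
  "composable10 C f g \<equiv> tgt1 C f = src1 C g"

abbreviation composable20 :: "('a, 'b, 'c, 'm) two_cat_scheme \<Rightarrow> 'c \<Rightarrow> 'c \<Rightarrow> bool" where
  "composable20 C \<alpha> \<beta> \<equiv> ttgt C \<alpha> = ssrc C \<beta>"

abbreviation composable21 :: "('a, 'b, 'c, 'm) two_cat_scheme \<Rightarrow> 'c \<Rightarrow> 'c \<Rightarrow> bool" where
  "composable21 C \<alpha> \<beta> \<equiv> tgt2 C \<alpha> = src2 C \<beta>"

text \<open>
  A linear map defined on the subspace of pairs satisfying \<open>R\<close>. The value elsewhere is fixed to
  \<open>undefined\<close>, so that two such partial operations are equal as soon as they agree on the pairs
  satisfying \<open>R\<close>.
\<close>

definition linear_composition ::
  "('k \<Rightarrow> 'x \<Rightarrow> 'x::ab_group_add) \<Rightarrow> ('x \<Rightarrow> 'x \<Rightarrow> bool) \<Rightarrow> ('x \<Rightarrow> 'x \<Rightarrow> 'x) \<Rightarrow> bool" where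
  "linear_composition sc R c \<longleftrightarrow>
     (\<forall>a b a' b'. R a b \<and> R a' b' \<longrightarrow> c (a + a') (b + b') = c a b + c a' b') \<and>
     (\<forall>r a b. R a b \<longrightarrow> c (sc r a) (sc r b) = sc r (c a b)) \<and>
     (\<forall>a b. \<not> R a b \<longrightarrow> c a b = undefined)"

definition linear_2_category ::
  "('k::field \<Rightarrow> 'a::ab_group_add \<Rightarrow> 'a) \<Rightarrow> ('k \<Rightarrow> 'b::ab_group_add \<Rightarrow> 'b) \<Rightarrow>
   ('k \<Rightarrow> 'c::ab_group_add \<Rightarrow> 'c) \<Rightarrow> ('a, 'b, 'c, 'm) two_cat_scheme \<Rightarrow> bool" where
  "linear_2_category sc0 sc1 sc2 C \<longleftrightarrow>
     Vector_Spaces.linear sc1 sc0 (src1 C) \<and> Vector_Spaces.linear sc1 sc0 (tgt1 C) \<and>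
     Vector_Spaces.linear sc2 sc1 (src2 C) \<and> Vector_Spaces.linear sc2 sc1 (tgt2 C) \<and>
     Vector_Spaces.linear sc0 sc1 (id0 C) \<and> Vector_Spaces.linear sc1 sc2 (id1 C) \<and>
     (\<forall>\<alpha>. src1 C (src2 C \<alpha>) = src1 C (tgt2 C \<alpha>) \<and> tgt1 C (src2 C \<alpha>) = tgt1 C (tgt2 C \<alpha>)) \<and>
     linear_composition sc1 (composable10 C) (comp10 C) \<and>
     linear_composition sc2 (composable20 C) (comp20 C) \<and>
     linear_composition sc2 (composable21 C) (comp21 C) \<and>
     (\<forall>f g. composable10 C f g \<longrightarrow>
        src1 C (comp10 C f g) = src1 C f \<and> tgt1 C (comp10 C f g) = tgt1 C g) \<and>
     (\<forall>\<alpha> \<beta>. composable21 C \<alpha> \<beta> \<longrightarrow>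
        src2 C (comp21 C \<alpha> \<beta>) = src2 C \<alpha> \<and> tgt2 C (comp21 C \<alpha> \<beta>) = tgt2 C \<beta>) \<and>
     (\<forall>\<alpha> \<beta>. composable20 C \<alpha> \<beta> \<longrightarrow>
        src2 C (comp20 C \<alpha> \<beta>) = comp10 C (src2 C \<alpha>) (src2 C \<beta>) \<and>
        tgt2 C (comp20 C \<alpha> \<beta>) = comp10 C (tgt2 C \<alpha>) (tgt2 C \<beta>)) \<and>
     (\<forall>x. src1 C (id0 C x) = x \<and> tgt1 C (id0 C x) = x) \<and>
     (\<forall>f. src2 C (id1 C f) = f \<and> tgt2 C (id1 C f) = f) \<and>
     (\<forall>f g h. composable10 C f g \<and> composable10 C g h \<longrightarrow>
        comp10 C (comp10 C f g) h = comp10 C f (comp10 C g h)) \<and>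
     (\<forall>\<alpha> \<beta> \<gamma>. composable20 C \<alpha> \<beta> \<and> composable20 C \<beta> \<gamma> \<longrightarrow>
        comp20 C (comp20 C \<alpha> \<beta>) \<gamma> = comp20 C \<alpha> (comp20 C \<beta> \<gamma>)) \<and>
     (\<forall>\<alpha> \<beta> \<gamma>. composable21 C \<alpha> \<beta> \<and> composable21 C \<beta> \<gamma> \<longrightarrow>
        comp21 C (comp21 C \<alpha> \<beta>) \<gamma> = comp21 C \<alpha> (comp21 C \<beta> \<gamma>)) \<and>
     (\<forall>f. comp10 C (id0 C (src1 C f)) f = f \<and> comp10 C f (id0 C (tgt1 C f)) = f) \<and>
     (\<forall>\<alpha>. comp20 C (iid C (ssrc C \<alpha>)) \<alpha> = \<alpha> \<and> comp20 C \<alpha> (iid C (ttgt C \<alpha>)) = \<alpha>) \<and>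
     (\<forall>\<alpha>. comp21 C (id1 C (src2 C \<alpha>)) \<alpha> = \<alpha> \<and> comp21 C \<alpha> (id1 C (tgt2 C \<alpha>)) = \<alpha>) \<and>
     (\<forall>\<alpha> \<beta> \<gamma> \<delta>. composable21 C \<alpha> \<beta> \<and> composable21 C \<gamma> \<delta> \<and>
        composable20 C \<alpha> \<gamma> \<and> composable20 C \<beta> \<delta> \<longrightarrow>
        comp20 C (comp21 C \<alpha> \<beta>) (comp21 C \<gamma> \<delta>) = comp21 C (comp20 C \<alpha> \<gamma>) (comp20 C \<beta> \<delta>)) \<and>
     (\<forall>f g. composable10 C f g \<longrightarrow> id1 C (comp10 C f g) = comp20 C (id1 C f) (id1 C g))"

section \<open>Multilinear functors, transformations and modifications\<close>

text \<open>
  An element of a \<open>k\<close>-fold product is a list of length \<open>k\<close>; values on lists of other lengths are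
  irrelevant in this section.
\<close>

definition multilinear ::
  "nat \<Rightarrow> ('k::field \<Rightarrow> 'x::ab_group_add \<Rightarrow> 'x) \<Rightarrow> ('k \<Rightarrow> 'y::ab_group_add \<Rightarrow> 'y) \<Rightarrow>
   ('x list \<Rightarrow> 'y) \<Rightarrow> bool" where
  "multilinear k scx scy F \<longleftrightarrow>
     (\<forall>xs ys. length xs + 1 + length ys = k \<longrightarrow> Vector_Spaces.linear scx scy (\<lambda>x. F (xs @ x # ys)))"

definition antisymmetric :: "nat \<Rightarrow> ('x list \<Rightarrow> 'y::ab_group_add) \<Rightarrow> bool" where
  "antisymmetric k F \<longleftrightarrow>
     (\<forall>xs a b ys. length xs + 2 + length ys = k \<longrightarrow> F (xs @ a # b # ys) = - F (xs @ b # a # ys))"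

type_synonym ('a, 'b, 'c) functor_family =
  "('a list \<Rightarrow> 'a) \<times> ('b list \<Rightarrow> 'b) \<times> ('c list \<Rightarrow> 'c)"

definition linear_2_functor ::
  "('k::field \<Rightarrow> 'a::ab_group_add \<Rightarrow> 'a) \<Rightarrow> ('k \<Rightarrow> 'b::ab_group_add \<Rightarrow> 'b) \<Rightarrow>
   ('k \<Rightarrow> 'c::ab_group_add \<Rightarrow> 'c) \<Rightarrow> ('a, 'b, 'c, 'm) two_cat_scheme \<Rightarrow> nat \<Rightarrow>
   ('a, 'b, 'c) functor_family \<Rightarrow> bool" where
  "linear_2_functor sc0 sc1 sc2 C k = (\<lambda>(F0, F1, F2).
     multilinear k sc0 sc0 F0 \<and> multilinear k sc1 sc1 F1 \<and> multilinear k sc2 sc2 F2 \<and>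
     (\<forall>fs. length fs = k \<longrightarrow>
        src1 C (F1 fs) = F0 (map (src1 C) fs) \<and> tgt1 C (F1 fs) = F0 (map (tgt1 C) fs)) \<and>
     (\<forall>\<alpha>s. length \<alpha>s = k \<longrightarrow>
        src2 C (F2 \<alpha>s) = F1 (map (src2 C) \<alpha>s) \<and> tgt2 C (F2 \<alpha>s) = F1 (map (tgt2 C) \<alpha>s)) \<and>
     (\<forall>xs. length xs = k \<longrightarrow> F1 (map (id0 C) xs) = id0 C (F0 xs)) \<and>
     (\<forall>fs. length fs = k \<longrightarrow> F2 (map (id1 C) fs) = id1 C (F1 fs)) \<and>
     (\<forall>fs gs. length fs = k \<and> list_all2 (composable10 C) fs gs \<longrightarrow>
        F1 (map2 (comp10 C) fs gs) = comp10 C (F1 fs) (F1 gs)) \<and>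
     (\<forall>\<alpha>s \<beta>s. length \<alpha>s = k \<and> list_all2 (composable20 C) \<alpha>s \<beta>s \<longrightarrow>
        F2 (map2 (comp20 C) \<alpha>s \<beta>s) = comp20 C (F2 \<alpha>s) (F2 \<beta>s)) \<and>
     (\<forall>\<alpha>s \<beta>s. length \<alpha>s = k \<and> list_all2 (composable21 C) \<alpha>s \<beta>s \<longrightarrow>
        F2 (map2 (comp21 C) \<alpha>s \<beta>s) = comp21 C (F2 \<alpha>s) (F2 \<beta>s)))"

definition linear_2_transformation ::
  "('k::field \<Rightarrow> 'a::ab_group_add \<Rightarrow> 'a) \<Rightarrow> ('k \<Rightarrow> 'b::ab_group_add \<Rightarrow> 'b) \<Rightarrow>
   ('k \<Rightarrow> 'c::ab_group_add \<Rightarrow> 'c) \<Rightarrow> ('a, 'b, 'c, 'm) two_cat_scheme \<Rightarrow> nat \<Rightarrow>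
   ('a, 'b, 'c) functor_family \<Rightarrow> ('a, 'b, 'c) functor_family \<Rightarrow> ('a list \<Rightarrow> 'b) \<Rightarrow> bool" where
  "linear_2_transformation sc0 sc1 sc2 C k = (\<lambda>(F0, F1, F2) (G0, G1, G2) \<theta>.
     linear_2_functor sc0 sc1 sc2 C k (F0, F1, F2) \<and>
     linear_2_functor sc0 sc1 sc2 C k (G0, G1, G2) \<and>
     multilinear k sc0 sc1 \<theta> \<and>
     (\<forall>xs. length xs = k \<longrightarrow> src1 C (\<theta> xs) = F0 xs \<and> tgt1 C (\<theta> xs) = G0 xs) \<and>
     (\<forall>\<alpha>s. length \<alpha>s = k \<longrightarrow>
        comp20 C (F2 \<alpha>s) (id1 C (\<theta> (map (ttgt C) \<alpha>s))) =
        comp20 C (id1 C (\<theta> (map (ssrc C) \<alpha>s))) (G2 \<alpha>s)))"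

definition linear_2_modification ::
  "('k::field \<Rightarrow> 'a::ab_group_add \<Rightarrow> 'a) \<Rightarrow> ('k \<Rightarrow> 'b::ab_group_add \<Rightarrow> 'b) \<Rightarrow>
   ('k \<Rightarrow> 'c::ab_group_add \<Rightarrow> 'c) \<Rightarrow> ('a, 'b, 'c, 'm) two_cat_scheme \<Rightarrow> nat \<Rightarrow>
   ('a, 'b, 'c) functor_family \<Rightarrow> ('a, 'b, 'c) functor_family \<Rightarrow>
   ('a list \<Rightarrow> 'b) \<Rightarrow> ('a list \<Rightarrow> 'b) \<Rightarrow> ('a list \<Rightarrow> 'c) \<Rightarrow> bool" where
  "linear_2_modification sc0 sc1 sc2 C k = (\<lambda>(F0, F1, F2) (G0, G1, G2) \<eta> \<epsilon> \<mu>.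
     linear_2_transformation sc0 sc1 sc2 C k (F0, F1, F2) (G0, G1, G2) \<eta> \<and>
     linear_2_transformation sc0 sc1 sc2 C k (F0, F1, F2) (G0, G1, G2) \<epsilon> \<and>
     multilinear k sc0 sc2 \<mu> \<and>
     (\<forall>xs. length xs = k \<longrightarrow> src2 C (\<mu> xs) = \<eta> xs \<and> tgt2 C (\<mu> xs) = \<epsilon> xs) \<and>
     (\<forall>\<alpha>s. length \<alpha>s = k \<longrightarrow>
        comp20 C (F2 \<alpha>s) (\<mu> (map (ttgt C) \<alpha>s)) = comp20 C (\<mu> (map (ssrc C) \<alpha>s)) (G2 \<alpha>s)))"

text \<open>
  The components in \<open>ker src1\<close> and \<open>ker src2\<close> of a 1-cell and of a 2-cell, with respect to the
  decompositions \<open>f = 1_(s f) + v1\<close> and \<open>\<alpha> = 1_(s \<alpha>) + v2\<close>.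
\<close>

definition part1 :: "('a, 'b::ab_group_add, 'c, 'm) two_cat_scheme \<Rightarrow> 'b \<Rightarrow> 'b" where
  "part1 C f = f - id0 C (src1 C f)"

definition part2 :: "('a, 'b, 'c::ab_group_add, 'm) two_cat_scheme \<Rightarrow> 'c \<Rightarrow> 'c" where
  "part2 C \<alpha> = \<alpha> - id1 C (src2 C \<alpha>)"

section \<open>Lie 3-algebras\<close>

record ('a, 'b, 'c) lie3 = "('a, 'b, 'c) two_cat" +
  bra0 :: "'a \<Rightarrow> 'a \<Rightarrow> 'a"
  bra1 :: "'b \<Rightarrow> 'b \<Rightarrow> 'b"
  bra2 :: "'c \<Rightarrow> 'c \<Rightarrow> 'c"
  jac :: "'a \<Rightarrow> 'a \<Rightarrow> 'a \<Rightarrow> 'b"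
  ident :: "'a \<Rightarrow> 'a \<Rightarrow> 'a \<Rightarrow> 'a \<Rightarrow> 'c"

definition on_pairs :: "('x \<Rightarrow> 'x \<Rightarrow> 'y) \<Rightarrow> 'x list \<Rightarrow> 'y" where
  "on_pairs h xs = h (xs ! 0) (xs ! 1)"

definition on_triples :: "('x \<Rightarrow> 'x \<Rightarrow> 'x \<Rightarrow> 'y) \<Rightarrow> 'x list \<Rightarrow> 'y" where
  "on_triples h xs = h (xs ! 0) (xs ! 1) (xs ! 2)"

definition on_quadruples :: "('x \<Rightarrow> 'x \<Rightarrow> 'x \<Rightarrow> 'x \<Rightarrow> 'y) \<Rightarrow> 'x list \<Rightarrow> 'y" where
  "on_quadruples h xs = h (xs ! 0) (xs ! 1) (xs ! 2) (xs ! 3)"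

text \<open>
  The functors between which the Jacobiator and the Identiator live, written once for a bracket
  \<open>b\<close> and used for the brackets of 0-, 1- and 2-cells alike.
\<close>

definition jac_source :: "('x \<Rightarrow> 'x \<Rightarrow> 'x::ab_group_add) \<Rightarrow> 'x \<Rightarrow> 'x \<Rightarrow> 'x \<Rightarrow> 'x" where
  "jac_source b x y z = b (b x y) z"

definition jac_target :: "('x \<Rightarrow> 'x \<Rightarrow> 'x::ab_group_add) \<Rightarrow> 'x \<Rightarrow> 'x \<Rightarrow> 'x \<Rightarrow> 'x" where
  "jac_target b x y z = b (b x z) y + b x (b y z)"

definition ident_source :: "('x \<Rightarrow> 'x \<Rightarrow> 'x::ab_group_add) \<Rightarrow> 'x \<Rightarrow> 'x \<Rightarrow> 'x \<Rightarrow> 'x \<Rightarrow> 'x" where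
  "ident_source b x y z u = b (b (b x y) z) u"

definition ident_target :: "('x \<Rightarrow> 'x \<Rightarrow> 'x::ab_group_add) \<Rightarrow> 'x \<Rightarrow> 'x \<Rightarrow> 'x \<Rightarrow> 'x \<Rightarrow> 'x" where
  "ident_target b x y z u =
     b (b x z) (b y u) + b x (b (b y u) z) + b (b (b x u) z) y +
     b (b x u) (b y z) + b (b x (b z u)) y + b x (b y (b z u))"

locale lie3_cells =
  fixes L :: "('a::ab_group_add, 'b::ab_group_add, 'c::ab_group_add) lie3"
begin

abbreviation brk0 ("\<langle>_,/ _\<rangle>\<^sub>0") where "\<langle>x, y\<rangle>\<^sub>0 \<equiv> bra0 L x y"
abbreviation brk1 ("\<langle>_,/ _\<rangle>\<^sub>1") where "\<langle>f, g\<rangle>\<^sub>1 \<equiv> bra1 L f g"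
abbreviation brk2 ("\<langle>_,/ _\<rangle>\<^sub>2") where "\<langle>\<alpha>, \<beta>\<rangle>\<^sub>2 \<equiv> bra2 L \<alpha> \<beta>"
abbreviation J where "J \<equiv> jac L"
abbreviation \<mu> where "\<mu> \<equiv> ident L"
abbreviation one where "one x \<equiv> id0 L x"
abbreviation two where "two x \<equiv> iid L x"
abbreviation idc where "idc f \<equiv> id1 L f"
abbreviation then1 (infixl "\<cdot>\<^sub>1" 60) where "f \<cdot>\<^sub>1 g \<equiv> comp10 L f g"
abbreviation then2 (infixl "\<cdot>\<^sub>2" 60) where "\<alpha> \<cdot>\<^sub>2 \<beta> \<equiv> comp20 L \<alpha> \<beta>"

text \<open>
  Composition along a 0-cell with a factor of the form \<open>g + 1\<close> (resp. \<open>\<beta> + 1\<^sup>2\<close>), where the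
  unlabelled identity is that of the unique 0-cell that makes the factor composable with what
  precedes it: \<open>w = t f - s g\<close> is forced by \<open>t f = s (g + 1_w)\<close>.
\<close>

definition then1_id (infixl "\<cdot>\<^sub>1\<^sup>+" 60) where
  "f \<cdot>\<^sub>1\<^sup>+ g = f \<cdot>\<^sub>1 (g + one (tgt1 L f - src1 L g))"

definition then2_id (infixl "\<cdot>\<^sub>2\<^sup>+" 60) where
  "\<alpha> \<cdot>\<^sub>2\<^sup>+ \<beta> = \<alpha> \<cdot>\<^sub>2 (\<beta> + two (ttgt L \<alpha> - ssrc L \<beta>))"

definition eta :: "'a \<Rightarrow> 'a \<Rightarrow> 'a \<Rightarrow> 'a \<Rightarrow> 'b" where
  "eta x y z u =
     \<langle>J x y z, one u\<rangle>\<^sub>1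
     \<cdot>\<^sub>1 (J \<langle>x, z\<rangle>\<^sub>0 y u + J x \<langle>y, z\<rangle>\<^sub>0 u)
     \<cdot>\<^sub>1\<^sup>+ \<langle>J x z u, one y\<rangle>\<^sub>1
     \<cdot>\<^sub>1\<^sup>+ \<langle>one x, J y z u\<rangle>\<^sub>1"

definition eps :: "'a \<Rightarrow> 'a \<Rightarrow> 'a \<Rightarrow> 'a \<Rightarrow> 'b" where
  "eps x y z u =
     J \<langle>x, y\<rangle>\<^sub>0 z u
     \<cdot>\<^sub>1\<^sup>+ \<langle>J x y u, one z\<rangle>\<^sub>1
     \<cdot>\<^sub>1 (J x \<langle>y, u\<rangle>\<^sub>0 z + J \<langle>x, u\<rangle>\<^sub>0 y z + J x y \<langle>z, u\<rangle>\<^sub>0)"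

text \<open>The inverse for composition along a 1-cell: source and target are exchanged and the
  component in \<open>ker src2\<close> changes its sign.\<close>

definition inverse21 :: "'c \<Rightarrow> 'c" where
  "inverse21 \<alpha> = idc (tgt2 L \<alpha>) - part2 L \<alpha>"

definition alpha1 :: "'a \<Rightarrow> 'a \<Rightarrow> 'a \<Rightarrow> 'a \<Rightarrow> 'a \<Rightarrow> 'c" where
  "alpha1 x y z u v =
     idc (J \<langle>\<langle>x, y\<rangle>\<^sub>0, z\<rangle>\<^sub>0 u v)
     \<cdot>\<^sub>2 (\<mu> x y z \<langle>u, v\<rangle>\<^sub>0 + \<langle>\<mu> x y z v, two u\<rangle>\<^sub>2)
     \<cdot>\<^sub>2\<^sup>+ idc (\<langle>J x \<langle>z, v\<rangle>\<^sub>0 y, one u\<rangle>\<^sub>1 + \<langle>J \<langle>x, v\<rangle>\<^sub>0 z y, one u\<rangle>\<^sub>1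
              + \<langle>J x z \<langle>y, v\<rangle>\<^sub>0, one u\<rangle>\<^sub>1)
     \<cdot>\<^sub>2\<^sup>+ (\<mu> \<langle>x, v\<rangle>\<^sub>0 y z u + \<mu> x \<langle>y, v\<rangle>\<^sub>0 z u + \<mu> x y \<langle>z, v\<rangle>\<^sub>0 u)"

definition alpha4 :: "'a \<Rightarrow> 'a \<Rightarrow> 'a \<Rightarrow> 'a \<Rightarrow> 'a \<Rightarrow> 'c" where
  "alpha4 x y z u v =
     \<langle>\<mu> x y z u, two v\<rangle>\<^sub>2
     \<cdot>\<^sub>2\<^sup>+ idc (\<langle>J \<langle>x, u\<rangle>\<^sub>0 z y, one v\<rangle>\<^sub>1 + \<langle>J x z \<langle>y, u\<rangle>\<^sub>0, one v\<rangle>\<^sub>1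
              + \<langle>J x \<langle>z, u\<rangle>\<^sub>0 y, one v\<rangle>\<^sub>1)
     \<cdot>\<^sub>2 (\<mu> \<langle>x, u\<rangle>\<^sub>0 y z v + \<mu> x \<langle>y, u\<rangle>\<^sub>0 z v + \<mu> x y \<langle>z, u\<rangle>\<^sub>0 v)
     \<cdot>\<^sub>2\<^sup>+ idc (\<langle>\<langle>J x u v, one z\<rangle>\<^sub>1, one y\<rangle>\<^sub>1 + \<langle>J x u v, one \<langle>y, z\<rangle>\<^sub>0\<rangle>\<^sub>1
              + \<langle>one x, \<langle>J y u v, one z\<rangle>\<^sub>1\<rangle>\<^sub>1 + \<langle>\<langle>one x, J z u v\<rangle>\<^sub>1, one y\<rangle>\<^sub>1
              + \<langle>one x, \<langle>one y, J z u v\<rangle>\<^sub>1\<rangle>\<^sub>1 + \<langle>one \<langle>x, z\<rangle>\<^sub>0, J y u v\<rangle>\<^sub>1)"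

definition alpha3 :: "'a \<Rightarrow> 'a \<Rightarrow> 'a \<Rightarrow> 'a \<Rightarrow> 'a \<Rightarrow> 'c" where
  "alpha3 x y z u v =
     \<mu> \<langle>x, y\<rangle>\<^sub>0 z u v
     \<cdot>\<^sub>2\<^sup>+ idc \<langle>J \<langle>x, y\<rangle>\<^sub>0 v u, one z\<rangle>\<^sub>1
     \<cdot>\<^sub>2\<^sup>+ \<langle>\<mu> x y u v, two z\<rangle>\<^sub>2
     \<cdot>\<^sub>2 idc (\<langle>J x y v, one \<langle>z, u\<rangle>\<^sub>0\<rangle>\<^sub>1 + J x y \<langle>\<langle>z, v\<rangle>\<^sub>0, u\<rangle>\<^sub>0 + J x y \<langle>z, \<langle>u, v\<rangle>\<^sub>0\<rangle>\<^sub>0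
             + J \<langle>\<langle>x, v\<rangle>\<^sub>0, u\<rangle>\<^sub>0 y z + J \<langle>x, v\<rangle>\<^sub>0 \<langle>y, u\<rangle>\<^sub>0 z + J \<langle>x, u\<rangle>\<^sub>0 \<langle>y, v\<rangle>\<^sub>0 z
             + J x \<langle>\<langle>y, v\<rangle>\<^sub>0, u\<rangle>\<^sub>0 z + J \<langle>x, \<langle>u, v\<rangle>\<^sub>0\<rangle>\<^sub>0 y z + J x \<langle>y, \<langle>u, v\<rangle>\<^sub>0\<rangle>\<^sub>0 z
             + \<langle>J x y u, one \<langle>z, v\<rangle>\<^sub>0\<rangle>\<^sub>1)
     \<cdot>\<^sub>2\<^sup>+ idc (J x \<langle>y, v\<rangle>\<^sub>0 \<langle>z, u\<rangle>\<^sub>0 + J \<langle>x, v\<rangle>\<^sub>0 y \<langle>z, u\<rangle>\<^sub>0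
              + J x \<langle>y, u\<rangle>\<^sub>0 \<langle>z, v\<rangle>\<^sub>0 + J \<langle>x, u\<rangle>\<^sub>0 y \<langle>z, v\<rangle>\<^sub>0)"

definition alpha2 :: "'a \<Rightarrow> 'a \<Rightarrow> 'a \<Rightarrow> 'a \<Rightarrow> 'a \<Rightarrow> 'c" where
  "alpha2 x y z u v =
     idc \<langle>\<langle>J x y z, one u\<rangle>\<^sub>1, one v\<rangle>\<^sub>1
     \<cdot>\<^sub>2 (\<mu> \<langle>x, z\<rangle>\<^sub>0 y u v + \<mu> x \<langle>y, z\<rangle>\<^sub>0 u v)
     \<cdot>\<^sub>2\<^sup>+ idc (\<langle>one x, J \<langle>y, z\<rangle>\<^sub>0 v u\<rangle>\<^sub>1 + \<langle>J \<langle>x, z\<rangle>\<^sub>0 v u, one y\<rangle>\<^sub>1)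
     \<cdot>\<^sub>2\<^sup>+ (\<langle>two x, \<mu> y z u v\<rangle>\<^sub>2 + \<langle>\<mu> x z u v, two y\<rangle>\<^sub>2)
     \<cdot>\<^sub>2\<^sup>+ idc (\<langle>J x z v, one \<langle>y, u\<rangle>\<^sub>0\<rangle>\<^sub>1 + \<langle>J x z u, one \<langle>y, v\<rangle>\<^sub>0\<rangle>\<^sub>1
              + \<langle>one \<langle>x, v\<rangle>\<^sub>0, J y z u\<rangle>\<^sub>1 + \<langle>one \<langle>x, u\<rangle>\<^sub>0, J y z v\<rangle>\<^sub>1)"

definition coherence :: bool where
  "coherence \<longleftrightarrow> (\<forall>x y z u v.
     alpha1 x y z u v + inverse21 (alpha4 x y z u v) =
     alpha3 x y z u v + inverse21 (alpha2 x y z u v))"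

end

definition lie_3_algebra ::
  "('k::field \<Rightarrow> 'a::ab_group_add \<Rightarrow> 'a) \<Rightarrow> ('k \<Rightarrow> 'b::ab_group_add \<Rightarrow> 'b) \<Rightarrow>
   ('k \<Rightarrow> 'c::ab_group_add \<Rightarrow> 'c) \<Rightarrow> ('a, 'b, 'c) lie3 \<Rightarrow> bool" where
  "lie_3_algebra sc0 sc1 sc2 L \<longleftrightarrow>
     linear_2_category sc0 sc1 sc2 L \<and>
     linear_2_functor sc0 sc1 sc2 L 2
       (on_pairs (bra0 L), on_pairs (bra1 L), on_pairs (bra2 L)) \<and>
     antisymmetric 2 (on_pairs (bra0 L)) \<and>
     antisymmetric 2 (on_pairs (bra1 L)) \<and>
     antisymmetric 2 (on_pairs (bra2 L)) \<and>
     linear_2_transformation sc0 sc1 sc2 L 3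
       (on_triples (jac_source (bra0 L)), on_triples (jac_source (bra1 L)),
        on_triples (jac_source (bra2 L)))
       (on_triples (jac_target (bra0 L)), on_triples (jac_target (bra1 L)),
        on_triples (jac_target (bra2 L)))
       (on_triples (jac L)) \<and>
     antisymmetric 3 (\<lambda>xs. part1 L (on_triples (jac L) xs)) \<and>
     linear_2_modification sc0 sc1 sc2 L 4
       (on_quadruples (ident_source (bra0 L)), on_quadruples (ident_source (bra1 L)),
        on_quadruples (ident_source (bra2 L)))
       (on_quadruples (ident_target (bra0 L)), on_quadruples (ident_target (bra1 L)),
        on_quadruples (ident_target (bra2 L)))
       (on_quadruples (lie3_cells.eta L)) (on_quadruples (lie3_cells.eps L))
       (on_quadruples (ident L)) \<and>
     antisymmetric 4 (\<lambda>xs. part2 L (on_quadruples (ident L) xs)) \<and>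
     lie3_cells.coherence L"

section \<open>3-term Lie infinity algebras\<close>

text \<open>The direct sum of three vector spaces, in degrees 0, 1 and 2, is their product type.\<close>

definition scale3 ::
  "('k \<Rightarrow> 'u \<Rightarrow> 'u) \<Rightarrow> ('k \<Rightarrow> 'v \<Rightarrow> 'v) \<Rightarrow> ('k \<Rightarrow> 'w \<Rightarrow> 'w) \<Rightarrow> 'k \<Rightarrow> 'u \<times> 'v \<times> 'w \<Rightarrow> 'u \<times> 'v \<times> 'w" where
  "scale3 sc0 sc1 sc2 r = (\<lambda>(x, f, a). (sc0 r x, sc1 r f, sc2 r a))"

definition grade :: "int \<Rightarrow> ('u::zero \<times> 'v::zero \<times> 'w::zero) set" where
  "grade d = {(x, f, a). (d \<noteq> 0 \<longrightarrow> x = 0) \<and> (d \<noteq> 1 \<longrightarrow> f = 0) \<and> (d \<noteq> 2 \<longrightarrow> a = 0)}"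

text \<open>
  \<open>homogeneous ds vs\<close>: the degrees of the entries of \<open>vs\<close> are listed by \<open>ds\<close>. Since 0 lies in
  every degree, the degrees are carried along explicitly.
\<close>

definition homogeneous :: "nat list \<Rightarrow> ('u::zero \<times> 'v::zero \<times> 'w::zero) list \<Rightarrow> bool" where
  "homogeneous ds vs \<longleftrightarrow> list_all2 (\<lambda>d v. v \<in> grade (int d)) ds vs"

text \<open>With indices starting at 0: permutations of \<open>{..<n}\<close> increasing on the first \<open>i\<close> and on the
  last \<open>n - i\<close> indices.\<close>

definition shuffle_perms :: "nat \<Rightarrow> nat \<Rightarrow> (nat \<Rightarrow> nat) set" where
  "shuffle_perms i n = {\<sigma>. \<sigma> permutes {..<n} \<and> strict_mono_on {..<i} \<sigma> \<and> strict_mono_on {i..<n} \<sigma>}"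

text \<open>The Koszul sign collects a factor \<open>(-1)^(\<bar>a\<bar> * \<bar>b\<bar>)\<close> for each pair of entries whose order is
  reversed by the rearrangement.\<close>

definition koszul_sign :: "nat list \<Rightarrow> (nat \<Rightarrow> nat) \<Rightarrow> int" where
  "koszul_sign ds \<sigma> =
     (\<Prod>(p, q)\<in>{(p, q). p < q \<and> q < length ds \<and> \<sigma> q < \<sigma> p}. (-1) ^ (ds ! \<sigma> p * ds ! \<sigma> q))"

definition chi :: "nat list \<Rightarrow> (nat \<Rightarrow> nat) \<Rightarrow> int" where
  "chi ds \<sigma> = sign \<sigma> * koszul_sign ds \<sigma>"

text \<open>
  All structure maps are packed into one function \<open>l\<close> on lists, the \<open>p\<close>-ary map being its
  restriction to lists of length \<open>p\<close>. In the homotopy Jacobi identities \<open>j = n + 1 - i\<close>, hence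
  \<open>j - 1 = n - i\<close>.
\<close>

definition lie_infinity_3 ::
  "('k::field \<Rightarrow> 'u::ab_group_add \<Rightarrow> 'u) \<Rightarrow> ('k \<Rightarrow> 'v::ab_group_add \<Rightarrow> 'v) \<Rightarrow>
   ('k \<Rightarrow> 'w::ab_group_add \<Rightarrow> 'w) \<Rightarrow> (('u \<times> 'v \<times> 'w) list \<Rightarrow> 'u \<times> 'v \<times> 'w) \<Rightarrow> bool" where
  "lie_infinity_3 sc0 sc1 sc2 l \<longleftrightarrow>
     (let sc = scale3 sc0 sc1 sc2 in
     vector_space sc0 \<and> vector_space sc1 \<and> vector_space sc2 \<and>
     (\<forall>vs. length vs = 0 \<or> length vs > 4 \<longrightarrow> l vs = 0) \<and>
     (\<forall>p\<in>{1..4}. multilinear p sc sc l) \<and>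
     (\<forall>ds vs. vs \<noteq> [] \<and> homogeneous ds vs \<longrightarrow>
        l vs \<in> grade (int (sum_list ds) + int (length vs) - 2)) \<and>
     (\<forall>d e vs v w ws. v \<in> grade (int d) \<and> w \<in> grade (int e) \<longrightarrow>
        l (vs @ v # w # ws) = sc (- ((-1) ^ (d * e))) (l (vs @ w # v # ws))) \<and>
     (\<forall>n ds vs. n \<ge> 1 \<and> length vs = n \<and> homogeneous ds vs \<longrightarrow>
        (\<Sum>i = 1..n. \<Sum>\<sigma>\<in>shuffle_perms i n.
           sc (of_int (chi ds \<sigma> * (-1) ^ (i * (n - i))))
             (l (l (map (\<lambda>p. vs ! \<sigma> p) [0..<i]) # map (\<lambda>p. vs ! \<sigma> p) [i..<n]))) = 0))"

definition vanishing_2_3 ::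
  "(('u::zero \<times> 'v::zero \<times> 'w::zero) list \<Rightarrow> 'u \<times> 'v \<times> 'w) \<Rightarrow> bool" where
  "vanishing_2_3 l \<longleftrightarrow>
     (\<forall>v w. homogeneous [1, 1] [v, w] \<longrightarrow> l [v, w] = 0) \<and>
     (\<forall>d e g u v w. homogeneous [d, e, g] [u, v, w] \<and> d + e + g = 1 \<longrightarrow> l [u, v, w] = 0)"

section \<open>The correspondence\<close>

text \<open>
  Identification of the graded vector space underlying a Lie infinity algebra with the kernels of
  the source maps of a linear 2-category: \<open>V0 = L0\<close>, and \<open>j1\<close>, \<open>j2\<close> identify \<open>V1\<close>, \<open>V2\<close> with
  \<open>ker s1\<close>, \<open>ker s2\<close>. The maps \<open>s1\<close>, \<open>s2\<close>, \<open>i0\<close>, \<open>i1\<close> are the source and identity maps, which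
  yield the decomposition of \<open>L1\<close> and \<open>L2\<close> into \<open>V0 + V1\<close> and \<open>V0 + V1 + V2\<close>.
\<close>

definition kernel_identification ::
  "('k::field \<Rightarrow> 'a::ab_group_add \<Rightarrow> 'a) \<Rightarrow> ('k \<Rightarrow> 'b::ab_group_add \<Rightarrow> 'b) \<Rightarrow>
   ('k \<Rightarrow> 'c::ab_group_add \<Rightarrow> 'c) \<Rightarrow> ('k \<Rightarrow> 'v::ab_group_add \<Rightarrow> 'v) \<Rightarrow>
   ('k \<Rightarrow> 'w::ab_group_add \<Rightarrow> 'w) \<Rightarrow> ('b \<Rightarrow> 'a) \<Rightarrow> ('c \<Rightarrow> 'b) \<Rightarrow> ('a \<Rightarrow> 'b) \<Rightarrow> ('b \<Rightarrow> 'c) \<Rightarrow>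
   ('v \<Rightarrow> 'b) \<Rightarrow> ('w \<Rightarrow> 'c) \<Rightarrow> bool" where
  "kernel_identification sc0 sc1 sc2 sv1 sv2 s1 s2 i0 i1 j1 j2 \<longleftrightarrow>
     Vector_Spaces.linear sc1 sc0 s1 \<and> Vector_Spaces.linear sc2 sc1 s2 \<and>
     Vector_Spaces.linear sc0 sc1 i0 \<and> Vector_Spaces.linear sc1 sc2 i1 \<and>
     (\<forall>x. s1 (i0 x) = x) \<and> (\<forall>f. s2 (i1 f) = f) \<and>
     Vector_Spaces.linear sv1 sc1 j1 \<and> inj j1 \<and> range j1 = {f. s1 f = 0} \<and>
     Vector_Spaces.linear sv2 sc2 j2 \<and> inj j2 \<and> range j2 = {\<alpha>. s2 \<alpha> = 0}"

text \<open>Every graded vector space occurs, with \<open>L1 = V0 \<times> V1\<close> and \<open>L2 = V0 \<times> V1 \<times> V2\<close>.\<close>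

lemma standard_kernel_identification:
  fixes sc0 :: "'k::field \<Rightarrow> 'u::ab_group_add \<Rightarrow> 'u"
    and sv1 :: "'k \<Rightarrow> 'v::ab_group_add \<Rightarrow> 'v" and sv2 :: "'k \<Rightarrow> 'w::ab_group_add \<Rightarrow> 'w"
  assumes "vector_space sc0" and "vector_space sv1" and "vector_space sv2"
  shows "kernel_identification sc0 (\<lambda>r (x, f). (sc0 r x, sv1 r f)) (scale3 sc0 sv1 sv2) sv1 sv2
           fst (\<lambda>(x, f, a). (x, f)) (\<lambda>x. (x, 0)) (\<lambda>(x, f). (x, f, 0))
           (\<lambda>f. (0, f)) (\<lambda>a. (0, 0, a))"
proof -
  interpret V0: vector_space sc0 by fact
  interpret V1: vector_space sv1 by fact
  interpret V2: vector_space sv2 by fact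
  have L1: "vector_space (\<lambda>r (x, f). (sc0 r x, sv1 r f))"
    by unfold_locales
      (auto simp: V0.scale_right_distrib V0.scale_left_distrib V1.scale_right_distrib
         V1.scale_left_distrib)
  have L2: "vector_space (scale3 sc0 sv1 sv2)"
    by unfold_locales
      (auto simp: scale3_def V0.scale_right_distrib V0.scale_left_distrib V1.scale_right_distrib
         V1.scale_left_distrib V2.scale_right_distrib V2.scale_left_distrib)
  show ?thesis
    unfolding kernel_identification_def Vector_Spaces.linear_iff
    using assms L1 L2 by (auto simp: scale3_def inj_def zero_prod_def image_iff)
qed

text \<open>
  With \<open>J\<close> and \<open>\<mu>\<close> replaced by their components in \<open>V1\<close> and \<open>V2\<close>: the unary map is the target
  map, the binary one is the bracket, the ternary one is \<open>J\<close> and the quaternary one is \<open>- \<mu>\<close>. The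
  last sign is forced by the homotopy Jacobi identity for \<open>n = 4\<close> and the orientation of \<open>\<mu>\<close>
  from \<open>\<eta>\<close> to \<open>\<epsilon>\<close>.
\<close>

fun lie3_to_lie_infinity ::
  "('v \<Rightarrow> 'b::ab_group_add) \<Rightarrow> ('w \<Rightarrow> 'c::ab_group_add) \<Rightarrow> ('a::ab_group_add, 'b, 'c) lie3 \<Rightarrow>
   ('a \<times> 'v::ab_group_add \<times> 'w::ab_group_add) list \<Rightarrow> 'a \<times> 'v \<times> 'w" where
  "lie3_to_lie_infinity j1 j2 L [(x, f, a)] =
     (tgt1 L (j1 f), inv j1 (tgt2 L (j2 a)), 0)"
| "lie3_to_lie_infinity j1 j2 L [(x, f, a), (y, g, b)] =
     (bra0 L x y,
      inv j1 (bra1 L (id0 L x) (j1 g) + bra1 L (j1 f) (id0 L y)),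
      inv j2 (bra2 L (iid L x) (j2 b) + bra2 L (j2 a) (iid L y)))"
| "lie3_to_lie_infinity j1 j2 L [(x, _), (y, _), (z, _)] =
     (0, inv j1 (part1 L (jac L x y z)), 0)"
| "lie3_to_lie_infinity j1 j2 L [(x, _), (y, _), (z, _), (u, _)] =
     (0, 0, - inv j2 (part2 L (ident L x y z u)))"
| "lie3_to_lie_infinity j1 j2 L _ = 0"

end

theory Submission
  imports Defs "HOL-Library.Sublist"
begin

text \<open>
  Both kinds of structure are encoded by the same finite list of multilinear maps on
  \<open>V0\<close>, \<open>V1\<close>, \<open>V2\<close>, called a skeleton here. On the side of
    Lie 3-algebras all compositions are
  determined by the vector space structure (\<open>a \<circ> b = a + b - 1\<close>), and the
    interchange law,
  applied to \<open>f = 1 \<circ> f = f \<circ> 1\<close>, expresses the bracket of two cells in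
    kernels of
  source maps by the action of \<open>V0\<close> on \<open>V1\<close> and shows that the brackets
    involving \<open>V2\<close> and \<open>V1\<close>
  vanish. On the side of Lie infinity algebras the degrees and the vanishing of \<open>l2\<close> on
  \<open>V1 \<times> V1\<close> and of \<open>l3\<close> in total degree 1 leave exactly the same
    maps. Naturality, the boundaries of
  \<open>J\<close> and \<open>\<mu>\<close> and the coherence law then become the homotopy Jacobi
    identities for \<open>n \<le> 5\<close>.
  The components of the coherence law in \<open>V0\<close> and \<open>V1\<close> hold
    automatically, so that only the
  component in \<open>V2\<close> is a condition, and it is the identity for \<open>n = 5\<close>.
\<close>

section \<open>Signs and shuffles\<close>

text \<open>The homotopy Jacobi identities are signed sums over sets of permutations, which
  rewriting cannot evaluate. They are therefore transported to explicit lists of shuffles, with the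
  signature replaced by the parity of inversions; the identities for up to five arguments are then
  computed by simplification. From six arguments on, and from four on as soon as one argument has no
  component in \<open>V0\<close>, each single term vanishes: maps of arity at least 3 see only
  \<open>V0\<close>-components and take no values in \<open>V0\<close>, and \<open>mm\<close>
  vanishes on boundaries. Neither direction of the correspondence is inverted by hand. Every Lie
  3-algebra with the prescribed source and identity maps is \<open>cells\<close> of a skeleton,
  every admissible Lie infinity structure is \<open>ell_maps\<close> of one, and the correspondence
  carries the first normal form to the second; it remains to see that \<open>ell_maps\<close>
  determines its skeleton. Since the source of \<mu> is built from the Jacobiator, the equations
  without \<open>mm\<close> form a locale of their own, in which these cells are computed before any
  condition on \<mu> is available.\<close>

definition pair_inversions :: "nat \<Rightarrow> (nat \<Rightarrow> nat) \<Rightarrow> (nat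
  \<times> nat) set" where
  "pair_inversions n \<sigma> = {(p, q). p < q \<and> q < n \<and> \<sigma> q < \<sigma> p}"

text \<open>The inverted pairs are (a, q) for a < q <= b and (p, b) for a < p < b, altogether 2 (b -
  a) - 1.\<close>

lemma inversions_transpose:
  assumes "a < b" "b < n"
  shows "odd (card (pair_inversions n (Transposition.transpose a b)))"
proof -
  have "pair_inversions n (Transposition.transpose a b) = Pair a ` {a<..b} \<union> (\<lambda>p.
    (p, b)) ` {a<..<b}"
    using assms by (auto simp: pair_inversions_def transpose_def split: if_splits)
  moreover have "card (Pair a ` {a<..b} \<union> (\<lambda>p. (p, b)) ` {a<..<b}) = (b - a) + (b -
    a - 1)"
    by (subst card_Un_disjoint) (auto simp: card_image inj_on_def)
  ultimately show ?thesis using assms by auto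
qed

text \<open>The product runs over all pairs p < q, with factor 1 for pairs in order, so that the
  products of two permutations share their index set and can be multiplied factorwise.\<close>

definition inv_parity :: "nat \<Rightarrow> (nat \<Rightarrow> nat) \<Rightarrow> int" where
  "inv_parity n \<sigma> = (\<Prod>(p, q)\<in>{(p, q). p < q \<and> q < n}. if \<sigma> q <
    \<sigma> p then -1 else 1)"

lemma finite_pairs [simp]: "finite {(p, q). p < q \<and> q < (n::nat)}"
  by (rule finite_subset[of _ "{..<n} \<times> {..<n}"]) auto

lemma inv_parity_transpose:
  assumes "a < b" "b < n"
  shows "inv_parity n (Transposition.transpose a b) = -1"
proof -
  have "inv_parity n \<sigma> = (\<Prod>e\<in>pair_inversions n \<sigma>. -1)" for \<sigma>
    unfolding inv_parity_def
    by (rule prod.mono_neutral_cong_right) (auto simp: pair_inversions_def split: if_splits)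
  then show ?thesis using inversions_transpose[OF assms] by simp
qed

text \<open>\<open>\<tau>\<close> permutes the unordered pairs of indices, and \<open>?r\<close> is
  this action on increasing pairs. After the product of \<open>\<sigma>\<close> is reindexed along
  \<open>?r\<close>, a pair is inverted by the composite exactly when one, but not both, of the two
  factors is -1.\<close>

lemma inv_parity_compose:
  assumes \<tau>: "\<tau> permutes {..<n}" and \<sigma>: "\<sigma> permutes {..<n}"
  shows "inv_parity n (\<sigma> \<circ> \<tau>) = inv_parity n \<sigma> * inv_parity n \<tau>"
proof -
  let ?P = "{(p, q). p < q \<and> q < n}"
  let ?r = "\<lambda>(p, q). if \<tau> p < \<tau> q then (\<tau> p, \<tau> q) else (\<tau> q,
    \<tau> p)"
  have lt: "\<tau> k < n \<longleftrightarrow> k < n" for k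
    using permutes_in_image[OF \<tau>, of k] by simp
  have inj: "\<tau> p = \<tau> q \<longleftrightarrow> p = q" and injs: "\<sigma> p = \<sigma> q
    \<longleftrightarrow> p = q" for p q
    using permutes_inj[OF \<tau>] permutes_inj[OF \<sigma>] by (auto dest: injD)
  have inj_r: "inj_on ?r ?P"
    by (auto simp: inj_on_def inj split: if_splits)
  moreover have sub: "?r ` ?P \<subseteq> ?P"
    by (auto simp: lt inj not_less le_less split: if_splits)
  ultimately have "?r ` ?P = ?P"
    by (simp add: endo_inj_surj)
  then have "inv_parity n \<sigma> = (\<Prod>(p, q)\<in>?r ` ?P. if \<sigma> q < \<sigma> p then -1
    else 1)"
    unfolding inv_parity_def by simp
  also have "\<dots> = (\<Prod>e\<in>?P. case ?r e of (p, q) \<Rightarrow> if \<sigma> q < \<sigma>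
    p then -1 else 1)"
    by (rule prod.reindex_cong[OF inj_r]) auto
  finally have "inv_parity n \<sigma> * inv_parity n \<tau> =
      (\<Prod>e\<in>?P. (case ?r e of (p, q) \<Rightarrow> if \<sigma> q < \<sigma> p then -1 else
        1) *
         (case e of (p, q) \<Rightarrow> if \<tau> q < \<tau> p then -1 else 1))"
    by (simp add: inv_parity_def prod.distrib)
  also have "\<dots> = inv_parity n (\<sigma> \<circ> \<tau>)"
    unfolding inv_parity_def
  proof (rule prod.cong, simp, clarify)
    fix p q :: nat
    assume "p < q"
    then show "(case if \<tau> p < \<tau> q then (\<tau> p, \<tau> q) else (\<tau> q, \<tau> p) of
          (p, q) \<Rightarrow> if \<sigma> q < \<sigma> p then - 1 else 1) * (if \<tau> q < \<tau>
            p then - 1 else 1) =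
        (if (\<sigma> \<circ> \<tau>) q < (\<sigma> \<circ> \<tau>) p then - 1 else (1::int))"
      using inj[of p q] injs[of "\<tau> p" "\<tau> q"]
      by (cases "\<tau> p < \<tau> q"; cases "\<sigma> (\<tau> p) < \<sigma> (\<tau> q)") auto
  qed
  finally show ?thesis by simp
qed

lemma sign_eq_inv_parity:
  assumes "\<sigma> permutes {..<n}"
  shows "sign \<sigma> = inv_parity n \<sigma>"
  using assms finite_lessThan
proof (induction rule: permutes_induct)
  show "sign id = inv_parity n id"
    by (auto simp: inv_parity_def case_prod_beta intro!: prod.neutral[symmetric])
next
  fix a b :: nat and p
  assume ab: "a \<in> {..<n}" "b \<in> {..<n}" "a \<noteq> b" and p: "sign p = inv_parity n p" "p
    permutes {..<n}"
  have t: "Transposition.transpose a b permutes {..<n}"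
    using ab by (simp add: permutes_swap_id)
  have "inv_parity n (Transposition.transpose a b) = -1"
    using ab inv_parity_transpose[of a b n] inv_parity_transpose[of b a n]
    by (cases "a < b") (auto simp: transpose_commute)
  moreover have "permutation (Transposition.transpose a b)" "permutation p"
    using t p(2) by (auto simp: permutation_permutes)
  ultimately show "sign (Transposition.transpose a b \<circ> p) = inv_parity n
    (Transposition.transpose a b \<circ> p)"
    using ab p t by (simp add: sign_compose inv_parity_compose sign_swap_id)
qed

text \<open>Signature and Koszul sign merge into one product over pairs. Its nested form unfolds by
  rewriting once n is a numeral.\<close>

lemma chi_eq_prod:
  assumes "\<sigma> permutes {..<n}" "length ds = n"
  shows "chi ds \<sigma> =
    (\<Prod>q<n. \<Prod>p<q. if \<sigma> q < \<sigma> p then - ((-1) ^ (ds ! \<sigma> p * ds !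
      \<sigma> q)) else 1)"
proof -
  let ?P = "{(p, q). p < q \<and> q < n}"
  have "koszul_sign ds \<sigma> =
      (\<Prod>(p, q)\<in>?P. if \<sigma> q < \<sigma> p then (-1) ^ (ds ! \<sigma> p * ds !
        \<sigma> q) else 1)"
    unfolding koszul_sign_def assms
    by (rule prod.mono_neutral_cong_left) (auto split: if_splits)
  then have "chi ds \<sigma> = (\<Prod>(p, q)\<in>?P. if \<sigma> q < \<sigma> p then - ((-1) ^ (ds
    ! \<sigma> p * ds ! \<sigma> q)) else 1)"
    unfolding chi_def sign_eq_inv_parity[OF assms(1)] inv_parity_def
    by (auto simp flip: prod.distrib intro!: prod.cong)
  also have "\<dots> = (\<Prod>(q, p)\<in>(SIGMA q:{..<n}. {..<q}). if \<sigma> q < \<sigma> p then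
    - ((-1) ^ (ds ! \<sigma> p * ds ! \<sigma> q)) else 1)"
    by (rule prod.reindex_bij_witness[of _ "\<lambda>(a, b). (b, a)" "\<lambda>(a, b). (b, a)"])
      auto
  also have "\<dots> = (\<Prod>q<n. \<Prod>p<q. if \<sigma> q < \<sigma> p then - ((-1) ^ (ds !
    \<sigma> p * ds ! \<sigma> q)) else 1)"
    by (subst prod.Sigma) auto
  finally show ?thesis .
qed

section \<open>Shuffles as explicit lists\<close>

definition shuffle_lists :: "nat \<Rightarrow> nat \<Rightarrow> nat list list" where
  "shuffle_lists i n =
     map (\<lambda>ks. ks @ filter (\<lambda>k. k \<notin> set ks) [0..<n]) (filter (\<lambda>ks.
       length ks = i) (subseqs [0..<n]))"

lemma distinct_shuffle_lists: "distinct (shuffle_lists i n)"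
proof -
  have "distinct (subseqs [0..<n])"
    by (rule distinct_set_subseqs[THEN distinct_map[THEN iffD1, THEN conjunct1]]) simp
  then show ?thesis
    by (auto simp: shuffle_lists_def distinct_map inj_on_def)
qed

text \<open>An increasing list is determined by its set, so the last n - i values of a shuffle are
  the increasing list of what the first i values leave over.\<close>

lemma set_shuffle_lists:
  assumes "i \<le> n"
  shows "(\<lambda>\<sigma>. map \<sigma> [0..<n]) ` shuffle_perms i n = set (shuffle_lists i n)"
    (is "?f ` _ = _")
proof (intro equalityI subsetI)
  fix xs assume "xs \<in> ?f ` shuffle_perms i n"
  then obtain \<sigma> where \<sigma>: "\<sigma> permutes {..<n}" and mono: "strict_mono_on {..<i}
    \<sigma>" "strict_mono_on {i..<n} \<sigma>"
    and xs: "xs = map \<sigma> [0..<n]"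
    by (auto simp: shuffle_perms_def)
  let ?ks = "map \<sigma> [0..<i]" and ?ls = "map \<sigma> [i..<n]"
  have sorted: "sorted_wrt (<) ?ks" "sorted_wrt (<) ?ls"
    using mono by (auto simp: sorted_wrt_map strict_mono_on_def intro!: sorted_wrt_mono_rel[OF _
      sorted_wrt_upt])
  have xs': "xs = ?ks @ ?ls"
    using assms upt_add_eq_append[of 0 i "n - i"] by (simp add: xs)
  have img: "\<sigma> ` {..<n} = {..<n}"
    using \<sigma> by (rule permutes_image)
  have "set ?ls = \<sigma> ` ({..<n} - {..<i})"
    using assms by (auto simp: image_iff)
  also have "\<dots> = \<sigma> ` {..<n} - \<sigma> ` {..<i}"
    using permutes_inj[OF \<sigma>] by (rule image_set_diff)
  finally have "set ?ls = set (filter (\<lambda>k. k \<notin> set ?ks) [0..<n])"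
    unfolding img by (auto simp: atLeast0LessThan)
  then have ls: "?ls = filter (\<lambda>k. k \<notin> set ?ks) [0..<n]"
    by (intro sorted_distinct_set_unique)
      (use sorted in \<open>auto simp: strict_sorted_iff sorted_wrt_filter\<close>)
  have "\<sigma> ` {..<i} \<subseteq> \<sigma> ` {..<n}"
    using assms by auto
  then have "set ?ks \<subseteq> set [0..<n]"
    unfolding img by (auto simp: image_subset_iff)
  then have "?ks \<in> set (subseqs [0..<n])"
    using sorted(1) by (simp add: sorted_subset_imp_subseq)
  then show "xs \<in> set (shuffle_lists i n)"
    unfolding shuffle_lists_def xs' ls set_map set_filter
    by (intro image_eqI[of _ _ ?ks]) auto
next
  fix xs assume "xs \<in> set (shuffle_lists i n)"
  then obtain ks where ks: "ks \<in> set (subseqs [0..<n])" "length ks = i"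
    and xs: "xs = ks @ filter (\<lambda>k. k \<notin> set ks) [0..<n]"
    by (auto simp: shuffle_lists_def)
  let ?ls = "filter (\<lambda>k. k \<notin> set ks) [0..<n]"
  obtain N where N: "ks = nths [0..<n] N"
    using ks(1) by (auto simp: subseq_conv_nths)
  have sorted: "sorted_wrt (<) ks" "sorted_wrt (<) ?ls"
    unfolding N by (simp_all add: strict_sorted_iff sorted_nths sorted_wrt_filter)
  have "set ks \<subseteq> {..<n}"
    using set_nths_subset[of "[0..<n]" N] by (auto simp: N)
  then have xs_set: "set xs = {..<n}"
    by (auto simp: xs)
  have dist: "distinct xs"
    using sorted(1) by (auto simp: xs strict_sorted_iff)
  then have len: "length xs = n"
    using distinct_card[of xs] xs_set by simp
  \<comment> \<open>Outside {..<n} the list gives no values; there the identity is what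
    \<open>permutes\<close> demands.\<close>
  let ?\<sigma> = "\<lambda>k. if k < n then xs ! k else k"
  have "bij_betw ((!) xs) {..<n} {..<n}"
    using bij_betw_nth[OF dist] xs_set len by auto
  then have "bij_betw ?\<sigma> {..<n} {..<n}"
    by (rule bij_betw_cong[THEN iffD1, rotated]) simp
  then have "?\<sigma> permutes {..<n}"
    by (rule bij_imp_permutes) simp
  moreover have "strict_mono_on {..<i} ?\<sigma>"
  proof (rule strict_mono_onI)
    fix p q assume "p \<in> {..<i}" "q \<in> {..<i}" "p < q"
    then show "?\<sigma> p < ?\<sigma> q"
      using sorted_wrt_nth_less[OF sorted(1), of p q] assms ks(2)
      by (auto simp: xs nth_append)
  qed
  moreover have "strict_mono_on {i..<n} ?\<sigma>"
  proof (rule strict_mono_onI)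
    fix p q assume "p \<in> {i..<n}" "q \<in> {i..<n}" "p < q"
    then show "?\<sigma> p < ?\<sigma> q"
      using sorted_wrt_nth_less[OF sorted(2), of "p - i" "q - i"] len ks(2)
      by (auto simp: xs nth_append)
  qed
  moreover have "xs = map ?\<sigma> [0..<n]"
    using len by (auto intro: nth_equalityI)
  ultimately show "xs \<in> ?f ` shuffle_perms i n"
    by (auto simp: shuffle_perms_def)
qed

lemma sum_shuffle_perms:
  assumes "i \<le> n"
  shows "(\<Sum>\<sigma>\<in>shuffle_perms i n. F (map \<sigma> [0..<n])) =
    (\<Sum>xs\<leftarrow>shuffle_lists i n. F xs)"
proof -
  have "inj_on (\<lambda>\<sigma>. map \<sigma> [0..<n]) (shuffle_perms i n)"
  proof (rule inj_onI, rule ext)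
    fix \<sigma> \<tau> k
    assume "\<sigma> \<in> shuffle_perms i n" "\<tau> \<in> shuffle_perms i n" "map \<sigma>
      [0..<n] = map \<tau> [0..<n]"
    then show "\<sigma> k = \<tau> k"
      by (cases "k < n") (auto simp: shuffle_perms_def permutes_not_in)
  qed
  then show ?thesis
    by (simp add: sum_list_distinct_conv_sum_set distinct_shuffle_lists sum.reindex flip:
      set_shuffle_lists[OF assms])
qed

section \<open>Homotopy Jacobi sums as sums over lists\<close>

definition list_chi :: "nat list \<Rightarrow> nat list \<Rightarrow> int" where
  "list_chi ds xs =
     (\<Prod>q<length xs. \<Prod>p<q. if xs ! q < xs ! p then - ((-1) ^ (ds ! (xs ! p) * ds ! (xs !
       q))) else 1)"

definition homotopy_summand where
  "homotopy_summand sc l ds vs i xs =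
     sc (of_int (list_chi ds xs * (-1) ^ (i * (length vs - i))))
       (l (l (map ((!) vs) (take i xs)) # map ((!) vs) (drop i xs)))"

lemma homotopy_sum_eq:
  assumes "length vs = n" "length ds = n"
  shows "(\<Sum>i = 1..n. \<Sum>\<sigma>\<in>shuffle_perms i n.
      sc (of_int (chi ds \<sigma> * (-1) ^ (i * (n - i))))
        (l (l (map (\<lambda>p. vs ! \<sigma> p) [0..<i]) # map (\<lambda>p. vs ! \<sigma> p)
          [i..<n]))) =
    (\<Sum>i = 1..n. \<Sum>xs\<leftarrow>shuffle_lists i n. homotopy_summand sc l ds vs i xs)"
proof (rule sum.cong)
  fix i assume i: "i \<in> {1..n}"
  have "sc (of_int (chi ds \<sigma> * (-1) ^ (i * (n - i))))
        (l (l (map (\<lambda>p. vs ! \<sigma> p) [0..<i]) # map (\<lambda>p. vs ! \<sigma> p)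
          [i..<n])) =
      homotopy_summand sc l ds vs i (map \<sigma> [0..<n])"
    if "\<sigma> \<in> shuffle_perms i n" for \<sigma>
  proof -
    have "chi ds \<sigma> = list_chi ds (map \<sigma> [0..<n])"
      using that assms(2)
      by (auto simp: list_chi_def shuffle_perms_def chi_eq_prod intro!: prod.cong)
    moreover have "take i (map \<sigma> [0..<n]) = map \<sigma> [0..<i]" "drop i (map \<sigma>
      [0..<n]) = map \<sigma> [i..<n]"
      using i by (auto simp: take_map drop_map)
    ultimately show ?thesis
      using assms(1) by (simp add: homotopy_summand_def comp_def)
  qed
  then show "(\<Sum>\<sigma>\<in>shuffle_perms i n. sc (of_int (chi ds \<sigma> * (-1) ^ (i * (n -
    i))))
        (l (l (map (\<lambda>p. vs ! \<sigma> p) [0..<i]) # map (\<lambda>p. vs ! \<sigma> p)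
          [i..<n]))) =
      (\<Sum>xs\<leftarrow>shuffle_lists i n. homotopy_summand sc l ds vs i xs)"
    using i sum_shuffle_perms[of i n "homotopy_summand sc l ds vs i"] by simp
qed simp

definition homotopy_sum where
  "homotopy_sum sc l ds vs =
     (\<Sum>i = 1..length vs. \<Sum>xs\<leftarrow>shuffle_lists i (length vs). homotopy_summand sc
       l ds vs i xs)"

text \<open>The left side copies the last clause of \<open>lie_infinity_3\<close>, so that
  \<open>unfolding\<close> can rewrite it. Homogeneity makes \<open>ds\<close> and \<open>vs\<close>
  equally long.\<close>

lemma homotopy_sum_all_iff:
  "(\<forall>n ds vs. n \<ge> 1 \<and> length vs = n \<and> homogeneous ds vs \<longrightarrow>
      (\<Sum>i = 1..n. \<Sum>\<sigma>\<in>shuffle_perms i n. sc (of_int (chi ds \<sigma> * (-1) ^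
        (i * (n - i))))
        (l (l (map (\<lambda>p. vs ! \<sigma> p) [0..<i]) # map (\<lambda>p. vs ! \<sigma> p)
          [i..<n]))) = 0) \<longleftrightarrow>
   (\<forall>ds vs. vs \<noteq> [] \<and> homogeneous ds vs \<longrightarrow> homotopy_sum sc l ds
     vs = 0)"
  (is "?L \<longleftrightarrow> ?R")
proof
  assume L: ?L
  show ?R
  proof (intro allI impI)
    fix ds :: "nat list" and vs :: "('a \<times> 'b \<times> 'c) list" assume A: "vs \<noteq> []
      \<and> homogeneous ds vs"
    then have "length vs \<ge> 1" "length ds = length vs"
      by (auto simp: homogeneous_def list_all2_lengthD Suc_le_eq)
    then show "homotopy_sum sc l ds vs = 0"
      using A L[rule_format, of "length vs" vs ds] homotopy_sum_eq[of vs "length vs" ds sc l]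
      by (simp add: homotopy_sum_def)
  qed
next
  assume R: ?R
  show ?L
  proof (intro allI impI)
    fix n and ds :: "nat list" and vs :: "('a \<times> 'b \<times> 'c) list" assume A: "n \<ge> 1
      \<and> length vs = n \<and> homogeneous ds vs"
    then have "vs \<noteq> []" "length ds = n"
      by (auto simp: homogeneous_def list_all2_lengthD)
    then show "(\<Sum>i = 1..n. \<Sum>\<sigma>\<in>shuffle_perms i n. sc (of_int (chi ds \<sigma> *
      (-1) ^ (i * (n - i))))
        (l (l (map (\<lambda>p. vs ! \<sigma> p) [0..<i]) # map (\<lambda>p. vs ! \<sigma> p)
          [i..<n]))) = 0"
      using R[rule_format, of vs ds] A homotopy_sum_eq[of vs n ds sc l] by (simp add:
        homotopy_sum_def)
  qed
qed

text \<open>Evaluation rules for a concrete number of arguments: numerals become successors, so that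
  ranges, subsequences and the double products of signs unfold completely.\<close>

lemmas homotopy_eval = homotopy_sum_def homotopy_summand_def list_chi_def shuffle_lists_def
  numeral_eq_Suc lessThan_Suc upt_rec atLeastAtMostSuc_conv

section \<open>Multilinear maps of small arity\<close>

lemma multilinear_1:
  "multilinear (Suc 0) s1 s2 F \<longleftrightarrow> Vector_Spaces.linear s1 s2 (\<lambda>x. F [x])"
  by (simp add: multilinear_def)

lemma all_split_length_1:
  fixes P :: "'a list \<Rightarrow> 'a list \<Rightarrow> bool"
  shows "(\<forall>xs ys. length xs + length ys = Suc 0 \<longrightarrow> P xs ys)
    \<longleftrightarrow> (\<forall>a. P [] [a]) \<and> (\<forall>a. P [a] [])" (is "?L = ?R")
proof
  assume R: ?R
  have "P xs ys" if "length xs + length ys = Suc 0" for xs ys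
    using that R by (cases xs) (auto simp: length_Suc_conv)
  then show ?L by simp
qed simp

text \<open>Repeated use puts the distinguished arguments into each position in turn, so that
  multilinearity and antisymmetry of a given arity become finite conjunctions.\<close>

lemma all_split_length_Suc:
  "(\<forall>xs ys. length xs + length ys = Suc n \<longrightarrow> P xs ys) \<longleftrightarrow>
    (\<forall>ys. length ys = Suc n \<longrightarrow> P [] ys) \<and> (\<forall>xs ys. length xs +
      length ys = n \<longrightarrow> (\<forall>a. P (a # xs) ys))"
  (is "?L = ?R")
proof
  assume R: ?R
  have "P xs ys" if "length xs + length ys = Suc n" for xs ys
    using R that by (cases xs) auto
  then show ?L by simp
qed simp

lemma all_length_Suc:
  "(\<forall>xs. length xs = Suc n \<longrightarrow> P xs) \<longleftrightarrow> (\<forall>x xs.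
    length xs = n \<longrightarrow> P (x # xs))"
  by (auto simp: length_Suc_conv)

lemma all_length_0: "(\<forall>xs. length xs = 0 \<longrightarrow> P xs) \<longleftrightarrow> P []"
  by simp

lemmas all_length = all_split_length_1 all_split_length_Suc all_length_Suc all_length_0
  eval_nat_numeral

lemma multilinear_2:
  "multilinear 2 s1 s2 F \<longleftrightarrow>
     (\<forall>a. Vector_Spaces.linear s1 s2 (\<lambda>x. F [x, a])) \<and> (\<forall>a.
       Vector_Spaces.linear s1 s2 (\<lambda>x. F [a, x]))"
  unfolding multilinear_def by (simp add: all_length)

lemma multilinear_3:
  "multilinear 3 s1 s2 F \<longleftrightarrow>
     (\<forall>a b. Vector_Spaces.linear s1 s2 (\<lambda>x. F [x, a, b])) \<and>
     (\<forall>b a. Vector_Spaces.linear s1 s2 (\<lambda>x. F [a, x, b])) \<and>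
     (\<forall>b a. Vector_Spaces.linear s1 s2 (\<lambda>x. F [a, b, x]))"
  unfolding multilinear_def by (simp add: all_length)

lemma multilinear_4:
  "multilinear 4 s1 s2 F \<longleftrightarrow>
     (\<forall>a b c. Vector_Spaces.linear s1 s2 (\<lambda>x. F [x, a, b, c])) \<and>
     (\<forall>b c a. Vector_Spaces.linear s1 s2 (\<lambda>x. F [a, x, b, c])) \<and>
     (\<forall>c b a. Vector_Spaces.linear s1 s2 (\<lambda>x. F [a, b, x, c])) \<and>
     (\<forall>c b a. Vector_Spaces.linear s1 s2 (\<lambda>x. F [a, b, c, x]))"
  unfolding multilinear_def by (simp add: all_length)

lemma antisymmetric_iff:
  "antisymmetric k F \<longleftrightarrow> (\<forall>xs ys. length xs + length ys + 2 = k
    \<longrightarrow>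
     (\<forall>a b. F (xs @ a # b # ys) = - F (xs @ b # a # ys)))"
  by (auto simp: antisymmetric_def)

lemma antisymmetric_2: "antisymmetric 2 F \<longleftrightarrow> (\<forall>a b. F [a, b] = - F [b,
  a])"
  by (auto simp: antisymmetric_def)

lemma antisymmetric_3:
  "antisymmetric 3 F \<longleftrightarrow>
     (\<forall>c a b. F [a, b, c] = - F [b, a, c]) \<and> (\<forall>a b c. F [a, b, c] = - F [a, c,
       b])"
  unfolding antisymmetric_iff by (simp add: all_length)

lemma antisymmetric_4:
  "antisymmetric 4 F \<longleftrightarrow>
     (\<forall>c d a b. F [a, b, c, d] = - F [b, a, c, d]) \<and> (\<forall>d a b c. F [a, b, c, d]
       = - F [a, c, b, d]) \<and>
     (\<forall>b a c d. F [a, b, c, d] = - F [a, b, d, c])"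
  unfolding antisymmetric_iff by (simp add: all_length)

section \<open>Skeletons\<close>

text \<open>
  \<open>d1\<close>, \<open>d2\<close> are the differentials, \<open>br\<close> is the bracket of
    \<open>V0\<close>, \<open>r1\<close> and \<open>r2\<close> are its actions on
  \<open>V1\<close> and \<open>V2\<close>, and \<open>jj\<close>, \<open>mm\<close> are the
    components of \<open>J\<close> in \<open>V1\<close> and of \<open>\<mu>\<close> in
    \<open>V2\<close>.
\<close>

fun ell_maps where
  "ell_maps d1 d2 br r1 r2 jj mm [(x, f, a)] = (d1 f, d2 a, 0)"
| "ell_maps d1 d2 br r1 r2 jj mm [(x, f, a), (y, g, b)] =
     (br x y, r1 x g - r1 y f, r2 x b - r2 y a)"
| "ell_maps d1 d2 br r1 r2 jj mm [(x, f, a), (y, g, b), (z, h, c)] = (0, jj x y z, 0)"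
| "ell_maps d1 d2 br r1 r2 jj mm [(x, f, a), (y, g, b), (z, h, c), (u, k, e)] =
     (0, 0, - mm x y z u)"
| "ell_maps d1 d2 br r1 r2 jj mm _ = 0"

locale skeleton =
  fixes sc0 :: "'k::field \<Rightarrow> 'a::ab_group_add \<Rightarrow> 'a"
    and sv1 :: "'k \<Rightarrow> 'v::ab_group_add \<Rightarrow> 'v" and sv2 :: "'k \<Rightarrow>
      'w::ab_group_add \<Rightarrow> 'w"
    and d1 :: "'v \<Rightarrow> 'a" and d2 :: "'w \<Rightarrow> 'v" and br :: "'a \<Rightarrow> 'a
      \<Rightarrow> 'a"
    and r1 :: "'a \<Rightarrow> 'v \<Rightarrow> 'v" and r2 :: "'a \<Rightarrow> 'w \<Rightarrow>
      'w"
    and jj :: "'a \<Rightarrow> 'a \<Rightarrow> 'a \<Rightarrow> 'v" and mm :: "'a \<Rightarrow>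
      'a \<Rightarrow> 'a \<Rightarrow> 'a \<Rightarrow> 'w"
  assumes d1_linear: "Vector_Spaces.linear sv1 sc0 d1"
    and d2_linear: "Vector_Spaces.linear sv2 sv1 d2"
    and br_linear: "Vector_Spaces.linear sc0 sc0 (br x)"
    and br_swap: "br x y = - br y x"
    and r1_linear: "Vector_Spaces.linear sv1 sv1 (r1 x)"
    and r1_linear_left: "Vector_Spaces.linear sc0 sv1 (\<lambda>x. r1 x f)"
    and r2_linear: "Vector_Spaces.linear sv2 sv2 (r2 x)"
    and r2_linear_left: "Vector_Spaces.linear sc0 sv2 (\<lambda>x. r2 x a)"
    and jj_linear: "Vector_Spaces.linear sc0 sv1 (jj x y)"
    and jj_swap: "jj x y z = - jj y x z" "jj x y z = - jj x z y"
    and mm_linear: "Vector_Spaces.linear sc0 sv2 (mm x y z)"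
    and mm_swap: "mm x y z u = - mm y x z u" "mm x y z u = - mm x z y u" "mm x y z u = - mm x y u z"
begin

sublocale V0: vector_space sc0 using d1_linear by (simp add: Vector_Spaces.linear_iff)
sublocale V1: vector_space sv1 using d1_linear by (simp add: Vector_Spaces.linear_iff)
sublocale V2: vector_space sv2 using d2_linear by (simp add: Vector_Spaces.linear_iff)

text \<open>Here and in the next five lemmas antisymmetry carries linearity from the last slot to
  the others.\<close>

lemma br_linear_left: "Vector_Spaces.linear sc0 sc0 (\<lambda>x. br x y)"
  using br_linear[of y] unfolding br_swap[of _ y] by (simp add: Vector_Spaces.linear_iff)

lemma jj_linear_mid: "Vector_Spaces.linear sc0 sv1 (\<lambda>y. jj x y z)"
  using jj_linear[of x z] unfolding jj_swap(2)[of x _ z] by (simp add: Vector_Spaces.linear_iff)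

lemma jj_linear_left: "Vector_Spaces.linear sc0 sv1 (\<lambda>x. jj x y z)"
  using jj_linear_mid[of y z] unfolding jj_swap(1)[of _ y z] by (simp add: Vector_Spaces.linear_iff)

lemma mm_linear_3: "Vector_Spaces.linear sc0 sv2 (\<lambda>z. mm x y z u)"
  using mm_linear[of x y u] unfolding mm_swap(3)[of x y _ u] by (simp add: Vector_Spaces.linear_iff)

lemma mm_linear_2: "Vector_Spaces.linear sc0 sv2 (\<lambda>y. mm x y z u)"
  using mm_linear_3[of x z u] unfolding mm_swap(2)[of x _ z u] by (simp add:
    Vector_Spaces.linear_iff)

lemma mm_linear_1: "Vector_Spaces.linear sc0 sv2 (\<lambda>x. mm x y z u)"
  using mm_linear_2[of y z u] unfolding mm_swap(1)[of _ y z u] by (simp add: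
    Vector_Spaces.linear_iff)

lemmas linears = d1_linear d2_linear br_linear br_linear_left r1_linear r1_linear_left
  r2_linear r2_linear_left jj_linear jj_linear_mid jj_linear_left
  mm_linear mm_linear_3 mm_linear_2 mm_linear_1

lemmas module_homs = linears[THEN Vector_Spaces.linear.axioms(3)]
lemmas additive [simp] =
  module_homs[THEN module_hom.add] module_homs[THEN module_hom.neg]
  module_homs[THEN module_hom.diff] module_homs[THEN module_hom.zero]
lemmas scales [simp] = module_homs[THEN module_hom.scale]

lemma scale3_vector_space: "vector_space (scale3 sc0 sv1 sv2)"
  by unfold_locales
    (auto simp: scale3_def V0.scale_right_distrib V0.scale_left_distrib V1.scale_right_distrib
      V1.scale_left_distrib V2.scale_right_distrib V2.scale_left_distrib)

sublocale V: vector_space "scale3 sc0 sv1 sv2" by (rule scale3_vector_space)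

abbreviation "l \<equiv> ell_maps d1 d2 br r1 r2 jj mm"

lemma ell_maps_linear:
  assumes "p \<in> {1..4}"
  shows "multilinear p (scale3 sc0 sv1 sv2) (scale3 sc0 sv1 sv2) l"
proof -
  have "p = Suc 0 \<or> p = 2 \<or> p = 3 \<or> p = 4" using assms by auto
  then show ?thesis
    by (elim disjE; simp add: multilinear_1 multilinear_2 multilinear_3 multilinear_4
      Vector_Spaces.linear_iff
      scale3_vector_space scale3_def algebra_simps V1.scale_right_diff_distrib
      V2.scale_right_diff_distrib)
qed

section \<open>Homotopy Jacobi sums in terms of the structure maps\<close>

lemma homotopy_sum_1: "homotopy_sum (scale3 sc0 sv1 sv2) l [d] [(x,f,a)] = (d1 (d2 a), 0, 0)"
  by (simp add: homotopy_eval)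

lemma homotopy_sum_2: "homotopy_sum (scale3 sc0 sv1 sv2) l [d, e] [(x, f, a), (y, g, b)] =
    (d1 (r1 x g) - d1 (r1 y f), d2 (r2 x b) - d2 (r2 y a), 0) +
     ((- br (d1 f) y, r1 y (d2 a) - r1 (d1 f) g, - r2 (d1 f) b) +
      scale3 sc0 sv1 sv2 ((- 1) ^ (e * d)) (br (d1 g) x, r1 (d1 g) f - r1 x (d2 b), r2 (d1 g) a))"
  by (simp add: homotopy_eval)

lemma homotopy_sum_3: "homotopy_sum (scale3 sc0 sv1 sv2) l [d, e, k] [(x, f, a), (y, g, b), (z, h,
  c)] =
   (d1 (jj x y z), 0, 0) +
     ((br (br x y) z, r1 (br x y) h - (r1 z (r1 x g) - r1 z (r1 y f)),
       r2 (br x y) c - (r2 z (r2 x b) - r2 z (r2 y a))) +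
      (scale3 sc0 sv1 sv2 ((- 1) ^ (k * d) * (- 1) ^ (e * d))
        (br (br y z) x, r1 (br y z) f - (r1 x (r1 y h) - r1 x (r1 z g)),
         r2 (br y z) a - (r2 x (r2 y c) - r2 x (r2 z b))) -
       scale3 sc0 sv1 sv2 ((- 1) ^ (k * e))
        (br (br x z) y, r1 (br x z) g - (r1 y (r1 x h) - r1 y (r1 z f)),
         r2 (br x z) b - (r2 y (r2 x c) - r2 y (r2 z a)))) +
      ((0, jj (d1 f) y z, 0) +
       (scale3 sc0 sv1 sv2 ((- 1) ^ (k * e) * (- 1) ^ (k * d)) (0, jj (d1 h) x y, 0) -
        scale3 sc0 sv1 sv2 ((- 1) ^ (e * d)) (0, jj (d1 g) x z, 0))))"
  by (simp add: homotopy_eval)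

text \<open>Homotopy sums insert the inner map as first argument. These instances of antisymmetry
  move a bracket there; an unrestricted swap would loop.\<close>

lemma jj_rotate: "jj x (br y y') z = - jj (br y y') x z" "jj x y (br z z') = jj (br z z') x y"
  using jj_swap(2)[of x y] jj_swap(1)[of x "br z z'" y] by (simp_all add: jj_swap(1)[of x])

lemma mm_rotate: "mm x (br y y') z u = - mm (br y y') x z u"
  "mm x y (br z z') u = mm (br z z') x y u" "mm x y z (br u u') = - mm (br u u') x y z"
  using mm_swap(3)[of x y z] mm_swap(2)[of x y _ z] mm_swap(2)[of x y _ u]
  by (simp_all add: mm_swap(1)[of x "br _ _"])

text \<open>
  The components in \<open>V1\<close> of \<open>\<eta>\<close> and \<open>\<epsilon>\<close>, and
    the component in \<open>V2\<close> of the difference of the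
  two sides of the coherence law.
\<close>

definition eta_part where
  "eta_part x y z u = - r1 u (jj x y z) + (jj (br x z) y u + jj x (br y z) u) - r1 y (jj x z u)
     + r1 x (jj y z u)"

definition eps_part where
  "eps_part x y z u = jj (br x y) z u - r1 z (jj x y u)
     + (jj x (br y u) z + jj (br x u) y z + jj x y (br z u))"

definition coherence_part where
  "coherence_part x y z u v =
     (mm x y z (br u v) - r2 u (mm x y z v)
       + (mm (br x v) y z u + mm x (br y v) z u + mm x y (br z v) u)
     - (- r2 v (mm x y z u) + (mm (br x u) y z v + mm x (br y u) z v + mm x y (br z u) v))
     - (mm (br x y) z u v - r2 z (mm x y u v))
     + (mm (br x z) y u v + mm x (br y z) u v + (r2 x (mm y z u v) - r2 y (mm x z u v))))"

text \<open>The sums for two and three arguments keep the degrees as variables. From four arguments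
  on only degree 0 is expanded, because positive degrees fall under
  \<open>homotopy_sum_vanish\<close>.\<close>

lemma homotopy_sum_4: "homotopy_sum (scale3 sc0 sv1 sv2) l [0, 0, 0, 0] [(x, f, a), (y, g, b), (z,
  h, c), (u, k, e)] =
    (0, eps_part x y z u - eta_part x y z u - d2 (mm x y z u),
     mm (d1 f) y z u + (mm (d1 h) x y u - mm (d1 k) x y z - mm (d1 g) x z u))"
  by (simp add: homotopy_eval eta_part_def eps_part_def jj_rotate)

lemma homotopy_sum_5: "homotopy_sum (scale3 sc0 sv1 sv2) l [0, 0, 0, 0, 0]
    [(x, f, a), (y, g, b), (z, h, c), (u, k, e), (v, p, q)] = (0, 0, coherence_part x y z u v)"
  using ell_maps_linear[of 1]
  by (simp add: homotopy_eval coherence_part_def mm_rotate zero_prod_def)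
end

text \<open>As homotopy identities, \<open>d1_d2\<close> belongs to one argument,
  \<open>d1_r1\<close> to \<open>r2_d1\<close> belong to two, and \<open>d1_jj\<close> to
  \<open>r2_br\<close> to three. Categorically these groups are globularity, functoriality of the
  antisymmetric bracket, and boundary and naturality of the Jacobiator.\<close>

locale pre_lie_skeleton = skeleton +
  assumes d1_d2: "d1 (d2 a) = 0"
    and d1_r1: "d1 (r1 x f) = br x (d1 f)"
    and r1_d1: "r1 (d1 f) g = - r1 (d1 g) f"
    and d2_r2: "d2 (r2 x a) = r1 x (d2 a)"
    and r2_d1: "r2 (d1 f) a = 0"
    and d1_jj: "d1 (jj x y z) = br (br x z) y + br x (br y z) - br (br x y) z"
    and r1_br: "r1 (br x y) f = r1 x (r1 y f) - r1 y (r1 x f) - jj (d1 f) x y"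
    and r2_br: "r2 (br x y) a = r2 x (r2 y a) - r2 y (r2 x a)"

text \<open>
  The first eight equations suffice to determine \<open>\<eta>\<close>, \<open>\<epsilon>\<close>
    and the cells of the coherence law.
\<close>

locale lie_skeleton = pre_lie_skeleton +
  assumes d2_mm: "d2 (mm x y z u) = eps_part x y z u - eta_part x y z u"
    and mm_d1: "mm (d1 f) y z u = 0"
    and coherence_part: "coherence_part x y z u v = 0"
begin

section \<open>The Lie infinity algebra of a skeleton\<close>

lemma grade_cases:
  assumes "v \<in> grade (int d)"
  obtains x where "d = 0" "v = (x, 0, 0)" | f where "d = 1" "v = (0, f, 0)"
    | a where "d = 2" "v = (0, 0, a)" | "d > 0" "v = (0, 0, 0)"
  using assms by (cases v; cases "d = 0"; cases "d = 1"; cases "d = 2") (auto simp: grade_def)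

lemma homotopy_identity_2:
  assumes "v \<in> grade (int d)" "w \<in> grade (int e)"
  shows "homotopy_sum (scale3 sc0 sv1 sv2) l [d, e] [v, w] = 0"
proof -
  have [simp]: "br x (d1 f) + br (d1 f) x = 0" "- br x (d1 f) = br (d1 f) x"
    "- r1 (d1 f) g = r1 (d1 g) f"
    "r1 (d1 f) g + r1 (d1 g) f = 0" for x f g
    using br_swap[of x "d1 f"] r1_d1[of f g] by simp_all
  show ?thesis
    using assms
    by (elim grade_cases; simp add: homotopy_sum_2 d1_d2 d1_r1 d2_r2 r2_d1 zero_prod_def scale3_def)
qed

lemma homotopy_identity_3:
  assumes "v \<in> grade (int d)" "w \<in> grade (int e)" "t \<in> grade (int k)"
  shows "homotopy_sum (scale3 sc0 sv1 sv2) l [d, e, k] [v, w, t] = 0"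
  using assms
  by (elim grade_cases; simp add: homotopy_sum_3 zero_prod_def scale3_def r1_br r2_br d1_jj
    br_swap[of "br _ _"])

lemma grade_fst: "v \<in> grade (int d) \<Longrightarrow> d > 0 \<Longrightarrow> fst v = 0"
  by (auto simp: grade_def)

lemma ell_maps_long: "length vs > 4 \<Longrightarrow> l vs = 0"
  by (cases "(d1, d2, br, r1, r2, jj, mm, vs)" rule: ell_maps.cases) auto

lemma ell_maps_fst_0:
  assumes "fst v = 0" "length ws \<ge> 2"
  shows "l (v # ws) = 0"
  using assms
  by (cases "(d1, d2, br, r1, r2, jj, mm, v # ws)" rule: ell_maps.cases) (auto simp: zero_prod_def)

lemma fst_ell_maps: "length vs \<ge> 3 \<Longrightarrow> fst (l vs) = 0"
  by (cases "(d1, d2, br, r1, r2, jj, mm, vs)" rule: ell_maps.cases) auto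

lemma ell_maps_zero: "l (0 # ws) = 0"
  by (cases "(d1, d2, br, r1, r2, jj, mm, 0 # ws)" rule: ell_maps.cases) (auto simp: zero_prod_def)

lemma ell_maps_fst_0_in:
  assumes "0 \<in> fst ` set vs" "length vs \<ge> 3"
  shows "l vs = 0"
  using assms
  by (cases "(d1, d2, br, r1, r2, jj, mm, vs)" rule: ell_maps.cases) (auto simp: zero_prod_def)

text \<open>If the inner map has arity at least 3, its value has no component in \<open>V0\<close>
  and is killed by an outer map of arity at least 3. Otherwise one of the two maps has arity above
  4.\<close>

lemma ell_maps_ell_maps_long:
  assumes "length us + length ws \<ge> 6"
  shows "l (l us # ws) = 0"
proof -
  consider "length us \<ge> 3" "length ws \<ge> 2" | "length us > 4" | "length ws \<ge> 4"
    using assms by linarith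
  then show ?thesis
    by cases (auto simp: ell_maps_fst_0 fst_ell_maps ell_maps_long ell_maps_zero)
qed

text \<open>A missing \<open>V0\<close>-component kills any map of arity at least 3 and passes
  through the binary map to its value. The one term that arity does not settle is the quaternary map
  after the unary one; its first argument is a boundary, so \<open>mm_d1\<close> applies. If the
  component is missing in a single outer argument, the outer bracket has two entries outside
  \<open>V0\<close> and vanishes.\<close>

lemma ell_maps_ell_maps_fst_0:
  assumes z: "0 \<in> fst ` set (us @ ws)" and "us \<noteq> []" and len: "length us + length ws
    \<ge> 4"
  shows "l (l us # ws) = 0"
proof (cases "0 \<in> fst ` set us")
  case True
  have "length us > 0" using \<open>us \<noteq> []\<close> by simp
  with len consider "length us \<ge> 3" | "length us = 2" "length ws \<ge> 2" | "length us = 1"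
    "length ws \<ge> 3"
    by arith
  then show ?thesis
  proof cases
    case 1
    then show ?thesis using True by (simp add: ell_maps_fst_0_in ell_maps_zero)
  next
    case 2
    then have "fst (l us) = 0"
      using True by (auto simp: length_Suc_conv eval_nat_numeral)
    with 2 show ?thesis by (simp add: ell_maps_fst_0)
  next
    case 3
    then obtain f a where "l us = (d1 f, d2 a, 0)"
      using True by (auto simp: length_Suc_conv)
    with 3 show ?thesis
      by (cases "(d1, d2, br, r1, r2, jj, mm, l us # ws)" rule: ell_maps.cases)
        (auto simp: mm_d1 zero_prod_def)
  qed
next
  case False
  then have ws: "0 \<in> fst ` set ws" using z by auto
  show ?thesis
  proof (cases "length ws \<ge> 2")
    case True
    then show ?thesis using ws by (intro ell_maps_fst_0_in) auto
  next
    case False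
    with ws obtain g b where "ws = [(0, g, b)]"
      by (cases ws; cases "tl ws") force+
    moreover from this len have "length us \<ge> 3" by simp
    then have "fst (l us) = 0" by (rule fst_ell_maps)
    ultimately show ?thesis by (cases "l us") (simp add: zero_prod_def)
  qed
qed

text \<open>A shuffle only rearranges the entries, so the two preceding lemmas apply to each summand
  separately.\<close>

lemma homotopy_sum_vanish:
  assumes "length vs \<ge> 6 \<or> length vs \<ge> 4 \<and> 0 \<in> fst ` set vs"
  shows "homotopy_sum (scale3 sc0 sv1 sv2) l ds vs = 0"
proof -
  have "homotopy_summand (scale3 sc0 sv1 sv2) l ds vs i xs = 0"
    if i: "i \<in> {1..length vs}" and xs: "xs \<in> set (shuffle_lists i (length vs))" for i xs
  proof -
    let ?us = "map ((!) vs) (take i xs)" and ?ws = "map ((!) vs) (drop i xs)"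
    have len: "length xs = length vs"
      using i xs by (auto simp flip: set_shuffle_lists)
    have "set xs = {..<length vs}"
      using i xs by (auto simp: shuffle_perms_def permutes_image atLeast0LessThan simp flip:
        set_shuffle_lists)
    then have "set (?us @ ?ws) = set vs"
      by (simp flip: map_append) (auto simp: set_conv_nth image_iff)
    moreover have lens: "length ?us + length ?ws = length vs" and "?us \<noteq> []"
      using len i by auto
    moreover note ell_maps_ell_maps_long[of ?us ?ws] ell_maps_ell_maps_fst_0[of ?us ?ws]
    ultimately have "l (l ?us # ?ws) = 0"
      using assms unfolding lens by blast
    then show ?thesis
      by (simp add: homotopy_summand_def)
  qed
  then show ?thesis
    by (simp add: homotopy_sum_def cong: map_cong)
qed

lemma homotopy_identity_4:
  assumes "v1 \<in> grade (int e1)" "v2 \<in> grade (int e2)" "v3 \<in> grade (int e3)" "v4 \<in>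
    grade (int e4)"
  shows "homotopy_sum (scale3 sc0 sv1 sv2) l [e1, e2, e3, e4] [v1, v2, v3, v4] = 0"
proof (cases "e1 = 0 \<and> e2 = 0 \<and> e3 = 0 \<and> e4 = 0")
  case True
  then show ?thesis
    by (cases v1; cases v2; cases v3; cases v4) (simp add: homotopy_sum_4 d2_mm mm_d1 zero_prod_def)
next
  case False
  then have "0 \<in> fst ` set [v1, v2, v3, v4]"
    using assms[THEN grade_fst] by auto
  then show ?thesis
    by (intro homotopy_sum_vanish) simp
qed

lemma homotopy_identity_5:
  assumes "v1 \<in> grade (int e1)" "v2 \<in> grade (int e2)" "v3 \<in> grade (int e3)" "v4 \<in>
    grade (int e4)"
    "v5 \<in> grade (int e5)"
  shows "homotopy_sum (scale3 sc0 sv1 sv2) l [e1, e2, e3, e4, e5] [v1, v2, v3, v4, v5] = 0"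
proof (cases "e1 = 0 \<and> e2 = 0 \<and> e3 = 0 \<and> e4 = 0 \<and> e5 = 0")
  case True
  then show ?thesis
    by (cases v1; cases v2; cases v3; cases v4; cases v5) (simp add: homotopy_sum_5 coherence_part
      zero_prod_def)
next
  case False
  then have "0 \<in> fst ` set [v1, v2, v3, v4, v5]"
    using assms[THEN grade_fst] by auto
  then show ?thesis
    by (intro homotopy_sum_vanish) simp
qed

lemma homotopy_sum_eq_0:
  assumes "vs \<noteq> []" "homogeneous ds vs"
  shows "homotopy_sum (scale3 sc0 sv1 sv2) l ds vs = 0"
proof (cases "length vs \<ge> 6")
  case False
  moreover have "length vs > 0"
    using assms(1) by simp
  ultimately have "length vs \<in> {1, 2, 3, 4, 5}"
    unfolding insert_iff by arith
  then show ?thesis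
    using assms(2)
    by (auto simp: length_Suc_conv homogeneous_def list_all2_Cons2 eval_nat_numeral d1_d2
        homotopy_sum_1 homotopy_identity_2 homotopy_identity_3 homotopy_identity_4
          homotopy_identity_5 zero_prod_def)
qed (simp add: homotopy_sum_vanish)

lemma ell_maps_grade:
  assumes "vs \<noteq> []" "homogeneous ds vs"
  shows "l vs \<in> grade (int (sum_list ds) + int (length vs) - 2)"
proof -
  have "length vs > 0"
    using assms(1) by simp
  then have "length vs \<in> {1, 2} \<or> length vs \<in> {3, 4} \<or> length vs > 4"
    unfolding insert_iff by arith
  then show ?thesis
  proof (elim disjE)
    assume "length vs \<in> {1, 2}"
    then show ?thesis
      using assms(2)
      by (auto simp: length_Suc_conv homogeneous_def list_all2_Cons2 eval_nat_numeral 
        elim!: grade_cases) (simp_all add: grade_def)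
  next
    assume "length vs \<in> {3, 4}"
    then show ?thesis
      using assms(2)
      by (auto simp: length_Suc_conv homogeneous_def list_all2_Cons2 eval_nat_numeral grade_def)
  qed (auto simp: ell_maps_long grade_def zero_prod_def)
qed

lemma ell_maps_swap:
  assumes "v \<in> grade (int d)" "w \<in> grade (int e)"
  shows "l (vs @ v # w # ws) = scale3 sc0 sv1 sv2 (- ((-1) ^ (d * e))) (l (vs @ w # v # ws))"
proof -
  consider "vs = []" "ws = []" | "length vs + length ws \<in> {1, 2}" | "length vs + length ws > 2"
    by (cases "length vs + length ws = 0") (simp, unfold insert_iff, arith)
  then show ?thesis
  proof cases
    case 1
    have [simp]: "- br y x = br x y" for x y
      by (simp only: br_swap[of x y])
    show ?thesis
      using assms unfolding 1
      by (elim grade_cases; simp add: scale3_def)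
  next
    case 2
    show ?thesis
    proof (cases "d = 0 \<and> e = 0")
      case True
      then obtain x y where xy: "v = (x, 0, 0)" "w = (y, 0, 0)"
        using assms by (cases v; cases w) (auto simp: grade_def)
      consider p where "vs = []" "ws = [p]" | p where "vs = [p]" "ws = []"
        | p q where "vs = []" "ws = [p, q]" | p q where "vs = [p]" "ws = [q]"
        | p q where "vs = [p, q]" "ws = []"
        using 2 by (cases vs; cases ws; cases "tl vs"; cases "tl ws") auto
      then show ?thesis
        by cases (auto simp: xy True scale3_def jj_swap(1)[of x y] jj_swap(2)[of _ x y]
            mm_swap(1)[of x y] mm_swap(2)[of _ x y] mm_swap(3)[of _ _ x y])
    next
      \<comment> \<open>An entry of positive degree has no component in \<open>V0\<close>, so both
        sides are 0.\<close>
      case False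
      then have "0 \<in> fst ` set (vs @ v # w # ws)" "0 \<in> fst ` set (vs @ w # v # ws)"
        using assms[THEN grade_fst] by auto
      moreover have "length (vs @ v # w # ws) \<ge> 3" "length (vs @ w # v # ws) \<ge> 3"
        using 2 by auto
      ultimately show ?thesis by (simp add: ell_maps_fst_0_in del: set_append)
    qed
  next
    case 3
    then show ?thesis by (simp add: ell_maps_long)
  qed
qed

lemma lie_infinity_ell_maps: "lie_infinity_3 sc0 sv1 sv2 l"
  unfolding lie_infinity_3_def Let_def homotopy_sum_all_iff
  using ell_maps_linear ell_maps_grade ell_maps_swap homotopy_sum_eq_0 ell_maps_long
    V0.vector_space_axioms V1.vector_space_axioms V2.vector_space_axioms
  by auto

lemma vanishing_ell_maps: "vanishing_2_3 l"
proof -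
  have "l [u, v, w] = 0" if "homogeneous [d, e, g] [u, v, w]" "d + e + g = 1" for d e g u v w
  proof (rule ell_maps_fst_0_in)
    show "0 \<in> fst ` set [u, v, w]"
      using that by (cases d; cases e; cases g) (auto simp: homogeneous_def grade_def)
  qed simp
  then show ?thesis
    by (auto simp: vanishing_2_3_def homogeneous_def grade_def zero_prod_def)
qed

end

section \<open>Lie infinity algebras are given by skeletons\<close>

text \<open>Conditions on degrees concern homogeneous arguments only; splitting a triple into its
  three components extends a vanishing statement to all arguments.\<close>

lemma additive_zero_if_zero_on_grades:
  fixes F :: "'a::ab_group_add \<times> 'v::ab_group_add \<times> 'w::ab_group_add \<Rightarrow>
    'z::ab_group_add"
  assumes "\<And>u v. F (u + v) = F u + F v" and "\<And>d v. v \<in> grade (int d)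
    \<Longrightarrow> F v = 0"
  shows "F v = 0"
proof -
  obtain x f a where v: "v = (x, f, a)" by (cases v)
  have "F v = F (x, 0, 0) + (F (0, f, 0) + F (0, 0, a))"
    by (simp add: v flip: assms(1))
  then show ?thesis
    using assms(2)[of "(x, 0, 0)" 0] assms(2)[of "(0, f, 0)" 1] assms(2)[of "(0, 0, a)" 2]
    by (simp add: grade_def)
qed

lemma lie_infinity_eq_ell_maps:
  fixes sc0 :: "'k::field \<Rightarrow> 'a::ab_group_add \<Rightarrow> 'a"
    and sv1 :: "'k \<Rightarrow> 'v::ab_group_add \<Rightarrow> 'v" and sv2 :: "'k \<Rightarrow>
      'w::ab_group_add \<Rightarrow> 'w"
  assumes L: "lie_infinity_3 sc0 sv1 sv2 l" and van: "vanishing_2_3 l"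
  shows "\<exists>d1 d2 br r1 r2 jj mm.
    lie_skeleton sc0 sv1 sv2 d1 d2 br r1 r2 jj mm \<and> l = ell_maps d1 d2 br r1 r2 jj mm"
proof -
  let ?sc = "scale3 sc0 sv1 sv2"
  from L have vs: "vector_space sc0" "vector_space sv1" "vector_space sv2"
    and long: "length vs = 0 \<or> length vs > 4 \<Longrightarrow> l vs = 0"
    and multi: "p \<in> {1..4} \<Longrightarrow> multilinear p ?sc ?sc l"
    and grade: "vs \<noteq> [] \<Longrightarrow> homogeneous ds vs \<Longrightarrow> l vs \<in>
      grade (int (sum_list ds) + int (length vs) - 2)"
    and swap: "v \<in> grade (int d) \<Longrightarrow> w \<in> grade (int e) \<Longrightarrow>
        l (us @ v # w # ws) = ?sc (- ((-1) ^ (d * e))) (l (us @ w # v # ws))"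
    and homotopy: "vs \<noteq> [] \<Longrightarrow> homogeneous ds vs \<Longrightarrow>
      homotopy_sum ?sc l ds vs = 0"
    for vs ds p v w d e us ws
    unfolding lie_infinity_3_def Let_def homotopy_sum_all_iff by blast+
  interpret V0: vector_space sc0 by fact
  interpret V1: vector_space sv1 by fact
  interpret V2: vector_space sv2 by fact
  have multi1: "multilinear (Suc 0) ?sc ?sc l" and multi2: "multilinear 2 ?sc ?sc l"
    and multi3: "multilinear 3 ?sc ?sc l" and multi4: "multilinear 4 ?sc ?sc l"
    using multi by simp_all
  note adds = multi1[unfolded multilinear_1 Vector_Spaces.linear_iff] multi2[unfolded multilinear_2
    Vector_Spaces.linear_iff]
    multi3[unfolded multilinear_3 Vector_Spaces.linear_iff] multi4[unfolded multilinear_4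
      Vector_Spaces.linear_iff]
  have sc0: "?sc r 0 = 0" for r by (simp add: scale3_def zero_prod_def)
  have g0: "(x, 0, 0) \<in> grade (int 0)" and g1: "(0, f, 0) \<in> grade (int 1)" and g2: "(0, 0,
    a) \<in> grade (int 2)"
    for x :: 'a and f :: 'v and a :: 'w
    by (simp_all add: grade_def)
  have grade_out: "v = 0" if "v \<in> grade k" "k < 0 \<or> k > 2" for v :: "'a \<times> 'v
    \<times> 'w" and k
    using that by (auto simp: grade_def zero_prod_def)
  have split: "(x, f, a) = (x, 0, 0) + ((0, f, 0) + (0, 0, a))" for x :: 'a and f :: 'v and a :: 'w
    by simp

  \<comment> \<open>The ternary map raises the total degree by 1. Total degree 1 is covered by the
    vanishing assumption, and from total degree 2 on the value would have degree at least 3.\<close>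
  have three: "l [v1, v2, v3] = 0" if "v1 \<in> grade (int e)" "e \<ge> 1" for v1 v2 v3 e
  proof (rule additive_zero_if_zero_on_grades[of "\<lambda>v. l [v1, v, v3]"])
    fix d2 and v2 :: "'a \<times> 'v \<times> 'w" assume v2: "v2 \<in> grade (int d2)"
    show "l [v1, v2, v3] = 0"
    proof (rule additive_zero_if_zero_on_grades[of "\<lambda>v. l [v1, v2, v]"])
      fix d3 and v3 :: "'a \<times> 'v \<times> 'w" assume v3: "v3 \<in> grade (int d3)"
      show "l [v1, v2, v3] = 0"
      proof (cases "e + d2 + d3 = 1")
        case True
        then show ?thesis
          using van[unfolded vanishing_2_3_def, THEN conjunct2, rule_format, of e d2 d3 v1 v2 v3]
            that v2 v3
          by (simp add: homogeneous_def)
      next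
        case False
        then show ?thesis
          using grade[of "[v1, v2, v3]" "[e, d2, d3]"] that v2 v3
          by (intro grade_out) (auto simp: homogeneous_def)
      qed
    qed (simp add: adds)
  qed (simp add: adds)
  \<comment> \<open>The other positions follow by swapping neighbours, again one homogeneous
    component at a time.\<close>
  have three2: "l [v1, v2, v3] = 0" if v2: "v2 \<in> grade (int e)" "e \<ge> 1" for v1 v2 v3 e
  proof (rule additive_zero_if_zero_on_grades[of "\<lambda>v. l [v, v2, v3]"])
    fix d and v1 :: "'a \<times> 'v \<times> 'w" assume "v1 \<in> grade (int d)"
    then show "l [v1, v2, v3] = 0"
      using swap[OF _ v2(1), of v1 d "[]" "[v3]"] three[OF v2] by (simp add: sc0)
  qed (simp add: adds)
  have three3: "l [v1, v2, v3] = 0" if v3: "v3 \<in> grade (int e)" "e \<ge> 1" for v1 v2 v3 e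
  proof (rule additive_zero_if_zero_on_grades[of "\<lambda>v. l [v1, v, v3]"])
    fix d and v2 :: "'a \<times> 'v \<times> 'w" assume "v2 \<in> grade (int d)"
    then show "l [v1, v2, v3] = 0"
      using swap[OF _ v3(1), of v2 d "[v1]" "[]"] three2[OF v3] by (simp add: sc0)
  qed (simp add: adds)
  \<comment> \<open>The quaternary map raises the total degree by 2, so a single entry of positive
    degree already pushes the value beyond degree 2.\<close>
  have four: "l [v1, v2, v3, v4] = 0" if "v1 \<in> grade (int e)" "e \<ge> 1" for v1 v2 v3 v4 e
  proof (rule additive_zero_if_zero_on_grades[of "\<lambda>v. l [v1, v, v3, v4]"])
    fix d2 and v2 :: "'a \<times> 'v \<times> 'w" assume v2: "v2 \<in> grade (int d2)"
    show "l [v1, v2, v3, v4] = 0"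
    proof (rule additive_zero_if_zero_on_grades[of "\<lambda>v. l [v1, v2, v, v4]"])
      fix d3 and v3 :: "'a \<times> 'v \<times> 'w" assume v3: "v3 \<in> grade (int d3)"
      show "l [v1, v2, v3, v4] = 0"
      proof (rule additive_zero_if_zero_on_grades[of "\<lambda>v. l [v1, v2, v3, v]"])
        fix d4 and v4 :: "'a \<times> 'v \<times> 'w" assume v4: "v4 \<in> grade (int d4)"
        show "l [v1, v2, v3, v4] = 0"
          using grade[of "[v1, v2, v3, v4]" "[e, d2, d3, d4]"] that v2 v3 v4
          by (intro grade_out) (auto simp: homogeneous_def)
      qed (simp add: adds)
    qed (simp add: adds)
  qed (simp add: adds)
  have four2: "l [v1, v2, v3, v4] = 0" if v2: "v2 \<in> grade (int e)" "e \<ge> 1" for v1 v2 v3 v4 e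
  proof (rule additive_zero_if_zero_on_grades[of "\<lambda>v. l [v, v2, v3, v4]"])
    fix d and v1 :: "'a \<times> 'v \<times> 'w" assume "v1 \<in> grade (int d)"
    then show "l [v1, v2, v3, v4] = 0"
      using swap[OF _ v2(1), of v1 d "[]" "[v3, v4]"] four[OF v2] by (simp add: sc0)
  qed (simp add: adds)
  have four3: "l [v1, v2, v3, v4] = 0" if v3: "v3 \<in> grade (int e)" "e \<ge> 1" for v1 v2 v3 v4 e
  proof (rule additive_zero_if_zero_on_grades[of "\<lambda>v. l [v1, v, v3, v4]"])
    fix d and v2 :: "'a \<times> 'v \<times> 'w" assume "v2 \<in> grade (int d)"
    then show "l [v1, v2, v3, v4] = 0"
      using swap[OF _ v3(1), of v2 d "[v1]" "[v4]"] four2[OF v3] by (simp add: sc0)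
  qed (simp add: adds)
  have four4: "l [v1, v2, v3, v4] = 0" if v4: "v4 \<in> grade (int e)" "e \<ge> 1" for v1 v2 v3 v4 e
  proof (rule additive_zero_if_zero_on_grades[of "\<lambda>v. l [v1, v2, v, v4]"])
    fix d and v3 :: "'a \<times> 'v \<times> 'w" assume "v3 \<in> grade (int d)"
    then show "l [v1, v2, v3, v4] = 0"
      using swap[OF _ v4(1), of v3 d "[v1, v2]" "[]"] four3[OF v4] by (simp add: sc0)
  qed (simp add: adds)

  \<comment> \<open>The maps are components of \<open>l\<close> on homogeneous arguments; the sign
    of \<open>mm\<close> is that of the quaternary case of \<open>ell_maps\<close>.\<close>
  define d1 where "d1 f = fst (l [(0, f, 0)])" for f
  define d2 where "d2 a = fst (snd (l [(0, 0, a)]))" for a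
  define br where "br x y = fst (l [(x, 0, 0), (y, 0, 0)])" for x y
  define r1 where "r1 x f = fst (snd (l [(x, 0, 0), (0, f, 0)]))" for x f
  define r2 where "r2 x a = snd (snd (l [(x, 0, 0), (0, 0, a)]))" for x a
  define jj where "jj x y z = fst (snd (l [(x, 0, 0), (y, 0, 0), (z, 0, 0)]))" for x y z
  define mm where "mm x y z u = - snd (snd (l [(x, 0, 0), (y, 0, 0), (z, 0, 0), (u, 0, 0)]))" for x
    y z u

  have l1: "l [(x, f, a)] = (d1 f, d2 a, 0)" for x f a
  proof -
    have "l [(x, 0, 0)] = 0"
      using grade[of "[(x, 0, 0)]" "[0]"] g0[of x] by (intro grade_out) (auto simp: homogeneous_def)
    moreover have "l [(0, f, 0)] = (d1 f, 0, 0)"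
      using grade[of "[(0, f, 0)]" "[1]"] g1[of f] unfolding d1_def
      by (cases "l [(0, f, 0)]") (auto simp: homogeneous_def grade_def)
    moreover have "l [(0, 0, a)] = (0, d2 a, 0)"
      using grade[of "[(0, 0, a)]" "[2]"] g2[of a] unfolding d2_def
      by (cases "l [(0, 0, a)]") (auto simp: homogeneous_def grade_def)
    ultimately show ?thesis
      by (subst split) (simp only: adds, simp)
  qed
  have l2: "l [(x, f, a), (y, g, b)] = (br x y, r1 x g - r1 y f, r2 x b - r2 y a)" for x f a y g b
  proof -
    have 00: "l [(x, 0, 0), (y, 0, 0)] = (br x y, 0, 0)" for x y
      using grade[of "[(x, 0, 0), (y, 0, 0)]" "[0, 0]"] g0[of x] g0[of y] unfolding br_def
      by (cases "l [(x, 0, 0), (y, 0, 0)]") (auto simp: homogeneous_def grade_def)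
    have 01: "l [(x, 0, 0), (0, f, 0)] = (0, r1 x f, 0)" for x f
      using grade[of "[(x, 0, 0), (0, f, 0)]" "[0, 1]"] g0[of x] g1[of f] unfolding r1_def
      by (cases "l [(x, 0, 0), (0, f, 0)]") (auto simp: homogeneous_def grade_def)
    have 02: "l [(x, 0, 0), (0, 0, a)] = (0, 0, r2 x a)" for x a
      using grade[of "[(x, 0, 0), (0, 0, a)]" "[0, 2]"] g0[of x] g2[of a] unfolding r2_def
      by (cases "l [(x, 0, 0), (0, 0, a)]") (auto simp: homogeneous_def grade_def)
    have 10: "l [(0, f, 0), (x, 0, 0)] = (0, - r1 x f, 0)" for x f
      using swap[OF g1 g0, of "[]" f x "[]"] by (simp add: 01 scale3_def)
    have 20: "l [(0, 0, a), (x, 0, 0)] = (0, 0, - r2 x a)" for x a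
      using swap[OF g2 g0, of "[]" a x "[]"] by (simp add: 02 scale3_def)
    \<comment> \<open>A value of degree 2 would be compatible with the weight, so this is where the
      assumption on the binary map enters. The remaining pairs of positive degrees have total degree
      above 2 and fall under \<open>high\<close>.\<close>
    have 11: "l [(0, f, 0), (0, g, 0)] = 0" for f g
      using van[unfolded vanishing_2_3_def, THEN conjunct1, rule_format, of "(0, f, 0)" "(0, g, 0)"]
        g1[of f] g1[of g]
      by (auto simp: homogeneous_def)
    have high: "l [v, w] = 0" if "v \<in> grade (int d)" "w \<in> grade (int e)" "d + e > 2" for v
      w d e
      using grade[of "[v, w]" "[d, e]"] that by (intro grade_out) (auto simp: homogeneous_def)
    have "l [(x, f, a), (y, g, b)] =
      l [(x, 0, 0), (y, 0, 0)] + (l [(x, 0, 0), (0, g, 0)] + l [(x, 0, 0), (0, 0, b)]) +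
      ((l [(0, f, 0), (y, 0, 0)] + (l [(0, f, 0), (0, g, 0)] + l [(0, f, 0), (0, 0, b)])) +
       (l [(0, 0, a), (y, 0, 0)] + (l [(0, 0, a), (0, g, 0)] + l [(0, 0, a), (0, 0, b)])))"
      by (subst split[of x f a], subst split[of y g b]) (simp only: adds ac_simps)
    then show ?thesis
      using high[OF g1 g2, of f b] high[OF g2 g1, of a g] high[OF g2 g2, of a b]
      by (simp add: 00 01 02 10 20 11)
  qed
  have l3: "l [(x, f, a), (y, g, b), (z, h, c)] = (0, jj x y z, 0)" for x f a y g b z h c
  proof -
    have "l [(x, f, a), (y, g, b), (z, h, c)] = l [(x, 0, 0), (y, 0, 0), (z, 0, 0)]"
      using three[OF g1, of f] three[OF g2, of a] three2[OF g1, of _ g] three2[OF g2, of _ b]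
        three3[OF g1, of _ _ h] three3[OF g2, of _ _ c]
      by (subst split[of x f a], subst split[of y g b], subst split[of z h c]) (simp only: adds,
        simp)
    also have "\<dots> = (0, jj x y z, 0)"
      using grade[of "[(x, 0, 0), (y, 0, 0), (z, 0, 0)]" "[0, 0, 0]"] g0[of x] g0[of y] g0[of z]
      unfolding jj_def
      by (cases "l [(x, 0, 0), (y, 0, 0), (z, 0, 0)]") (auto simp: homogeneous_def grade_def)
    finally show ?thesis .
  qed
  have l4: "l [(x, f, a), (y, g, b), (z, h, c), (u, k, e)] = (0, 0, - mm x y z u)"
    for x f a y g b z h c u k e
  proof -
    have "l [(x, f, a), (y, g, b), (z, h, c), (u, k, e)] = l [(x, 0, 0), (y, 0, 0), (z, 0, 0), (u,
      0, 0)]"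
      using four[OF g1, of f] four[OF g2, of a] four2[OF g1, of _ g] four2[OF g2, of _ b]
        four3[OF g1, of _ _ h] four3[OF g2, of _ _ c] four4[OF g1, of _ _ _ k] four4[OF g2, of _ _
          _ e]
      by (subst split[of x f a], subst split[of y g b], subst split[of z h c], subst split[of u k
        e])
        (simp only: adds, simp)
    also have "\<dots> = (0, 0, - mm x y z u)"
      using grade[of "[(x, 0, 0), (y, 0, 0), (z, 0, 0), (u, 0, 0)]" "[0, 0, 0, 0]"]
        g0[of x] g0[of y] g0[of z] g0[of u]
      unfolding mm_def
      by (cases "l [(x, 0, 0), (y, 0, 0), (z, 0, 0), (u, 0, 0)]") (auto simp: homogeneous_def
        grade_def)
    finally show ?thesis .
  qed
  have l_eq: "l = ell_maps d1 d2 br r1 r2 jj mm"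
  proof
    fix vs show "l vs = ell_maps d1 d2 br r1 r2 jj mm vs"
      by (cases "(d1, d2, br, r1, r2, jj, mm, vs)" rule: ell_maps.cases) (simp_all add: l1 l2 l3 l4
        long)
  qed
  have lin1: "l [u + v] = l [u] + l [v]" "l [?sc r u] = ?sc r (l [u])"
    and lin2: "l [w, u + v] = l [w, u] + l [w, v]" "l [w, ?sc r u] = ?sc r (l [w, u])"
      "l [u + v, w] = l [u, w] + l [v, w]" "l [?sc r u, w] = ?sc r (l [u, w])"
    and lin3: "l [w1, w2, u + v] = l [w1, w2, u] + l [w1, w2, v]"
      "l [w1, w2, ?sc r u] = ?sc r (l [w1, w2, u])"
    and lin4: "l [w1, w2, w3, u + v] = l [w1, w2, w3, u] + l [w1, w2, w3, v]"
      "l [w1, w2, w3, ?sc r u] = ?sc r (l [w1, w2, w3, u])"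
    for u v w w1 w2 w3 r
    by (simp_all add: adds)
  have "l [0, w] = 0" "l [w, 0] = 0" for w
    using lin2(1)[of w 0 0] lin2(3)[of 0 0 w] by simp_all
  \<comment> \<open>Evaluating \<open>l2\<close> at homogeneous arguments leaves terms such as
    \<open>r1 0 0\<close>, which must disappear before linearity of the actions is
    available.\<close>
  from this[of "(_, _, _)"] have [simp]: "r1 0 f = 0" "r1 x 0 = 0" "r2 0 a = 0" "r2 x 0 = 0" for x
    f a
    by (simp_all add: r1_def r2_def zero_prod_def)
  have neg_eq: "- a = - b - c \<longleftrightarrow> a = b + c" for a b c :: 'w
    by (metis minus_add_distrib diff_conv_add_uminus neg_equal_iff_equal)
  interpret skeleton sc0 sv1 sv2 d1 d2 br r1 r2 jj mm
  proof (rule skeleton.intro)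
    show "Vector_Spaces.linear sv1 sc0 d1"
      using lin1(1)[of "(0, f, 0)" "(0, g, 0)" for f g] lin1(2)[of r "(0, f, 0)" for r f]
      by (simp add: Vector_Spaces.linear_iff vs l1 scale3_def)
    show "Vector_Spaces.linear sv2 sv1 d2"
      using lin1(1)[of "(0, 0, a)" "(0, 0, b)" for a b] lin1(2)[of r "(0, 0, a)" for r a]
      by (simp add: Vector_Spaces.linear_iff vs l1 scale3_def)
    show "Vector_Spaces.linear sc0 sc0 (br x)" for x
      using lin2(1)[of "(x, 0, 0)" "(y, 0, 0)" "(z, 0, 0)" for y z] lin2(2)[of "(x, 0, 0)" r "(y,
        0, 0)" for r y]
      by (simp add: Vector_Spaces.linear_iff vs l2 scale3_def)
    show "br x y = - br y x" for x y
      using swap[OF g0 g0, of "[]" x y "[]"] by (simp add: l2 scale3_def)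
    show "Vector_Spaces.linear sv1 sv1 (r1 x)" for x
      using lin2(1)[of "(x, 0, 0)" "(0, f, 0)" "(0, g, 0)" for f g] lin2(2)[of "(x, 0, 0)" r "(0,
        f, 0)" for r f]
      by (simp add: Vector_Spaces.linear_iff vs l2 scale3_def)
    show "Vector_Spaces.linear sc0 sv1 (\<lambda>x. r1 x f)" for f
      using lin2(3)[of "(x, 0, 0)" "(y, 0, 0)" "(0, f, 0)" for x y] lin2(4)[of r "(x, 0, 0)" "(0,
        f, 0)" for r x]
      by (simp add: Vector_Spaces.linear_iff vs l2 scale3_def)
    show "Vector_Spaces.linear sv2 sv2 (r2 x)" for x
      using lin2(1)[of "(x, 0, 0)" "(0, 0, a)" "(0, 0, b)" for a b] lin2(2)[of "(x, 0, 0)" r "(0,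
        0, a)" for r a]
      by (simp add: Vector_Spaces.linear_iff vs l2 scale3_def)
    show "Vector_Spaces.linear sc0 sv2 (\<lambda>x. r2 x a)" for a
      using lin2(3)[of "(x, 0, 0)" "(y, 0, 0)" "(0, 0, a)" for x y] lin2(4)[of r "(x, 0, 0)" "(0,
        0, a)" for r x]
      by (simp add: Vector_Spaces.linear_iff vs l2 scale3_def)
    show "Vector_Spaces.linear sc0 sv1 (jj x y)" for x y
      using lin3(1)[of "(x, 0, 0)" "(y, 0, 0)" "(z, 0, 0)" "(u, 0, 0)" for z u]
        lin3(2)[of "(x, 0, 0)" "(y, 0, 0)" r "(z, 0, 0)" for r z]
      by (simp add: Vector_Spaces.linear_iff vs l3 scale3_def)
    show "jj x y z = - jj y x z" "jj x y z = - jj x z y" for x y z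
      using swap[OF g0 g0, of "[]" x y "[(z, 0, 0)]"] swap[OF g0 g0, of "[(x, 0, 0)]" y z "[]"]
      by (simp_all add: l3 scale3_def)
    show "Vector_Spaces.linear sc0 sv2 (mm x y z)" for x y z
      using lin4(1)[of "(x, 0, 0)" "(y, 0, 0)" "(z, 0, 0)" "(u, 0, 0)" "(v, 0, 0)" for u v]
        lin4(2)[of "(x, 0, 0)" "(y, 0, 0)" "(z, 0, 0)" r "(u, 0, 0)" for r u]
      by (simp add: Vector_Spaces.linear_iff vs l4 scale3_def neg_eq)
    show "mm x y z u = - mm y x z u" "mm x y z u = - mm x z y u" "mm x y z u = - mm x y u z" for x
      y z u
      using swap[OF g0 g0, of "[]" x y "[(z, 0, 0), (u, 0, 0)]"] swap[OF g0 g0, of "[(x, 0, 0)]" y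
        z "[(u, 0, 0)]"]
        swap[OF g0 g0, of "[(x, 0, 0), (y, 0, 0)]" z u "[]"]
      by (simp_all add: l4 scale3_def minus_equation_iff)
  qed
  note homotopy_maps = homotopy[unfolded l_eq]
  have "lie_skeleton sc0 sv1 sv2 d1 d2 br r1 r2 jj mm"
  proof (intro lie_skeleton.intro pre_lie_skeleton.intro skeleton_axioms
      pre_lie_skeleton_axioms.intro lie_skeleton_axioms.intro)
    fix x y z u v :: 'a and f g :: 'v and a :: 'w
    \<comment> \<open>Each equation of the locales is one component of a homotopy identity on
      arguments of suitable degrees, listed here and in \<open>hom0\<close>.\<close>
    have hom: "homogeneous [2] [(0, 0, a)]" "homogeneous [0, 1] [(x, 0, 0), (0, f, 0)]"
      "homogeneous [0, 2] [(x, 0, 0), (0, 0, a)]" "homogeneous [1, 1] [(0, f, 0), (0, g, 0)]"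
      "homogeneous [1, 2] [(0, f, 0), (0, 0, a)]"
      by (simp_all add: homogeneous_def grade_def)
    have hom0: "homogeneous [0, 0, 0] [(x, 0, 0), (y, 0, 0), (z, 0, 0)]"
      "homogeneous [0, 0, 0, 0] [(x, 0, 0), (y, 0, 0), (z, 0, 0), (u, 0, 0)]"
      "homogeneous [0, 0, 0, 0, 0] [(x, 0, 0), (y, 0, 0), (z, 0, 0), (u, 0, 0), (v, 0, 0)]"
      "homogeneous [0, 0, 1] [(x, 0, 0), (y, 0, 0), (0, f, 0)]"
      "homogeneous [0, 0, 2] [(x, 0, 0), (y, 0, 0), (0, 0, a)]"
      "homogeneous [1, 0, 0, 0] [(0, f, 0), (y, 0, 0), (z, 0, 0), (u, 0, 0)]"
      by (simp_all add: homogeneous_def grade_def)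
    show "d1 (d2 a) = 0"
      using homotopy_maps[OF _ hom(1)] by (simp add: homotopy_sum_1 zero_prod_def)
    show "d1 (r1 x f) = br x (d1 f)"
      using homotopy_maps[OF _ hom(2)] by (simp add: homotopy_sum_2 scale3_def zero_prod_def
        br_swap[of "d1 f" x])
    show "r1 (d1 f) g = - r1 (d1 g) f"
      using homotopy_maps[OF _ hom(4)] by (simp add: homotopy_sum_2 scale3_def zero_prod_def
        eq_neg_iff_add_eq_0 neg_eq_iff_add_eq_0)
    show "d2 (r2 x a) = r1 x (d2 a)"
      using homotopy_maps[OF _ hom(3)] by (simp add: homotopy_sum_2 scale3_def zero_prod_def
        eq_neg_iff_add_eq_0 neg_eq_iff_add_eq_0)
    show "r2 (d1 f) a = 0"
      using homotopy_maps[OF _ hom(5)] by (simp add: homotopy_sum_2 scale3_def zero_prod_def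
        eq_neg_iff_add_eq_0 neg_eq_iff_add_eq_0)
    show "d1 (jj x y z) = br (br x z) y + br x (br y z) - br (br x y) z"
      using homotopy_maps[OF _ hom0(1)] by (simp add: homotopy_sum_3 scale3_def zero_prod_def
        br_swap[of "br y z" x] algebra_simps)
    show "r1 (br x y) f = r1 x (r1 y f) - r1 y (r1 x f) - jj (d1 f) x y"
      using homotopy_maps[OF _ hom0(4)] by (simp add: homotopy_sum_3 scale3_def zero_prod_def
        algebra_simps)
    show "r2 (br x y) a = r2 x (r2 y a) - r2 y (r2 x a)"
      using homotopy_maps[OF _ hom0(5)] by (simp add: homotopy_sum_3 scale3_def zero_prod_def
        algebra_simps)
    show "d2 (mm x y z u) = eps_part x y z u - eta_part x y z u"
      using homotopy_maps[OF _ hom0(2)] by (simp add: homotopy_sum_4 zero_prod_def)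
    show "mm (d1 f) y z u = 0"
      using homotopy_maps[OF _ hom0(6)] by (simp add: homotopy_eval scale3_def zero_prod_def)
    show "coherence_part x y z u v = 0"
      using homotopy_maps[OF _ hom0(3)] by (simp add: homotopy_sum_5 zero_prod_def)
  qed
  with l_eq show ?thesis by blast
qed

section \<open>Functors built from a bracket\<close>

lemma all_list_all2_Suc:
  "(\<forall>fs gs. length fs = Suc n \<and> list_all2 R fs gs \<longrightarrow> P fs gs)
    \<longleftrightarrow>
   (\<forall>f g. R f g \<longrightarrow> (\<forall>fs gs. length fs = n \<and> list_all2 R fs gs
     \<longrightarrow> P (f # fs) (g # gs)))" (is "?L = ?R")
proof
  assume R: ?R
  have "P fs gs" if "length fs = Suc n" "list_all2 R fs gs" for fs gs
    using that R by (cases fs; cases gs) auto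
  then show ?L by simp
qed simp

lemma linear_2_functor_2:
  "linear_2_functor sc0 sc1 sc2 C 2 (on_pairs b0, on_pairs b1, on_pairs b2) \<longleftrightarrow>
     multilinear 2 sc0 sc0 (on_pairs b0) \<and> multilinear 2 sc1 sc1 (on_pairs b1) \<and>
     multilinear 2 sc2 sc2 (on_pairs b2) \<and>
     (\<forall>f g. src1 C (b1 f g) = b0 (src1 C f) (src1 C g) \<and> tgt1 C (b1 f g) = b0 (tgt1 C
       f) (tgt1 C g)) \<and>
     (\<forall>\<alpha> \<beta>. src2 C (b2 \<alpha> \<beta>) = b1 (src2 C \<alpha>) (src2 C
       \<beta>) \<and> tgt2 C (b2 \<alpha> \<beta>) = b1 (tgt2 C \<alpha>) (tgt2 C \<beta>)) \<and>
     (\<forall>x y. b1 (id0 C x) (id0 C y) = id0 C (b0 x y)) \<and>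
     (\<forall>f g. b2 (id1 C f) (id1 C g) = id1 C (b1 f g)) \<and>
     (\<forall>f f'. composable10 C f f' \<longrightarrow> (\<forall>g g'. composable10 C g g'
       \<longrightarrow>
        b1 (comp10 C f f') (comp10 C g g') = comp10 C (b1 f g) (b1 f' g'))) \<and>
     (\<forall>\<alpha> \<alpha>'. composable20 C \<alpha> \<alpha>' \<longrightarrow>
       (\<forall>\<beta> \<beta>'. composable20 C \<beta> \<beta>' \<longrightarrow>
        b2 (comp20 C \<alpha> \<alpha>') (comp20 C \<beta> \<beta>') = comp20 C (b2 \<alpha>
          \<beta>) (b2 \<alpha>' \<beta>'))) \<and>
     (\<forall>\<alpha> \<alpha>'. composable21 C \<alpha> \<alpha>' \<longrightarrow>
       (\<forall>\<beta> \<beta>'. composable21 C \<beta> \<beta>' \<longrightarrow>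
        b2 (comp21 C \<alpha> \<alpha>') (comp21 C \<beta> \<beta>') = comp21 C (b2 \<alpha>
          \<beta>) (b2 \<alpha>' \<beta>')))"
  unfolding linear_2_functor_def
  by (simp add: on_pairs_def eval_nat_numeral all_length_Suc all_list_all2_Suc)

lemma linear_2_functor_3:
  "linear_2_functor sc0 sc1 sc2 C 3 (on_triples b0, on_triples b1, on_triples b2)
    \<longleftrightarrow>
     multilinear 3 sc0 sc0 (on_triples b0) \<and> multilinear 3 sc1 sc1 (on_triples b1) \<and>
     multilinear 3 sc2 sc2 (on_triples b2) \<and>
     (\<forall>f g h. src1 C (b1 f g h) = b0 (src1 C f) (src1 C g) (src1 C h) \<and>
        tgt1 C (b1 f g h) = b0 (tgt1 C f) (tgt1 C g) (tgt1 C h)) \<and>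
     (\<forall>\<alpha> \<beta> \<gamma>. src2 C (b2 \<alpha> \<beta> \<gamma>) = b1 (src2 C
       \<alpha>) (src2 C \<beta>) (src2 C \<gamma>) \<and>
        tgt2 C (b2 \<alpha> \<beta> \<gamma>) = b1 (tgt2 C \<alpha>) (tgt2 C \<beta>) (tgt2 C
          \<gamma>)) \<and>
     (\<forall>x y z. b1 (id0 C x) (id0 C y) (id0 C z) = id0 C (b0 x y z)) \<and>
     (\<forall>f g h. b2 (id1 C f) (id1 C g) (id1 C h) = id1 C (b1 f g h)) \<and>
     (\<forall>f f'. composable10 C f f' \<longrightarrow> (\<forall>g g'. composable10 C g g'
       \<longrightarrow> (\<forall>h h'. composable10 C h h' \<longrightarrow>
        b1 (comp10 C f f') (comp10 C g g') (comp10 C h h') = comp10 C (b1 f g h) (b1 f' g' h'))))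
          \<and>
     (\<forall>f f'. composable20 C f f' \<longrightarrow> (\<forall>g g'. composable20 C g g'
       \<longrightarrow> (\<forall>h h'. composable20 C h h' \<longrightarrow>
        b2 (comp20 C f f') (comp20 C g g') (comp20 C h h') = comp20 C (b2 f g h) (b2 f' g' h'))))
          \<and>
     (\<forall>f f'. composable21 C f f' \<longrightarrow> (\<forall>g g'. composable21 C g g'
       \<longrightarrow> (\<forall>h h'. composable21 C h h' \<longrightarrow>
        b2 (comp21 C f f') (comp21 C g g') (comp21 C h h') = comp21 C (b2 f g h) (b2 f' g' h'))))"
  unfolding linear_2_functor_def
  by (simp add: on_triples_def eval_nat_numeral all_length_Suc all_list_all2_Suc)

lemma linear_2_functor_4:
  "linear_2_functor sc0 sc1 sc2 C 4 (on_quadruples b0, on_quadruples b1, on_quadruples b2)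
    \<longleftrightarrow>
     multilinear 4 sc0 sc0 (on_quadruples b0) \<and> multilinear 4 sc1 sc1 (on_quadruples b1) \<and>
     multilinear 4 sc2 sc2 (on_quadruples b2) \<and>
     (\<forall>f g h k. src1 C (b1 f g h k) = b0 (src1 C f) (src1 C g) (src1 C h) (src1 C k) \<and>
        tgt1 C (b1 f g h k) = b0 (tgt1 C f) (tgt1 C g) (tgt1 C h) (tgt1 C k)) \<and>
     (\<forall>f g h k. src2 C (b2 f g h k) = b1 (src2 C f) (src2 C g) (src2 C h) (src2 C k) \<and>
        tgt2 C (b2 f g h k) = b1 (tgt2 C f) (tgt2 C g) (tgt2 C h) (tgt2 C k)) \<and>
     (\<forall>x y z u. b1 (id0 C x) (id0 C y) (id0 C z) (id0 C u) = id0 C (b0 x y z u)) \<and>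
     (\<forall>f g h k. b2 (id1 C f) (id1 C g) (id1 C h) (id1 C k) = id1 C (b1 f g h k)) \<and>
     (\<forall>f f'. composable10 C f f' \<longrightarrow> (\<forall>g g'. composable10 C g g'
       \<longrightarrow> (\<forall>h h'. composable10 C h h' \<longrightarrow>
       (\<forall>k k'. composable10 C k k' \<longrightarrow>
        b1 (comp10 C f f') (comp10 C g g') (comp10 C h h') (comp10 C k k') = comp10 C (b1 f g h k)
          (b1 f' g' h' k'))))) \<and>
     (\<forall>f f'. composable20 C f f' \<longrightarrow> (\<forall>g g'. composable20 C g g'
       \<longrightarrow> (\<forall>h h'. composable20 C h h' \<longrightarrow>
       (\<forall>k k'. composable20 C k k' \<longrightarrow>
        b2 (comp20 C f f') (comp20 C g g') (comp20 C h h') (comp20 C k k') = comp20 C (b2 f g h k)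
          (b2 f' g' h' k'))))) \<and>
     (\<forall>f f'. composable21 C f f' \<longrightarrow> (\<forall>g g'. composable21 C g g'
       \<longrightarrow> (\<forall>h h'. composable21 C h h' \<longrightarrow>
       (\<forall>k k'. composable21 C k k' \<longrightarrow>
        b2 (comp21 C f f') (comp21 C g g') (comp21 C h h') (comp21 C k k') = comp21 C (b2 f g h k)
          (b2 f' g' h' k')))))"
  unfolding linear_2_functor_def
  by (simp add: on_quadruples_def eval_nat_numeral all_length_Suc all_list_all2_Suc)

lemma multilinear_on_pairs: "multilinear 2 s1 s2 (on_pairs b) \<longleftrightarrow>
    (\<forall>a. Vector_Spaces.linear s1 s2 (\<lambda>x. b x a)) \<and> (\<forall>a.
      Vector_Spaces.linear s1 s2 (b a))"
  by (simp add: multilinear_2 on_pairs_def)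

lemma multilinear_on_triples: "multilinear 3 s1 s2 (on_triples F) \<longleftrightarrow>
     (\<forall>a b. Vector_Spaces.linear s1 s2 (\<lambda>x. F x a b)) \<and>
     (\<forall>b a. Vector_Spaces.linear s1 s2 (\<lambda>x. F a x b)) \<and> (\<forall>b a.
       Vector_Spaces.linear s1 s2 (F a b))"
  by (simp add: multilinear_3 on_triples_def)

lemma multilinear_on_quadruples: "multilinear 4 s1 s2 (on_quadruples F) \<longleftrightarrow>
     (\<forall>a b c. Vector_Spaces.linear s1 s2 (\<lambda>x. F x a b c)) \<and>
     (\<forall>b c a. Vector_Spaces.linear s1 s2 (\<lambda>x. F a x b c)) \<and>
     (\<forall>c b a. Vector_Spaces.linear s1 s2 (\<lambda>x. F a b x c)) \<and>
     (\<forall>c b a. Vector_Spaces.linear s1 s2 (F a b c))"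
  by (simp add: multilinear_4 on_quadruples_def)

text \<open>What follows from category and bracket alone is needed for a given Lie 3-algebra as well
  as for the one constructed from a skeleton, so it is developed once for both.\<close>

locale bracket_functor =
  fixes sc0 :: "'k::field \<Rightarrow> 'a::ab_group_add \<Rightarrow> 'a"
    and sc1 :: "'k \<Rightarrow> 'b::ab_group_add \<Rightarrow> 'b"
    and sc2 :: "'k \<Rightarrow> 'c::ab_group_add \<Rightarrow> 'c"
    and L :: "('a, 'b, 'c) lie3"
  assumes category: "linear_2_category sc0 sc1 sc2 L"
    and bracket: "linear_2_functor sc0 sc1 sc2 L 2 (on_pairs (bra0 L), on_pairs (bra1 L), on_pairs
      (bra2 L))"
begin

lemmas category_facts = category[unfolded linear_2_category_def linear_composition_def
  Vector_Spaces.linear_iff]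
lemmas functor_facts = bracket[unfolded linear_2_functor_2 multilinear_on_pairs
  Vector_Spaces.linear_iff]

lemma vector_spaces: "vector_space sc0" "vector_space sc1" "vector_space sc2"
  using category_facts by simp_all

sublocale V0: vector_space sc0 by (rule vector_spaces)
sublocale V1: vector_space sc1 by (rule vector_spaces)
sublocale V2: vector_space sc2 by (rule vector_spaces)

lemma linear_structure:
  "src1 L (f + g) = src1 L f + src1 L g" "tgt1 L (f + g) = tgt1 L f + tgt1 L g"
  "src2 L (\<alpha> + \<beta>) = src2 L \<alpha> + src2 L \<beta>" "tgt2 L (\<alpha> + \<beta>) =
    tgt2 L \<alpha> + tgt2 L \<beta>"
  "id0 L (x + y) = id0 L x + id0 L y" "id1 L (f + g) = id1 L f + id1 L g"
  using category_facts by simp_all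

lemma scale_structure:
  "src1 L (sc1 r f) = sc0 r (src1 L f)" "tgt1 L (sc1 r f) = sc0 r (tgt1 L f)"
  "src2 L (sc2 r \<alpha>) = sc1 r (src2 L \<alpha>)" "tgt2 L (sc2 r \<alpha>) = sc1 r (tgt2 L
    \<alpha>)"
  using category_facts by simp_all

lemma globular:
  "src1 L (id0 L x) = x" "tgt1 L (id0 L x) = x" "src2 L (id1 L f) = f" "tgt2 L (id1 L f) = f"
  "src1 L (tgt2 L \<alpha>) = ssrc L \<alpha>" "tgt1 L (src2 L \<alpha>) = ttgt L \<alpha>"
  using category_facts by simp_all

lemma composite_laws:
  "\<forall>f g. composable10 L f g \<longrightarrow> src1 L (comp10 L f g) = src1 L f \<and> tgt1
    L (comp10 L f g) = tgt1 L g"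
  "\<forall>\<alpha> \<beta>. composable20 L \<alpha> \<beta> \<longrightarrow> src2 L (comp20 L
    \<alpha> \<beta>) = comp10 L (src2 L \<alpha>) (src2 L \<beta>) \<and>
     tgt2 L (comp20 L \<alpha> \<beta>) = comp10 L (tgt2 L \<alpha>) (tgt2 L \<beta>)"
  "\<forall>\<alpha> \<beta>. composable21 L \<alpha> \<beta> \<longrightarrow> src2 L (comp21 L
    \<alpha> \<beta>) = src2 L \<alpha> \<and> tgt2 L (comp21 L \<alpha> \<beta>) = tgt2 L \<beta>"
  "\<forall>\<alpha>. comp20 L (iid L (ssrc L \<alpha>)) \<alpha> = \<alpha> \<and> comp20 L
    \<alpha> (iid L (ttgt L \<alpha>)) = \<alpha>"
  "\<forall>f g. composable10 L f g \<longrightarrow> id1 L (comp10 L f g) = comp20 L (id1 L f)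
    (id1 L g)"
  "\<forall>\<alpha> \<beta> \<gamma>. composable20 L \<alpha> \<beta> \<and> composable20 L
    \<beta> \<gamma> \<longrightarrow>
     comp20 L (comp20 L \<alpha> \<beta>) \<gamma> = comp20 L \<alpha> (comp20 L \<beta> \<gamma>)"
  "\<forall>a b a' b'. composable10 L a b \<and> composable10 L a' b' \<longrightarrow>
     comp10 L (a + a') (b + b') = comp10 L a b + comp10 L a' b'"
  "\<forall>a b a' b'. composable20 L a b \<and> composable20 L a' b' \<longrightarrow>
     comp20 L (a + a') (b + b') = comp20 L a b + comp20 L a' b'"
  "\<forall>a b a' b'. composable21 L a b \<and> composable21 L a' b' \<longrightarrow>
     comp21 L (a + a') (b + b') = comp21 L a b + comp21 L a' b'"
  "\<forall>f. comp10 L (id0 L (src1 L f)) f = f \<and> comp10 L f (id0 L (tgt1 L f)) = f"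
  "\<forall>\<alpha>. comp21 L (id1 L (src2 L \<alpha>)) \<alpha> = \<alpha> \<and> comp21 L
    \<alpha> (id1 L (tgt2 L \<alpha>)) = \<alpha>"
  "\<forall>a b. \<not> composable10 L a b \<longrightarrow> comp10 L a b = undefined"
  "\<forall>a b. \<not> composable20 L a b \<longrightarrow> comp20 L a b = undefined"
  "\<forall>a b. \<not> composable21 L a b \<longrightarrow> comp21 L a b = undefined"
  using category unfolding linear_2_category_def linear_composition_def by - (elim conjE,
    assumption)+

lemma composites:
  "composable10 L f g \<Longrightarrow> src1 L (comp10 L f g) = src1 L f"
  "composable10 L f g \<Longrightarrow> tgt1 L (comp10 L f g) = tgt1 L g"
  "composable20 L \<alpha> \<beta> \<Longrightarrow> src2 L (comp20 L \<alpha> \<beta>) = comp10 L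
    (src2 L \<alpha>) (src2 L \<beta>)"
  "composable20 L \<alpha> \<beta> \<Longrightarrow> tgt2 L (comp20 L \<alpha> \<beta>) = comp10 L
    (tgt2 L \<alpha>) (tgt2 L \<beta>)"
  "composable21 L \<alpha> \<beta> \<Longrightarrow> src2 L (comp21 L \<alpha> \<beta>) = src2 L
    \<alpha>"
  "composable21 L \<alpha> \<beta> \<Longrightarrow> tgt2 L (comp21 L \<alpha> \<beta>) = tgt2 L
    \<beta>"
  "comp20 L (iid L (ssrc L \<alpha>)) \<alpha> = \<alpha>" "comp20 L \<alpha> (iid L (ttgt L
    \<alpha>)) = \<alpha>"
  "composable10 L f g \<Longrightarrow> id1 L (comp10 L f g) = comp20 L (id1 L f) (id1 L g)"
  using composite_laws by simp_all

lemma comp20_assoc: "composable20 L \<alpha> \<beta> \<Longrightarrow> composable20 L \<beta>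
  \<gamma> \<Longrightarrow>
    comp20 L (comp20 L \<alpha> \<beta>) \<gamma> = comp20 L \<alpha> (comp20 L \<beta> \<gamma>)"
  using composite_laws(6) by simp

lemmas comp_add = composite_laws(7-9)[rule_format, OF conjI]

lemma bracket_linear:
  "bra0 L (x + x') y = bra0 L x y + bra0 L x' y" "bra0 L x (y + y') = bra0 L x y + bra0 L x y'"
  "bra1 L (f + f') g = bra1 L f g + bra1 L f' g" "bra1 L f (g + g') = bra1 L f g + bra1 L f g'"
  "bra2 L (\<alpha> + \<alpha>') \<beta> = bra2 L \<alpha> \<beta> + bra2 L \<alpha>' \<beta>"
    "bra2 L \<alpha> (\<beta> + \<beta>') = bra2 L \<alpha> \<beta> + bra2 L \<alpha> \<beta>'"
  "bra0 L (sc0 r x) y = sc0 r (bra0 L x y)" "bra0 L x (sc0 r y) = sc0 r (bra0 L x y)"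
  "bra1 L (sc1 r f) g = sc1 r (bra1 L f g)" "bra1 L f (sc1 r g) = sc1 r (bra1 L f g)"
  "bra2 L (sc2 r \<alpha>) \<beta> = sc2 r (bra2 L \<alpha> \<beta>)" "bra2 L \<alpha> (sc2 r
    \<beta>) = sc2 r (bra2 L \<alpha> \<beta>)"
  using functor_facts by simp_all

lemma bracket_functor:
  "src1 L (bra1 L f g) = bra0 L (src1 L f) (src1 L g)" "tgt1 L (bra1 L f g) = bra0 L (tgt1 L f)
    (tgt1 L g)"
  "src2 L (bra2 L \<alpha> \<beta>) = bra1 L (src2 L \<alpha>) (src2 L \<beta>)" "tgt2 L (bra2 L
    \<alpha> \<beta>) = bra1 L (tgt2 L \<alpha>) (tgt2 L \<beta>)"
  "bra1 L (id0 L x) (id0 L y) = id0 L (bra0 L x y)" "bra2 L (id1 L f) (id1 L g) = id1 L (bra1 L f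
    g)"
  "composable10 L f f' \<Longrightarrow> composable10 L g g' \<Longrightarrow>
     bra1 L (comp10 L f f') (comp10 L g g') = comp10 L (bra1 L f g) (bra1 L f' g')"
  "composable20 L \<alpha> \<alpha>' \<Longrightarrow> composable20 L \<beta> \<beta>'
    \<Longrightarrow>
     bra2 L (comp20 L \<alpha> \<alpha>') (comp20 L \<beta> \<beta>') = comp20 L (bra2 L \<alpha>
       \<beta>) (bra2 L \<alpha>' \<beta>')"
  "composable21 L \<alpha> \<alpha>' \<Longrightarrow> composable21 L \<beta> \<beta>'
    \<Longrightarrow>
     bra2 L (comp21 L \<alpha> \<alpha>') (comp21 L \<beta> \<beta>') = comp21 L (bra2 L \<alpha>
       \<beta>) (bra2 L \<alpha>' \<beta>')"
  using functor_facts by simp_all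

lemmas [simp] = linear_structure globular composites bracket_linear bracket_functor

section \<open>Iterated brackets as functors\<close>

lemma jac_source_functor:
  "linear_2_functor sc0 sc1 sc2 L 3
     (on_triples (jac_source (bra0 L)), on_triples (jac_source (bra1 L)), on_triples (jac_source
       (bra2 L)))"
  by (simp add: linear_2_functor_3 multilinear_on_triples Vector_Spaces.linear_iff vector_spaces
    jac_source_def)

text \<open>A sum of functors is a functor because composition is additive on composable pairs,
  which is \<open>comp_add\<close>.\<close>

lemma jac_target_functor:
  "linear_2_functor sc0 sc1 sc2 L 3
     (on_triples (jac_target (bra0 L)), on_triples (jac_target (bra1 L)), on_triples (jac_target
       (bra2 L)))"
  by (simp add: linear_2_functor_3 multilinear_on_triples Vector_Spaces.linear_iff vector_spaces
    jac_target_def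
    ac_simps V0.scale_right_distrib V1.scale_right_distrib V2.scale_right_distrib comp_add)

lemma ident_source_functor:
  "linear_2_functor sc0 sc1 sc2 L 4
     (on_quadruples (ident_source (bra0 L)), on_quadruples (ident_source (bra1 L)), on_quadruples
       (ident_source (bra2 L)))"
  by (simp add: linear_2_functor_4 multilinear_on_quadruples Vector_Spaces.linear_iff vector_spaces
    ident_source_def)

lemma ident_target_functor:
  "linear_2_functor sc0 sc1 sc2 L 4
     (on_quadruples (ident_target (bra0 L)), on_quadruples (ident_target (bra1 L)), on_quadruples
       (ident_target (bra2 L)))"
  by (simp add: linear_2_functor_4 multilinear_on_quadruples Vector_Spaces.linear_iff vector_spaces
    ident_target_def
    ac_simps V0.scale_right_distrib V1.scale_right_distrib V2.scale_right_distrib comp_add)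

text \<open>
  Naturality squares can be pasted, bracketed and added. This yields the naturality of
    \<open>\<eta>\<close>
  and \<open>\<epsilon>\<close> from that of the Jacobiator without expanding anything in
    components.
\<close>

definition square where
  "square \<alpha> f g \<beta> \<longleftrightarrow> src1 L f = ttgt L \<alpha> \<and> tgt1 L f =
    ttgt L \<beta> \<and>
     src1 L g = ssrc L \<alpha> \<and> tgt1 L g = ssrc L \<beta> \<and> comp20 L \<alpha> (id1 L f)
       = comp20 L (id1 L g) \<beta>"

lemma square_id: "square \<alpha> (id0 L (ttgt L \<alpha>)) (id0 L (ssrc L \<alpha>)) \<alpha>"
  by (simp add: square_def)

text \<open>The bracket preserves composition along 0-cells and identities, so the bracket of two
  composites is the composite of the brackets.\<close>

lemma square_bracket:
  "square \<alpha> f g \<beta> \<Longrightarrow> square \<alpha>' f' g' \<beta>' \<Longrightarrow>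
   square (bra2 L \<alpha> \<alpha>') (bra1 L f f') (bra1 L g g') (bra2 L \<beta> \<beta>')"
  by (simp add: square_def flip: bracket_functor(6,8))

lemma square_add:
  "square \<alpha> f g \<beta> \<Longrightarrow> square \<alpha>' f' g' \<beta>' \<Longrightarrow>
    square (\<alpha> + \<alpha>') (f + f') (g + g') (\<beta> + \<beta>')"
  by (simp add: square_def comp_add)

lemma square_paste:
  assumes 1: "square \<alpha> f g \<beta>" and 2: "square \<beta> f' g' \<gamma>"
  shows "square \<alpha> (comp10 L f f') (comp10 L g g') \<gamma>"
proof -
  note sq = 1[unfolded square_def] 2[unfolded square_def]
  have "comp20 L \<alpha> (id1 L (comp10 L f f')) = comp20 L (comp20 L \<alpha> (id1 L f)) (id1 L
    f')"
    using sq comp20_assoc[of \<alpha> "id1 L f" "id1 L f'"] by simp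
  also have "\<dots> = comp20 L (id1 L g) (comp20 L \<beta> (id1 L f'))"
    using sq comp20_assoc[of "id1 L g" \<beta> "id1 L f'"] by simp
  also have "\<dots> = comp20 L (id1 L (comp10 L g g')) \<gamma>"
    using sq comp20_assoc[of "id1 L g" "id1 L g'" \<gamma>] by simp
  finally show ?thesis
    using sq by (simp add: square_def)
qed

text \<open>The next factor acts on \<beta> only, and \<omega> is carried along by its identity
  square. The 0-cells of the unlabelled identities are the target and source 0-cells of \<omega> on
  the two legs.\<close>

lemma square_paste_id:
  assumes 1: "square \<alpha> f g (\<beta> + \<omega>)" and 2: "square \<beta> f' g' \<gamma>"
  shows "square \<alpha> (lie3_cells.then1_id L f f') (lie3_cells.then1_id L g g') (\<gamma> +
    \<omega>)"
proof -
  have "tgt1 L f - src1 L f' = ttgt L \<omega>" "tgt1 L g - src1 L g' = ssrc L \<omega>"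
    using 1 2 by (simp_all add: square_def)
  then show ?thesis
    unfolding lie3_cells.then1_id_def
    using square_paste[OF 1 square_add[OF 2 square_id[of \<omega>]]] by simp
qed

end

locale jacobiator = bracket_functor +
  assumes jac_square: "square (jac_source (bra2 L) \<alpha> \<beta> \<gamma>) (jac L (ttgt L
    \<alpha>) (ttgt L \<beta>) (ttgt L \<gamma>))
    (jac L (ssrc L \<alpha>) (ssrc L \<beta>) (ssrc L \<gamma>)) (jac_target (bra2 L) \<alpha>
      \<beta> \<gamma>)"
begin

lemma eta_square:
  "square (ident_source (bra2 L) a b c d) (lie3_cells.eta L (ttgt L a) (ttgt L b) (ttgt L c) (ttgt
    L d))
     (lie3_cells.eta L (ssrc L a) (ssrc L b) (ssrc L c) (ssrc L d)) (ident_target (bra2 L) a b c d)"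
proof -
  let ?b = "bra2 L"
  note J = jac_square[unfolded jac_source_def jac_target_def, simplified]
  have 1: "square (?b (?b (?b a b) c) d) (bra1 L (jac L (ttgt L a) (ttgt L b) (ttgt L c)) (id0 L
    (ttgt L d)))
      (bra1 L (jac L (ssrc L a) (ssrc L b) (ssrc L c)) (id0 L (ssrc L d)))
      (?b (?b (?b a c) b) d + ?b (?b a (?b b c)) d)"
    using square_bracket[OF J[of a b c] square_id[of d]] by simp
  note 2 = square_paste[OF 1 square_add[OF J[of "?b a c" b d] J[of a "?b b c" d]]]
  \<comment> \<open>Regrouping isolates the summand on which the next factor of \<eta> acts; the
    others play the role of \<omega>.\<close>
  have eq: "?b (?b (?b a c) d) b + ?b (?b a c) (?b b d) + (?b (?b a d) (?b b c) + ?b a (?b (?b b c)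
    d)) =
      ?b (?b (?b a c) d) b + (?b (?b a c) (?b b d) + ?b (?b a d) (?b b c) + ?b a (?b (?b b c) d))"
    by (simp add: ac_simps)
  note 3 = square_paste_id[OF 2[unfolded eq] square_bracket[OF J[of a c d] square_id[of b]]]
  have eq: "?b (?b (?b a d) c + ?b a (?b c d)) b + (?b (?b a c) (?b b d) + ?b (?b a d) (?b b c) +
    ?b a (?b (?b b c) d)) =
    ?b a (?b (?b b c) d) + (?b (?b (?b a d) c) b + ?b (?b a (?b c d)) b + (?b (?b a c) (?b b d) +
      ?b (?b a d) (?b b c)))"
    by (simp add: ac_simps)
  note 4 = square_paste_id[OF 3[unfolded eq] square_bracket[OF square_id[of a] J[of b c d]]]
  then show ?thesis
    by (simp add: lie3_cells.eta_def ident_source_def ident_target_def ac_simps)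
qed

lemma eps_square:
  "square (ident_source (bra2 L) a b c d) (lie3_cells.eps L (ttgt L a) (ttgt L b) (ttgt L c) (ttgt
    L d))
     (lie3_cells.eps L (ssrc L a) (ssrc L b) (ssrc L c) (ssrc L d)) (ident_target (bra2 L) a b c d)"
proof -
  let ?b = "bra2 L"
  note J = jac_square[unfolded jac_source_def jac_target_def, simplified]
  note 1 = J[of "?b a b" c d]
  note 2 = square_paste_id[OF 1 square_bracket[OF J[of a b d] square_id[of c]]]
  have eq: "?b (?b (?b a d) b + ?b a (?b b d)) c + ?b (?b a b) (?b c d) =
    ?b (?b a (?b b d)) c + ?b (?b (?b a d) b) c + ?b (?b a b) (?b c d)"
    by (simp add: ac_simps)
  note 3 = square_paste[OF 2[unfolded eq] square_add[OF square_add[OF J[of a "?b b d" c] J[of "?b a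
    d" b c]] J[of a b "?b c d"]]]
  then show ?thesis
    by (simp add: lie3_cells.eps_def ident_source_def ident_target_def ac_simps)
qed

end

section \<open>Coordinates on cells\<close>

locale coordinates =
  fixes sc0 :: "'k::field \<Rightarrow> 'a::ab_group_add \<Rightarrow> 'a"
    and sc1 :: "'k \<Rightarrow> 'b::ab_group_add \<Rightarrow> 'b"
    and sc2 :: "'k \<Rightarrow> 'c::ab_group_add \<Rightarrow> 'c"
    and sv1 :: "'k \<Rightarrow> 'v::ab_group_add \<Rightarrow> 'v"
    and sv2 :: "'k \<Rightarrow> 'w::ab_group_add \<Rightarrow> 'w"
    and s1 :: "'b \<Rightarrow> 'a" and s2 :: "'c \<Rightarrow> 'b"
    and i0 :: "'a \<Rightarrow> 'b" and i1 :: "'b \<Rightarrow> 'c"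
    and j1 :: "'v \<Rightarrow> 'b" and j2 :: "'w \<Rightarrow> 'c"
  assumes ident: "kernel_identification sc0 sc1 sc2 sv1 sv2 s1 s2 i0 i1 j1 j2"
begin

lemmas ident_facts = ident[unfolded kernel_identification_def Vector_Spaces.linear_iff]

lemma spaces: "vector_space sc0" "vector_space sc1" "vector_space sc2" "vector_space sv1"
  "vector_space sv2"
  using ident_facts by simp_all

text \<open>With \<open>cell2\<close>, \<open>ker1\<close> and \<open>ker2\<close> this is the
  standing identification of cells with tuples of components and its inverse.\<close>

definition cell1 where "cell1 x f = i0 x + j1 f"
definition cell2 where "cell2 x f a = i1 (cell1 x f) + j2 a"
definition ker1 where "ker1 F = inv j1 (F - i0 (s1 F))"
definition ker2 where "ker2 \<alpha> = inv j2 (\<alpha> - i1 (s2 \<alpha>))"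

lemma linears:
  "s1 (F + G) = s1 F + s1 G" "s2 (\<alpha> + \<beta>) = s2 \<alpha> + s2 \<beta>" "i0 (x + y) = i0
    x + i0 y" "i1 (F + G) = i1 F + i1 G"
  "j1 (f + g) = j1 f + j1 g" "j2 (a + b) = j2 a + j2 b"
  "s1 (sc1 r F) = sc0 r (s1 F)" "s2 (sc2 r \<alpha>) = sc1 r (s2 \<alpha>)" "i0 (sc0 r x) = sc1 r
    (i0 x)"
  "i1 (sc1 r F) = sc2 r (i1 F)" "j1 (sv1 r f) = sc1 r (j1 f)" "j2 (sv2 r a) = sc2 r (j2 a)"
  using ident_facts by simp_all

lemma sections [simp]: "s1 (i0 x) = x" "s2 (i1 F) = F" "s1 (j1 f) = 0" "s2 (j2 a) = 0"
  and inj: "inj j1" "inj j2" and ranges: "range j1 = {f. s1 f = 0}" "range j2 = {\<alpha>. s2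
    \<alpha> = 0}"
  using ident_facts by auto

lemma s_coord [simp]: "s1 (cell1 x f) = x" "s2 (cell2 x f a) = cell1 x f"
  by (simp_all add: cell1_def cell2_def linears)

lemma ker_coord [simp]: "ker1 (cell1 x f) = f" "ker2 (cell2 x f a) = a"
  by (simp_all add: ker1_def ker2_def, simp_all add: cell1_def cell2_def inj)

lemma coord1: "cell1 (s1 F) (ker1 F) = F"
proof -
  have "s1 (F - i0 (s1 F)) = 0"
    using linears(1)[of "F - i0 (s1 F)" "i0 (s1 F)"] by simp
  then have "F - i0 (s1 F) \<in> range j1" by (simp add: ranges)
  then show ?thesis by (simp add: cell1_def ker1_def f_inv_into_f)
qed

lemma coord2: "cell2 (s1 (s2 \<alpha>)) (ker1 (s2 \<alpha>)) (ker2 \<alpha>) = \<alpha>"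
proof -
  have "s2 (\<alpha> - i1 (s2 \<alpha>)) = 0"
    using linears(2)[of "\<alpha> - i1 (s2 \<alpha>)" "i1 (s2 \<alpha>)"] by simp
  then have "\<alpha> - i1 (s2 \<alpha>) \<in> range j2" by (simp add: ranges)
  then show ?thesis by (simp add: cell2_def ker2_def f_inv_into_f coord1)
qed

text \<open>Turns the axioms, which quantify over cells, into equations between components.\<close>

lemma all_cell1: "(\<forall>F. P F) \<longleftrightarrow> (\<forall>x f. P (cell1 x f))"
  by (metis coord1)
lemma all_cell2: "(\<forall>\<alpha>. P \<alpha>) \<longleftrightarrow> (\<forall>x f a. P (cell2 x
  f a))"
  by (metis coord2)

lemma cell_inject [simp]: "cell1 x f = cell1 y g \<longleftrightarrow> x = y \<and> f = g"
  "cell2 x f a = cell2 y g b \<longleftrightarrow> x = y \<and> f = g \<and> a = b"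
  by (metis s_coord ker_coord)+

lemma cell_add [simp]: "cell1 x f + cell1 y g = cell1 (x + y) (f + g)"
  "cell2 x f a + cell2 y g b = cell2 (x + y) (f + g) (a + b)"
  by (simp_all add: cell1_def cell2_def linears)

lemma cell_scale [simp]: "sc1 r (cell1 x f) = cell1 (sc0 r x) (sv1 r f)"
  "sc2 r (cell2 x f a) = cell2 (sc0 r x) (sv1 r f) (sv2 r a)"
  using spaces(2,3) by (simp_all add: cell1_def cell2_def linears
    vector_space.vector_space_assms(1))

lemma cell_diff [simp]: "cell1 x f - cell1 y g = cell1 (x - y) (f - g)"
  "cell2 x f a - cell2 y g b = cell2 (x - y) (f - g) (a - b)"
  by (simp_all add: diff_eq_eq)

lemma i_coord: "i0 x = cell1 x 0" "i1 (cell1 x f) = cell2 x f 0" "j1 f = cell1 0 f" "j2 a = cell2 0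
  0 a"
proof -
  have "j1 0 = 0" "j2 0 = 0" "i0 0 = 0" "i1 0 = 0"
    using linears(3)[of 0 0] linears(4)[of 0 0] linears(5)[of 0 0] linears(6)[of 0 0] by simp_all
  then show "i0 x = cell1 x 0" "i1 (cell1 x f) = cell2 x f 0" "j1 f = cell1 0 f" "j2 a = cell2 0 0
    a"
    by (simp_all add: cell1_def cell2_def)
qed

lemma cell_zero [simp]: "cell1 0 0 = 0" "cell2 0 0 0 = 0"
  using cell_diff(1)[of 0 0 0 0] cell_diff(2)[of 0 0 0 0 0 0] by simp_all

lemma cell_uminus [simp]: "- cell1 x f = cell1 (- x) (- f)" "- cell2 x f a = cell2 (- x) (- f) (-
  a)"
  using cell_diff(1)[of 0 0 x f] cell_diff(2)[of 0 0 0 x f a] by simp_all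

text \<open>The Lie 3-algebra of a skeleton. Compositions add kernel components and are
  \<open>undefined\<close> off composable pairs, as \<open>linear_composition\<close> prescribes, so
  that equality of records can hold. In the brackets of 1- and 2-cells the target 0-cell of the
  second argument acts on the \<open>V1\<close>-component of the first, as the interchange law
  forces. The source of \<mu> is \<eta>.\<close>

definition cells where
  "cells d1 d2 br r1 r2 jj mm = \<lparr>
     src1 = s1, src2 = s2,
     tgt1 = (\<lambda>F. s1 F + d1 (ker1 F)),
     tgt2 = (\<lambda>\<alpha>. cell1 (s1 (s2 \<alpha>)) (ker1 (s2 \<alpha>) + d2 (ker2 \<alpha>))),
     id0 = i0, id1 = i1,
     comp10 = (\<lambda>F G. if s1 F + d1 (ker1 F) = s1 G then cell1 (s1 F) (ker1 F + ker1 G) else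
       undefined),
     comp20 = (\<lambda>\<alpha> \<beta>. if s1 (s2 \<alpha>) + d1 (ker1 (s2 \<alpha>) + d2 (ker2
       \<alpha>)) = s1 (s2 \<beta>)
       then cell2 (s1 (s2 \<alpha>)) (ker1 (s2 \<alpha>) + ker1 (s2 \<beta>)) (ker2 \<alpha> + ker2
         \<beta>) else undefined),
     comp21 = (\<lambda>\<alpha> \<beta>. if cell1 (s1 (s2 \<alpha>)) (ker1 (s2 \<alpha>) + d2
       (ker2 \<alpha>)) = s2 \<beta>
       then cell2 (s1 (s2 \<alpha>)) (ker1 (s2 \<alpha>)) (ker2 \<alpha> + ker2 \<beta>) else
         undefined),
     bra0 = br,
     bra1 = (\<lambda>F G. cell1 (br (s1 F) (s1 G)) (r1 (s1 F) (ker1 G) - r1 (s1 G + d1 (ker1 G))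
       (ker1 F))),
     bra2 = (\<lambda>\<alpha> \<beta>. cell2 (br (s1 (s2 \<alpha>)) (s1 (s2 \<beta>)))
       (r1 (s1 (s2 \<alpha>)) (ker1 (s2 \<beta>)) - r1 (s1 (s2 \<beta>) + d1 (ker1 (s2 \<beta>)))
         (ker1 (s2 \<alpha>)))
       (r2 (s1 (s2 \<alpha>)) (ker2 \<beta>) - r2 (s1 (s2 \<beta>)) (ker2 \<alpha>))),
     jac = (\<lambda>x y z. cell1 (br (br x y) z) (jj x y z)),
     ident = (\<lambda>x y z u. cell2 (br (br (br x y) z) u) (skeleton.eta_part br r1 jj x y z u)
       (mm x y z u)) \<rparr>"

end

text \<open>Besides serving the construction of a Lie 3-algebra, this locale is interpreted for a
  given one: the last three equations of \<open>lie_skeleton\<close> are read off from the cells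
  computed here.\<close>

locale pre_cells = coordinates sc0 sc1 sc2 sv1 sv2 s1 s2 i0 i1 j1 j2
    + pre_lie_skeleton sc0 sv1 sv2 d1 d2 br r1 r2 jj mm
  for sc0 :: "'k::field \<Rightarrow> 'a::ab_group_add \<Rightarrow> 'a"
    and sc1 :: "'k \<Rightarrow> 'b::ab_group_add \<Rightarrow> 'b"
    and sc2 :: "'k \<Rightarrow> 'c::ab_group_add \<Rightarrow> 'c"
    and sv1 :: "'k \<Rightarrow> 'v::ab_group_add \<Rightarrow> 'v"
    and sv2 :: "'k \<Rightarrow> 'w::ab_group_add \<Rightarrow> 'w"
    and s1 s2 i0 i1 j1 j2 d1 d2 br r1 r2 jj mm
begin

abbreviation "L \<equiv> cells d1 d2 br r1 r2 jj mm"

lemma cells_coord [simp]: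
  "src1 L (cell1 x f) = x" "tgt1 L (cell1 x f) = x + d1 f"
  "src2 L (cell2 x f a) = cell1 x f" "tgt2 L (cell2 x f a) = cell1 x (f + d2 a)"
  "id0 L x = cell1 x 0" "id1 L (cell1 x f) = cell2 x f 0"
  "comp10 L (cell1 x f) (cell1 y g) = (if x + d1 f = y then cell1 x (f + g) else undefined)"
  "comp20 L (cell2 x f a) (cell2 y g b) = (if x + d1 f = y then cell2 x (f + g) (a + b) else
    undefined)"
  "comp21 L (cell2 x f a) (cell2 y g b) = (if x = y \<and> f + d2 a = g then cell2 x f (a + b) else
    undefined)"
  "bra0 L x y = br x y"
  "bra1 L (cell1 x f) (cell1 y g) = cell1 (br x y) (r1 x g - r1 (y + d1 g) f)"
  "bra2 L (cell2 x f a) (cell2 y g b) = cell2 (br x y) (r1 x g - r1 (y + d1 g) f) (r2 x b - r2 y a)"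
  "jac L x y z = cell1 (br (br x y) z) (jj x y z)"
  "ident L x y z u = cell2 (br (br (br x y) z) u) (eta_part x y z u) (mm x y z u)"
  by (simp_all add: cells_def d1_d2 i_coord)

lemma cells_category: "linear_2_category sc0 sc1 sc2 L"
  unfolding linear_2_category_def linear_composition_def Vector_Spaces.linear_iff all_cell1
    all_cell2
  by (simp add: spaces d1_d2 algebra_simps)

lemma cells_bracket: "linear_2_functor sc0 sc1 sc2 L 2 (on_pairs (bra0 L), on_pairs (bra1 L),
  on_pairs (bra2 L))"
proof -
  have br_cancel: "br x y + br y x = 0" "br x y + (br y x + z) = z" for x y z
    by (simp_all add: br_swap[of x y])
  have r1_cancel: "r1 (d1 f) g + r1 (d1 g) f = 0" for f g
    by (simp add: r1_d1[of f])
  \<comment> \<open>In the target of a bracket of 2-cells, the boundary of a 1-cell acts on the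
    boundary of a 2-cell; this mixed term has to vanish.\<close>
  have r1_d2: "r1 (d1 f) (d2 a) = 0" for f a
    by (simp add: r1_d1[of f] d1_d2)
  show ?thesis
    unfolding linear_2_functor_2 multilinear_on_pairs Vector_Spaces.linear_iff all_cell1 all_cell2
    by (simp add: spaces d1_d2 d1_r1 d2_r2 r2_d1 br_cancel r1_cancel r1_d2 algebra_simps)
qed

sublocale B: bracket_functor sc0 sc1 sc2 L
  using cells_category cells_bracket by unfold_locales

text \<open>With composability as a premise instead of a conditional in the value, large composites
  can be rewritten as a whole.\<close>

lemma comp20_cell2: "x + d1 f = y \<Longrightarrow> comp20 L (cell2 x f a) (cell2 y g b) = cell2 x
  (f + g) (a + b)"
  by simp

lemma bra2_cell2: "y + d1 g = y' \<Longrightarrow>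
    bra2 L (cell2 x f a) (cell2 y g b) = cell2 (br x y) (r1 x g - r1 y' f) (r2 x b - r2 y a)"
  by simp

text \<open>Names for the targets keep nested brackets small in \<open>jac_natural\<close>. The
  identity combines \<open>d1_r1\<close> with antisymmetry of \<open>br\<close>.\<close>

lemma d1_bracket:
  assumes "x + d1 f = x'" "y + d1 g = y'"
  shows "br x y + d1 (r1 x g - r1 y' f) = br x' y'"
  using assms[symmetric] br_swap[of "d1 g" "d1 f"] br_swap[of "y" "d1 f"] by (simp add: d1_r1)

lemma jac_natural:
  "comp20 L (jac_source (bra2 L) \<alpha> \<beta> \<gamma>) (id1 L (jac L (ttgt L \<alpha>) (ttgt L
    \<beta>) (ttgt L \<gamma>))) =
   comp20 L (id1 L (jac L (ssrc L \<alpha>) (ssrc L \<beta>) (ssrc L \<gamma>))) (jac_target (bra2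
     L) \<alpha> \<beta> \<gamma>)"
proof -
  obtain x f a where \<alpha>: "\<alpha> = cell2 x f a" using coord2 by metis
  obtain y g b where \<beta>: "\<beta> = cell2 y g b" using coord2 by metis
  obtain z h c where \<gamma>: "\<gamma> = cell2 z h c" using coord2 by metis
  define X Y Z where "X = x + d1 f" and "Y = y + d1 g" and "Z = z + d1 h"
  note X = X_def[symmetric] and Y = Y_def[symmetric] and Z = Z_def[symmetric]
  have tgt: "ttgt L \<alpha> = X" "ttgt L \<beta> = Y" "ttgt L \<gamma> = Z"
    by (simp_all add: \<alpha> \<beta> \<gamma> X Y Z d1_d2)
  have src: "jac_source (bra2 L) \<alpha> \<beta> \<gamma> = cell2 (br (br x y) z)
      (r1 (br x y) h - r1 Z (r1 x g - r1 Y f)) (r2 (br x y) c - r2 z (r2 x b - r2 y a))"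
    unfolding jac_source_def \<alpha> \<beta> \<gamma> bra2_cell2[OF Y] bra2_cell2[OF Z] ..
  have tgt': "jac_target (bra2 L) \<alpha> \<beta> \<gamma> = cell2 (br (br x z) y + br x (br y z))
      ((r1 (br x z) g - r1 Y (r1 x h - r1 Z f)) + (r1 x (r1 y h - r1 Z g) - r1 (br Y Z) f))
      ((r2 (br x z) b - r2 y (r2 x c - r2 z a)) + (r2 x (r2 y c - r2 z b) - r2 (br y z) a))"
    unfolding jac_target_def \<alpha> \<beta> \<gamma> bra2_cell2[OF Y] bra2_cell2[OF Z]
      bra2_cell2[OF d1_bracket[OF Y Z]] cell_add ..
  have t: "br (br x y) z + d1 (jj x y z) = br (br x z) y + br x (br y z)"
    by (simp add: d1_jj)
  \<comment> \<open>Passing from sources to targets one slot at a time produces exactly the terms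
    \<open>jj (d1 _)\<close> that occur in \<open>r1_br\<close>.\<close>
  have jjX: "jj X Y Z = jj x y z + jj (d1 h) x y - jj (d1 g) x Z + jj (d1 f) Y Z"
  proof -
    have "jj X Y Z = jj x Y Z + jj (d1 f) Y Z" "jj x Y Z = jj x y Z - jj (d1 g) x Z"
      "jj x y Z = jj x y z + jj (d1 h) x y"
      using jj_swap(1)[of x "d1 g" Z] jj_swap(2)[of x y "d1 h"] jj_swap(1)[of x "d1 h" y]
      by (simp_all add: X_def Y_def Z_def)
    then show ?thesis by simp
  qed
  \<comment> \<open>Replacing z by Z in the first action and Y by y in the second changes both by
    \<open>r1 (d1 g) (r1 x h)\<close>. These changes cancel in the difference, after which
    \<open>r1_br\<close> applies.\<close>
  have "r1 (br x z) g = r1 (br x Z) g + r1 (d1 g) (r1 x h)"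
    using r1_d1[of "r1 x h" g] by (simp add: Z_def d1_r1)
  moreover have "r1 Y (r1 x h) = r1 y (r1 x h) + r1 (d1 g) (r1 x h)"
    by (simp add: Y_def)
  ultimately have V1: "(r1 (br x y) h - r1 Z (r1 x g - r1 Y f)) + jj X Y Z =
      jj x y z + ((r1 (br x z) g - r1 Y (r1 x h - r1 Z f)) + (r1 x (r1 y h - r1 Z g) - r1 (br Y Z)
        f))"
    unfolding jjX by (simp add: r1_br algebra_simps)
  show ?thesis
    unfolding src tgt' tgt unfolding \<alpha> \<beta> \<gamma> cells_coord(1,3,6,13)
      comp20_cell2[OF d1_bracket[OF d1_bracket[OF X Y] Z]] comp20_cell2[OF t] V1
    by (simp add: r2_br)
qed

sublocale jacobiator sc0 sc1 sc2 L
proof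
  show "B.square (jac_source (bra2 L) \<alpha> \<beta> \<gamma>) (jac L (ttgt L \<alpha>) (ttgt L
    \<beta>) (ttgt L \<gamma>))
    (jac L (ssrc L \<alpha>) (ssrc L \<beta>) (ssrc L \<gamma>)) (jac_target (bra2 L) \<alpha>
      \<beta> \<gamma>)" for \<alpha> \<beta> \<gamma>
    using jac_natural[of \<alpha> \<beta> \<gamma>]
    by (simp add: B.square_def jac_source_def jac_target_def d1_jj)
qed

section \<open>The cells of the coherence law in coordinates\<close>

lemma then1_id_cell1: "lie3_cells.then1_id L (cell1 x f) (cell1 y g) = cell1 x (f + g)"
  by (simp add: lie3_cells.then1_id_def)

lemma then2_id_cell2: "lie3_cells.then2_id L (cell2 x f a) (cell2 y g b) = cell2 x (f + g) (a + b)"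
  by (simp add: lie3_cells.then2_id_def d1_d2)

lemma inverse21_cell2: "lie3_cells.inverse21 L (cell2 x f a) = cell2 x (f + d2 a) (- a)"
  by (simp add: lie3_cells.inverse21_def part2_def)

lemma d1_r1_right: "d1 (r1 x f) = - br (d1 f) x"
  by (simp only: d1_r1 br_swap[of x])

lemma eta_cell1: "lie3_cells.eta L x y z u = cell1 (br (br (br x y) z) u) (eta_part x y z u)"
  by (simp add: lie3_cells.eta_def then1_id_cell1 eta_part_def d1_r1_right d1_jj)

lemma eps_cell1: "lie3_cells.eps L x y z u = cell1 (br (br (br x y) z) u) (eps_part x y z u)"
  by (simp add: lie3_cells.eps_def then1_id_cell1 eps_part_def d1_r1_right d1_jj)

lemma d1_eta_part: "d1 (eta_part x y z u) = ident_target br x y z u - ident_source br x y z u"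
  by (simp add: eta_part_def d1_r1_right[of u] d1_r1_right[of y] d1_r1[of x] d1_jj ident_target_def
    ident_source_def)

lemma d1_eps_part: "d1 (eps_part x y z u) = ident_target br x y z u - ident_source br x y z u"
  by (simp add: eps_part_def d1_r1_right[of z] d1_jj ident_target_def ident_source_def)

text \<open>Here and in the next three lemmas, composing along 0-cells adds the components of the
  factors, and bracketing with an identity on the right gives an action with a minus sign.
  \<open>d1_jj\<close> and \<open>d1_eta_part\<close> establish composability with the factors to
  which no identity is added.\<close>

lemma alpha1_cell2: "lie3_cells.alpha1 L x y z u v = cell2 (br (br (br (br x y) z) u) v)
   (jj (br (br x y) z) u v + (eta_part x y z (br u v) - r1 u (eta_part x y z v))
    - (r1 u (jj x (br z v) y) + r1 u (jj (br x v) z y) + r1 u (jj x z (br y v)))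
    + (eta_part (br x v) y z u + eta_part x (br y v) z u + eta_part x y (br z v) u))
   (mm x y z (br u v) - r2 u (mm x y z v) + (mm (br x v) y z u + mm x (br y v) z u + mm x y (br z
     v) u))"
  by (simp add: lie3_cells.alpha1_def then2_id_cell2 d1_jj)

lemma alpha4_cell2: "lie3_cells.alpha4 L x y z u v = cell2 (br (br (br (br x y) z) u) v)
   (- r1 v (eta_part x y z u)
    - (r1 v (jj (br x u) z y) + r1 v (jj x z (br y u)) + r1 v (jj x (br z u) y))
    + (eta_part (br x u) y z v + eta_part x (br y u) z v + eta_part x y (br z u) v)
    + (r1 y (r1 z (jj x u v)) - r1 (br y z) (jj x u v) - r1 x (r1 z (jj y u v)) - r1 y (r1 x (jj z
      u v))
      + r1 x (r1 y (jj z u v)) + r1 (br x z) (jj y u v)))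
   (- r2 v (mm x y z u) + (mm (br x u) y z v + mm x (br y u) z v + mm x y (br z u) v))"
  by (simp add: lie3_cells.alpha4_def then2_id_cell2 d1_jj d1_r1_right d1_eta_part ident_target_def
    ident_source_def
    br_swap[of z y] br_swap[of z "br y u"] br_swap[of "br z u" y])

lemma alpha3_cell2: "lie3_cells.alpha3 L x y z u v = cell2 (br (br (br (br x y) z) u) v)
   (eta_part (br x y) z u v - r1 z (jj (br x y) v u) - r1 z (eta_part x y u v)
     + (- r1 (br z u) (jj x y v) + jj x y (br (br z v) u) + jj x y (br z (br u v))
       + jj (br (br x v) u) y z + jj (br x v) (br y u) z + jj (br x u) (br y v) z
       + jj x (br (br y v) u) z + jj (br x (br u v)) y z + jj x (br y (br u v)) z - r1 (br z v) (jj
         x y u))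
     + (jj x (br y v) (br z u) + jj (br x v) y (br z u) + jj x (br y u) (br z v) + jj (br x u) y
       (br z v)))
   (mm (br x y) z u v - r2 z (mm x y u v))"
  by (simp add: lie3_cells.alpha3_def then2_id_cell2 d1_jj d1_r1_right d1_eta_part ident_target_def
    ident_source_def
    br_swap[of v u])

lemma alpha2_cell2: "lie3_cells.alpha2 L x y z u v = cell2 (br (br (br (br x y) z) u) v)
   (r1 v (r1 u (jj x y z)) + (eta_part (br x z) y u v + eta_part x (br y z) u v)
     + (r1 x (jj (br y z) v u) - r1 y (jj (br x z) v u))
     + (r1 x (eta_part y z u v) - r1 y (eta_part x z u v))
     + (- r1 (br y u) (jj x z v) - r1 (br y v) (jj x z u) + r1 (br x v) (jj y z u) + r1 (br x u)
       (jj y z v)))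
   (mm (br x z) y u v + mm x (br y z) u v + (r2 x (mm y z u v) - r2 y (mm x z u v)))"
  by (simp add: lie3_cells.alpha2_def then2_id_cell2 d1_jj d1_r1_right d1_eta_part ident_target_def
    ident_source_def)

end

locale skeleton_cells = pre_cells sc0 sc1 sc2 sv1 sv2 s1 s2 i0 i1 j1 j2 d1 d2 br r1 r2 jj mm
    + lie_skeleton sc0 sv1 sv2 d1 d2 br r1 r2 jj mm
  for sc0 :: "'k::field \<Rightarrow> 'a::ab_group_add \<Rightarrow> 'a"
    and sc1 :: "'k \<Rightarrow> 'b::ab_group_add \<Rightarrow> 'b"
    and sc2 :: "'k \<Rightarrow> 'c::ab_group_add \<Rightarrow> 'c"
    and sv1 :: "'k \<Rightarrow> 'v::ab_group_add \<Rightarrow> 'v"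
    and sv2 :: "'k \<Rightarrow> 'w::ab_group_add \<Rightarrow> 'w"
    and s1 s2 i0 i1 j1 j2 d1 d2 br r1 r2 jj mm
begin

lemma cells_coherence:
  "lie3_cells.alpha1 L x y z u v + lie3_cells.inverse21 L (lie3_cells.alpha4 L x y z u v) =
   lie3_cells.alpha3 L x y z u v + lie3_cells.inverse21 L (lie3_cells.alpha2 L x y z u v)"
proof -
  \<comment> \<open>Antisymmetry as a general rewrite rule would loop. These instances sort the
    arguments, with
    \<open>x\<close>, \<open>y\<close>, \<open>z\<close>, \<open>u\<close>, \<open>v\<close> in
      this order and brackets moved to the left; together with \<open>r1_br\<close>, which
    eliminates all actions of brackets, they bring the component in \<open>V1\<close> into a normal
      form.\<close>
  note normal =
      br_swap[of y x] jj_swap(1)[of y x] jj_swap(2)[of _ y x] br_swap[of z x] jj_swap(1)[of z x]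
      jj_swap(2)[of _ z x] br_swap[of u x] jj_swap(1)[of u x] jj_swap(2)[of _ u x]
      br_swap[of v x] jj_swap(1)[of v x] jj_swap(2)[of _ v x] br_swap[of z y] jj_swap(1)[of z y]
      jj_swap(2)[of _ z y] br_swap[of u y] jj_swap(1)[of u y] jj_swap(2)[of _ u y]
      br_swap[of v y] jj_swap(1)[of v y] jj_swap(2)[of _ v y] br_swap[of u z] jj_swap(1)[of u z]
      jj_swap(2)[of _ u z] br_swap[of v z] jj_swap(1)[of v z] jj_swap(2)[of _ v z]
      br_swap[of v u] jj_swap(1)[of v u] jj_swap(2)[of _ v u] br_swap[of x "br _ _"]
      jj_swap(1)[of x "br _ _"] jj_swap(2)[of _ x "br _ _"] br_swap[of y "br _ _"]
      jj_swap(1)[of y "br _ _"] jj_swap(2)[of _ y "br _ _"] br_swap[of z "br _ _"]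
      jj_swap(1)[of z "br _ _"] jj_swap(2)[of _ z "br _ _"] br_swap[of u "br _ _"]
      jj_swap(1)[of u "br _ _"] jj_swap(2)[of _ u "br _ _"] br_swap[of v "br _ _"]
      jj_swap(1)[of v "br _ _"] jj_swap(2)[of _ v "br _ _"] jj_swap(1)[of "br z u" "br x y"]
      jj_swap(1)[of "br z v" "br x y"] jj_swap(1)[of "br u v" "br x y"]
      jj_swap(1)[of "br y u" "br x z"] jj_swap(1)[of "br y v" "br x z"]
      jj_swap(1)[of "br u v" "br x z"] jj_swap(1)[of "br y z" "br x u"]
      jj_swap(1)[of "br y v" "br x u"] jj_swap(1)[of "br z v" "br x u"]
      jj_swap(1)[of "br y z" "br x v"] jj_swap(1)[of "br y u" "br x v"]
      jj_swap(1)[of "br z u" "br x v"] jj_swap(1)[of "br u v" "br y z"]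
      jj_swap(1)[of "br z v" "br y u"] jj_swap(1)[of "br z u" "br y v"]
  show ?thesis
    unfolding alpha1_cell2 alpha4_cell2 alpha3_cell2 alpha2_cell2 inverse21_cell2 cell_add
      cell_inject
  proof (intro conjI, rule refl, goal_cases)
    \<comment> \<open>The component in \<open>V1\<close>: inverting a cell adds \<open>d2\<close> of
      its \<open>V2\<close>-component, which \<open>d2_mm\<close> converts into \<epsilon> minus
      \<eta>. What remains involves \<open>jj\<close> and actions only.\<close>
    case 1
    show ?case
      by (simp add: eta_part_def eps_part_def d2_r2 d2_mm r1_br d1_jj normal algebra_simps)
  next
    case 2
    show ?case
      using coherence_part[of x y z u v] by (simp add: coherence_part_def algebra_simps)
  qed
qed

end

section \<open>Transformations and modifications of arity three and four\<close>

lemma linear_2_transformation_3: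
  "linear_2_transformation sc0 sc1 sc2 C 3 (on_triples F0, on_triples F1, on_triples F2)
     (on_triples G0, on_triples G1, on_triples G2) (on_triples \<theta>) \<longleftrightarrow>
   linear_2_functor sc0 sc1 sc2 C 3 (on_triples F0, on_triples F1, on_triples F2) \<and>
   linear_2_functor sc0 sc1 sc2 C 3 (on_triples G0, on_triples G1, on_triples G2) \<and>
   multilinear 3 sc0 sc1 (on_triples \<theta>) \<and>
   (\<forall>x y z. src1 C (\<theta> x y z) = F0 x y z \<and> tgt1 C (\<theta> x y z) = G0 x y z)
     \<and>
   (\<forall>\<alpha> \<beta> \<gamma>. comp20 C (F2 \<alpha> \<beta> \<gamma>) (id1 C (\<theta>
     (ttgt C \<alpha>) (ttgt C \<beta>) (ttgt C \<gamma>))) =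
      comp20 C (id1 C (\<theta> (ssrc C \<alpha>) (ssrc C \<beta>) (ssrc C \<gamma>))) (G2 \<alpha>
        \<beta> \<gamma>))"
  unfolding linear_2_transformation_def
  by (simp add: on_triples_def eval_nat_numeral all_length_Suc)

lemma linear_2_transformation_4:
  "linear_2_transformation sc0 sc1 sc2 C 4 (on_quadruples F0, on_quadruples F1, on_quadruples F2)
     (on_quadruples G0, on_quadruples G1, on_quadruples G2) (on_quadruples \<theta>)
       \<longleftrightarrow>
   linear_2_functor sc0 sc1 sc2 C 4 (on_quadruples F0, on_quadruples F1, on_quadruples F2) \<and>
   linear_2_functor sc0 sc1 sc2 C 4 (on_quadruples G0, on_quadruples G1, on_quadruples G2) \<and>
   multilinear 4 sc0 sc1 (on_quadruples \<theta>) \<and>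
   (\<forall>x y z u. src1 C (\<theta> x y z u) = F0 x y z u \<and> tgt1 C (\<theta> x y z u) = G0
     x y z u) \<and>
   (\<forall>\<alpha> \<beta> \<gamma> \<delta>.
      comp20 C (F2 \<alpha> \<beta> \<gamma> \<delta>) (id1 C (\<theta> (ttgt C \<alpha>) (ttgt C
        \<beta>) (ttgt C \<gamma>) (ttgt C \<delta>))) =
      comp20 C (id1 C (\<theta> (ssrc C \<alpha>) (ssrc C \<beta>) (ssrc C \<gamma>) (ssrc C
        \<delta>))) (G2 \<alpha> \<beta> \<gamma> \<delta>))"
  unfolding linear_2_transformation_def
  by (simp add: on_quadruples_def eval_nat_numeral all_length_Suc)

lemma linear_2_modification_4:
  "linear_2_modification sc0 sc1 sc2 C 4 (on_quadruples F0, on_quadruples F1, on_quadruples F2)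
     (on_quadruples G0, on_quadruples G1, on_quadruples G2) (on_quadruples \<eta>) (on_quadruples
       \<epsilon>)
     (on_quadruples \<mu>) \<longleftrightarrow>
   linear_2_transformation sc0 sc1 sc2 C 4 (on_quadruples F0, on_quadruples F1, on_quadruples F2)
     (on_quadruples G0, on_quadruples G1, on_quadruples G2) (on_quadruples \<eta>) \<and>
   linear_2_transformation sc0 sc1 sc2 C 4 (on_quadruples F0, on_quadruples F1, on_quadruples F2)
     (on_quadruples G0, on_quadruples G1, on_quadruples G2) (on_quadruples \<epsilon>) \<and>
   multilinear 4 sc0 sc2 (on_quadruples \<mu>) \<and>
   (\<forall>x y z u. src2 C (\<mu> x y z u) = \<eta> x y z u \<and> tgt2 C (\<mu> x y z u) =
     \<epsilon> x y z u) \<and>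
   (\<forall>\<alpha> \<beta> \<gamma> \<delta>.
      comp20 C (F2 \<alpha> \<beta> \<gamma> \<delta>) (\<mu> (ttgt C \<alpha>) (ttgt C \<beta>)
        (ttgt C \<gamma>) (ttgt C \<delta>)) =
      comp20 C (\<mu> (ssrc C \<alpha>) (ssrc C \<beta>) (ssrc C \<gamma>) (ssrc C \<delta>)) (G2
        \<alpha> \<beta> \<gamma> \<delta>))"
  unfolding linear_2_modification_def
  by (simp add: on_quadruples_def eval_nat_numeral all_length_Suc)

section \<open>The axioms of a Lie 3-algebra for the cells of a skeleton\<close>

context skeleton_cells begin

text \<open>Antisymmetry moves \<open>mm_d1\<close> to every slot. Source and target 0-cells of a
  2-cell differ by a boundary, so \<open>mm\<close> does not distinguish them.\<close>

lemma mm_invariant: "mm (x + d1 f) (y + d1 g) (z + d1 h) (u + d1 k) = mm x y z u"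
proof -
  have "mm x (d1 f) z u = 0" "mm x y (d1 f) u = 0" "mm x y z (d1 f) = 0" for x y z u f
    using mm_swap(1)[of x "d1 f"] mm_swap(2)[of x y "d1 f"] mm_swap(1)[of x "d1 f" y]
      mm_swap(3)[of x y z "d1 f"] mm_swap(2)[of x y "d1 f" z] by (simp_all add: mm_d1)
  then show ?thesis by (simp add: mm_d1)
qed

text \<open>\<mu> is the identity of \<eta> plus a cell in the kernel of \<open>src2\<close>. The
  first part is natural by \<open>eta_square\<close>, the second is the same at sources and targets,
  and additivity of composition joins them.\<close>

lemma ident_natural:
  "comp20 L (ident_source (bra2 L) \<alpha> \<beta> \<gamma> \<delta>) (ident L (ttgt L \<alpha>)
    (ttgt L \<beta>) (ttgt L \<gamma>) (ttgt L \<delta>)) =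
   comp20 L (ident L (ssrc L \<alpha>) (ssrc L \<beta>) (ssrc L \<gamma>) (ssrc L \<delta>))
     (ident_target (bra2 L) \<alpha> \<beta> \<gamma> \<delta>)"
proof -
  let ?F = "ident_source (bra2 L) \<alpha> \<beta> \<gamma> \<delta>" and ?G = "ident_target (bra2
    L) \<alpha> \<beta> \<gamma> \<delta>"
  let ?e = "lie3_cells.eta L (ttgt L \<alpha>) (ttgt L \<beta>) (ttgt L \<gamma>) (ttgt L \<delta>)"
  let ?e' = "lie3_cells.eta L (ssrc L \<alpha>) (ssrc L \<beta>) (ssrc L \<gamma>) (ssrc L
    \<delta>)"
  note sq = eta_square[of \<alpha> \<beta> \<gamma> \<delta>, unfolded B.square_def]
  have ident: "ident L x y z u = id1 L (lie3_cells.eta L x y z u) + cell2 0 0 (mm x y z u)" for x y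
    z u
    by (simp add: eta_cell1)
  have m: "mm (ttgt L \<alpha>) (ttgt L \<beta>) (ttgt L \<gamma>) (ttgt L \<delta>) = mm (ssrc L
    \<alpha>) (ssrc L \<beta>) (ssrc L \<gamma>) (ssrc L \<delta>)"
    (is "?m = ?m'")
  proof -
    have "\<exists>f. ttgt L \<alpha> = ssrc L \<alpha> + d1 f" for \<alpha>
      using all_cell2[of "\<lambda>\<alpha>. \<exists>f. ttgt L \<alpha> = ssrc L \<alpha> + d1 f"]
        by (auto simp: d1_d2)
    then show ?thesis
      using mm_invariant by metis
  qed
  have zero: "comp20 L 0 (cell2 0 0 a) = cell2 0 0 a" "comp20 L (cell2 0 0 a) 0 = cell2 0 0 a" for a
    using cells_coord(8)[of 0 0 0 0 0 a] cells_coord(8)[of 0 0 a 0 0 0] by simp_all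
  have z: "composable20 L 0 (cell2 0 0 a)" "composable20 L (cell2 0 0 a) 0" for a
    using cells_coord(1-4)[of 0 0] cells_coord(3,4)[of 0 0 0] by (simp_all add: d1_d2)
  have "comp20 L ?F (id1 L ?e + cell2 0 0 ?m) = comp20 L ?F (id1 L ?e) + comp20 L 0 (cell2 0 0 ?m)"
    using B.comp_add(2)[of ?F "id1 L ?e" 0 "cell2 0 0 ?m"] sq z by simp
  also have "\<dots> = comp20 L (id1 L ?e') ?G + comp20 L (cell2 0 0 ?m') 0"
    using sq by (simp add: zero m)
  also have "\<dots> = comp20 L (id1 L ?e' + cell2 0 0 ?m') ?G"
    using B.comp_add(2)[of "id1 L ?e'" ?G "cell2 0 0 ?m'" 0] sq z by simp
  finally show ?thesis unfolding ident .
qed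

lemma bra0_cells: "bra0 L = br"
  by (simp add: cells_def)

lemma cells_lie_3_algebra: "lie_3_algebra sc0 sc1 sc2 L"
  unfolding lie_3_algebra_def
proof (intro conjI)
  show "antisymmetric 2 (on_pairs (bra0 L))"
    unfolding antisymmetric_2 on_pairs_def by (simp, intro allI, rule br_swap)
  \<comment> \<open>The mixed term \<open>r1 (d1 g) f\<close> changes sign under exchange of f and g
    by \<open>r1_d1\<close>, which makes the asymmetric-looking bracket antisymmetric.\<close>
  have r1_swap: "r1 x g - r1 (y + d1 g) f = - (r1 y f - r1 (x + d1 f) g)" for x y f g
    using r1_d1[of f g] by simp
  have "bra1 L (cell1 x f) (cell1 y g) = - bra1 L (cell1 y g) (cell1 x f)" for x y f g
    unfolding cells_coord(11) cell_uminus by (simp only: cell_inject br_swap[of x y] r1_swap[of x g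
      y f] simp_thms)
  note bra1_swap = this
  show "antisymmetric 2 (on_pairs (bra1 L))"
    unfolding antisymmetric_2 on_pairs_def all_cell1
    by (simp only: nth_Cons_0 nth_Cons_Suc One_nat_def, intro allI, rule bra1_swap)
  have "bra2 L (cell2 x f a) (cell2 y g b) = - bra2 L (cell2 y g b) (cell2 x f a)" for x y f g a b
    unfolding cells_coord(12) cell_uminus
    by (simp only: cell_inject br_swap[of x y] r1_swap[of x g y f] minus_diff_eq simp_thms)
  note bra2_swap = this
  show "antisymmetric 2 (on_pairs (bra2 L))"
    unfolding antisymmetric_2 on_pairs_def all_cell2
    by (simp only: nth_Cons_0 nth_Cons_Suc One_nat_def, intro allI, rule bra2_swap)
  show J: "linear_2_transformation sc0 sc1 sc2 L 3
     (on_triples (jac_source (bra0 L)), on_triples (jac_source (bra1 L)), on_triples (jac_source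
       (bra2 L)))
     (on_triples (jac_target (bra0 L)), on_triples (jac_target (bra1 L)), on_triples (jac_target
       (bra2 L)))
     (on_triples (jac L))"
    unfolding linear_2_transformation_3 multilinear_on_triples Vector_Spaces.linear_iff
    using B.jac_source_functor B.jac_target_functor jac_natural
    by (simp add: spaces jac_source_def jac_target_def d1_jj)
  show "antisymmetric 3 (\<lambda>xs. part1 L (on_triples (jac L) xs))"
    unfolding antisymmetric_3 on_triples_def part1_def by (simp, intro conjI allI; rule jj_swap)
  show "antisymmetric 4 (\<lambda>xs. part2 L (on_quadruples (ident L) xs))"
    unfolding antisymmetric_4 on_quadruples_def part2_def by (simp, intro conjI allI; rule mm_swap)
  have eta: "linear_2_transformation sc0 sc1 sc2 L 4
     (on_quadruples (ident_source (bra0 L)), on_quadruples (ident_source (bra1 L)), on_quadruples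
       (ident_source (bra2 L)))
     (on_quadruples (ident_target (bra0 L)), on_quadruples (ident_target (bra1 L)), on_quadruples
       (ident_target (bra2 L)))
     (on_quadruples (lie3_cells.eta L))"
    unfolding linear_2_transformation_4 multilinear_on_quadruples Vector_Spaces.linear_iff
    using B.ident_source_functor B.ident_target_functor eta_square[unfolded B.square_def]
    by (simp add: spaces eta_cell1 d1_eta_part ident_source_def bra0_cells) (simp add: eta_part_def
      algebra_simps V1.scale_right_diff_distrib)
  have eps: "linear_2_transformation sc0 sc1 sc2 L 4
     (on_quadruples (ident_source (bra0 L)), on_quadruples (ident_source (bra1 L)), on_quadruples
       (ident_source (bra2 L)))
     (on_quadruples (ident_target (bra0 L)), on_quadruples (ident_target (bra1 L)), on_quadruples
       (ident_target (bra2 L)))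
     (on_quadruples (lie3_cells.eps L))"
    unfolding linear_2_transformation_4 multilinear_on_quadruples Vector_Spaces.linear_iff
    using B.ident_source_functor B.ident_target_functor eps_square[unfolded B.square_def]
    by (simp add: spaces eps_cell1 d1_eps_part ident_source_def bra0_cells) (simp add: eps_part_def
      algebra_simps V1.scale_right_diff_distrib)
  show "linear_2_modification sc0 sc1 sc2 L 4
     (on_quadruples (ident_source (bra0 L)), on_quadruples (ident_source (bra1 L)), on_quadruples
       (ident_source (bra2 L)))
     (on_quadruples (ident_target (bra0 L)), on_quadruples (ident_target (bra1 L)), on_quadruples
       (ident_target (bra2 L)))
     (on_quadruples (lie3_cells.eta L)) (on_quadruples (lie3_cells.eps L)) (on_quadruples (ident
       L))"
    unfolding linear_2_modification_4 multilinear_on_quadruples Vector_Spaces.linear_iff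
    using eta eps ident_natural
    by (simp add: spaces eta_cell1 eps_cell1 d2_mm) (simp add: eta_part_def algebra_simps
      V1.scale_right_diff_distrib)
  show "lie3_cells.coherence L"
    unfolding lie3_cells.coherence_def using cells_coherence by blast
qed (rule cells_category cells_bracket)+

end

section \<open>The correspondence evaluated on a skeleton\<close>

context skeleton_cells begin

lemma inv_coord: "inv j1 (cell1 0 f) = f" "inv j2 (cell2 0 0 a) = a"
  using inv_f_f[OF inj(1), of f] inv_f_f[OF inj(2), of a] by (simp_all add: i_coord)

lemma lie_infinity_cells: "lie3_to_lie_infinity j1 j2 L = ell_maps d1 d2 br r1 r2 jj mm"
proof
  fix vs
  show "lie3_to_lie_infinity j1 j2 L vs = ell_maps d1 d2 br r1 r2 jj mm vs"
    by (cases "(d1, d2, br, r1, r2, jj, mm, vs)" rule: ell_maps.cases)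
      (simp_all add: i_coord inv_coord part1_def part2_def)
qed

end

section \<open>Lie 3-algebras are given by skeletons\<close>

text \<open>Evaluation at suitable arguments isolates each map; linearity of the actions removes the
  accompanying terms \<open>r1 y 0\<close> and \<open>r2 y 0\<close>.\<close>

lemma ell_maps_inject:
  assumes "lie_skeleton sc0 sv1 sv2 d1 d2 br r1 r2 jj mm"
    and "lie_skeleton sc0 sv1 sv2 d1' d2' br' r1' r2' jj' mm'"
    and eq: "ell_maps d1 d2 br r1 r2 jj mm = ell_maps d1' d2' br' r1' r2' jj' mm'"
  shows "d1 = d1' \<and> d2 = d2' \<and> br = br' \<and> r1 = r1' \<and> r2 = r2' \<and> jj = jj'
    \<and> mm = mm'"
proof -
  interpret A: lie_skeleton sc0 sv1 sv2 d1 d2 br r1 r2 jj mm by fact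
  interpret B: lie_skeleton sc0 sv1 sv2 d1' d2' br' r1' r2' jj' mm' by fact
  have "d1 f = d1' f" "d2 a = d2' a" "br x y = br' x y" "r1 x f = r1' x f" "r2 x a = r2' x a"
    "jj x y z = jj' x y z" "mm x y z u = mm' x y z u" for x y z u f a
    using fun_cong[OF eq, of "[(0, f, a)]"] fun_cong[OF eq, of "[(x, 0, 0), (y, f, a)]"]
      fun_cong[OF eq, of "[(x, 0, 0), (y, 0, 0), (z, 0, 0)]"]
      fun_cong[OF eq, of "[(x, 0, 0), (y, 0, 0), (z, 0, 0), (u, 0, 0)]"]
    by simp_all
  then show ?thesis by (simp add: fun_eq_iff)
qed

context coordinates begin

lemma ker1_add: "ker1 (F + G) = ker1 F + ker1 G"
  using ker_coord(1)[of "s1 F + s1 G" "ker1 F + ker1 G"] by (simp add: coord1 flip: cell_add)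

lemma ker2_add: "ker2 (\<alpha> + \<beta>) = ker2 \<alpha> + ker2 \<beta>"
  using ker_coord(2)[of "s1 (s2 \<alpha>) + s1 (s2 \<beta>)" "ker1 (s2 \<alpha>) + ker1 (s2
    \<beta>)" "ker2 \<alpha> + ker2 \<beta>"]
  by (simp add: coord2 flip: cell_add)

lemma ker2_scale: "ker2 (sc2 r \<alpha>) = sv2 r (ker2 \<alpha>)"
  using ker_coord(2)[of "sc0 r (s1 (s2 \<alpha>))" "sv1 r (ker1 (s2 \<alpha>))" "sv2 r (ker2
    \<alpha>)"]
  by (simp add: coord2 flip: cell_scale)

lemma coord_zero [simp]: "s1 0 = 0" "s2 0 = 0" "ker1 0 = 0" "ker2 0 = 0"
  using s_coord(1)[of 0 0] s_coord(2)[of 0 0 0] ker_coord(1)[of 0 0] ker_coord(2)[of 0 0 0] by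
    simp_all

lemma lie_3_algebra_eq_cells:
  fixes L :: "('a, 'b, 'c) lie3"
  assumes L: "lie_3_algebra sc0 sc1 sc2 L"
    and fields: "src1 L = s1" "src2 L = s2" "id0 L = i0" "id1 L = i1"
  shows "\<exists>d1 d2 br r1 r2 jj mm.
    lie_skeleton sc0 sv1 sv2 d1 d2 br r1 r2 jj mm \<and> L = cells d1 d2 br r1 r2 jj mm"
proof -
  note lie = L[unfolded lie_3_algebra_def]
  interpret B: bracket_functor sc0 sc1 sc2 L
    using lie by unfold_locales simp_all
  have jacobi: "linear_2_transformation sc0 sc1 sc2 L 3
       (on_triples (jac_source (bra0 L)), on_triples (jac_source (bra1 L)), on_triples (jac_source
         (bra2 L)))
       (on_triples (jac_target (bra0 L)), on_triples (jac_target (bra1 L)), on_triples (jac_target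
         (bra2 L)))
       (on_triples (jac L))"
    and ident: "linear_2_modification sc0 sc1 sc2 L 4
       (on_quadruples (ident_source (bra0 L)), on_quadruples (ident_source (bra1 L)), on_quadruples
         (ident_source (bra2 L)))
       (on_quadruples (ident_target (bra0 L)), on_quadruples (ident_target (bra1 L)), on_quadruples
         (ident_target (bra2 L)))
       (on_quadruples (lie3_cells.eta L)) (on_quadruples (lie3_cells.eps L)) (on_quadruples (ident
         L))"
    and anti: "antisymmetric 2 (on_pairs (bra0 L))" "antisymmetric 2 (on_pairs (bra1 L))"
      "antisymmetric 2 (on_pairs (bra2 L))" "antisymmetric 3 (\<lambda>xs. part1 L (on_triples (jac
        L) xs))"
      "antisymmetric 4 (\<lambda>xs. part2 L (on_quadruples (ident L) xs))"
    and coherence: "lie3_cells.coherence L"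
    using lie by blast+

  have src [simp]: "src1 L (cell1 x f) = x" "src2 L (cell2 x f a) = cell1 x f" for x f a
    by (simp_all add: fields)
  have id: "id0 L x = cell1 x 0" "id1 L (cell1 x f) = cell2 x f 0" for x f
    by (simp_all add: fields i_coord)
  have src_zero [simp]: "src1 L 0 = 0" "src2 L 0 = 0"
    by (simp_all add: fields)
  have id_zero [simp]: "id0 L 0 = 0" "id1 L 0 = 0"
    using id(1)[of 0] id(2)[of 0 0] by simp_all
  define d1 where "d1 f = tgt1 L (cell1 0 f)" for f
  define d2 where "d2 a = ker1 (tgt2 L (cell2 0 0 a))" for a
  define br where "br = bra0 L"
  define r1 where "r1 x f = ker1 (bra1 L (cell1 x 0) (cell1 0 f))" for x f
  define r2 where "r2 x a = ker2 (bra2 L (cell2 x 0 0) (cell2 0 0 a))" for x a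
  define jj where "jj x y z = ker1 (jac L x y z)" for x y z
  define mm where "mm x y z u = ker2 (ident L x y z u)" for x y z u

  have tgt1: "tgt1 L (cell1 x f) = x + d1 f" for x f
    using B.linear_structure(2)[of "cell1 x 0" "cell1 0 f"] B.globular(2)[of x] by (simp add:
      d1_def id)
  have tgt2_0: "tgt2 L (cell2 0 0 a) = cell1 0 (d2 a)" for a
    using B.globular(5)[of "cell2 0 0 a"] coord1[of "tgt2 L (cell2 0 0 a)"] by (simp add: d2_def
      fields)
  have tgt2: "tgt2 L (cell2 x f a) = cell1 x (f + d2 a)" for x f a
    using B.linear_structure(4)[of "cell2 x f 0" "cell2 0 0 a"] B.globular(4)[of "cell1 x f"]
    by (simp add: tgt2_0 id)
  have d1_add: "d1 (f + g) = d1 f + d1 g" for f g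
    using B.linear_structure(2)[of "cell1 0 f" "cell1 0 g"] by (simp add: d1_def)
  have d1_zero: "d1 0 = 0"
    using d1_add[of 0 0] by simp
  have tgt_zero [simp]: "tgt1 L 0 = 0" "tgt2 L 0 = 0"
    using B.linear_structure(2)[of 0 0] B.linear_structure(4)[of 0 0] by simp_all
  have d1_d2: "d1 (d2 a) = 0" for a
  proof -
    have "d1 (d2 a) = tgt1 L (tgt2 L (cell2 0 0 a))"
      by (simp add: tgt2_0 tgt1)
    also have "\<dots> = tgt1 L (src2 L (cell2 0 0 a))"
      by (rule B.globular(6)[symmetric])
    finally show ?thesis by simp
  qed
  have V: "vector_space sc0" "vector_space sv1" "vector_space sv2" by (rule spaces)+
  have r1_add_left: "r1 (x + y) f = r1 x f + r1 y f" for x y f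
  proof -
    show ?thesis
      using B.bracket_linear(3)[of "cell1 x 0" "cell1 y 0" "cell1 0 f"] by (simp add: r1_def
        ker1_add)
  qed
  \<comment> \<open>By additivity the composite of (x, f) and (y, g) is the sum of (x, f) composed
    with (x + d1 f, 0) and of 0 composed with (0, g), and the unit laws evaluate both. The other two
    compositions are treated likewise.\<close>
  have comp10: "comp10 L (cell1 x f) (cell1 y g) = (if x + d1 f = y then cell1 x (f + g) else
    undefined)" for x f y g
  proof -
    have "comp10 L (cell1 x f + 0) (cell1 (x + d1 f) 0 + cell1 0 g) = cell1 x f + cell1 0 g"
      using B.comp_add(1)[of "cell1 x f" "cell1 (x + d1 f) 0" 0 "cell1 0 g"]
        B.composite_laws(10)[rule_format, of "cell1 x f"] B.composite_laws(10)[rule_format, of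
          "cell1 0 g"]
      by (simp add: tgt1 id)
    then show ?thesis
      using B.composite_laws(12)[rule_format, of "cell1 x f" "cell1 y g"] by (auto simp: tgt1)
  qed
  have comp20: "comp20 L (cell2 x f a) (cell2 y g b) = (if x + d1 f = y then cell2 x (f + g) (a +
    b) else undefined)"
    for x f a y g b
  proof -
    have "comp20 L (cell2 x f a + 0) (cell2 (x + d1 f) 0 0 + cell2 0 g b) = cell2 x f a + cell2 0 g
      b"
      using B.comp_add(2)[of "cell2 x f a" "cell2 (x + d1 f) 0 0" 0 "cell2 0 g b"]
        B.composite_laws(4)[rule_format, of "cell2 x f a"] B.composite_laws(4)[rule_format, of
          "cell2 0 g b"]
      by (simp add: tgt1 tgt2 d1_add d1_d2 id)
    then show ?thesis
      using B.composite_laws(13)[rule_format, of "cell2 x f a" "cell2 y g b"] by (auto simp: tgt1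
        tgt2 d1_add d1_d2)
  qed
  have comp21: "comp21 L (cell2 x f a) (cell2 y g b) = (if x = y \<and> f + d2 a = g then cell2 x f
    (a + b) else undefined)"
    for x f a y g b
  proof -
    have "comp21 L (cell2 x f a + 0) (cell2 x (f + d2 a) 0 + cell2 0 0 b) = cell2 x f a + cell2 0 0
      b"
      using B.comp_add(3)[of "cell2 x f a" "cell2 x (f + d2 a) 0" 0 "cell2 0 0 b"]
        B.composite_laws(11)[rule_format, of "cell2 x f a"] B.composite_laws(11)[rule_format, of
          "cell2 0 0 b"]
      by (simp add: tgt2 id)
    then show ?thesis
      using B.composite_laws(14)[rule_format, of "cell2 x f a" "cell2 y g b"] by (auto simp: tgt2)
  qed

  have bra_zero [simp]: "bra1 L F 0 = 0" "bra1 L 0 F = 0" "bra2 L \<alpha> 0 = 0" "bra2 L 0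
    \<alpha> = 0" for F \<alpha>
    using B.bracket_linear(4)[of F 0 0] B.bracket_linear(3)[of 0 0 F]
      B.bracket_linear(6)[of \<alpha> 0 0] B.bracket_linear(5)[of 0 0 \<alpha>] by simp_all
  have br_swap: "br x y = - br y x" for x y
    using anti(1)[unfolded antisymmetric_2 on_pairs_def, rule_format, of x y] by (simp add: br_def)
  have bra1_swap: "bra1 L F G = - bra1 L G F" for F G
    using anti(2)[unfolded antisymmetric_2 on_pairs_def, rule_format, of F G] by simp
  have bra2_swap: "bra2 L \<alpha> \<beta> = - bra2 L \<beta> \<alpha>" for \<alpha> \<beta>
    using anti(3)[unfolded antisymmetric_2 on_pairs_def, rule_format, of \<alpha> \<beta>] by simp
  have cell1_ker: "F = cell1 0 (ker1 F)" if "s1 F = 0" for F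
    using coord1[of F] that by simp
  have cell2_ker: "\<alpha> = cell2 0 0 (ker2 \<alpha>)" if "s2 \<alpha> = 0" for \<alpha>
    using coord2[of \<alpha>] that by simp
  have bra0_zero: "bra0 L x 0 = 0" "bra0 L 0 x = 0" for x
    using B.bracket_linear(2)[of x 0 0] B.bracket_linear(1)[of 0 0 x] by simp_all
  have bra1_00: "bra1 L (cell1 x 0) (cell1 y 0) = cell1 (br x y) 0" for x y
    using B.bracket_functor(5)[of x y] by (simp add: id br_def)
  have bra1_01: "bra1 L (cell1 x 0) (cell1 0 f) = cell1 0 (r1 x f)" for x f
    unfolding r1_def using B.bracket_functor(1)[of "cell1 x 0" "cell1 0 f"]
    by (intro cell1_ker) (simp add: fields bra0_zero)
  have bra1_10: "bra1 L (cell1 0 f) (cell1 x 0) = cell1 0 (- r1 x f)" for x f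
    using bra1_swap[of "cell1 0 f" "cell1 x 0"] by (simp add: bra1_01)
  \<comment> \<open>The interchange law can be applied in two ways, which also gives
    \<open>r1_d1\<close>.\<close>
  have bra1_11: "bra1 L (cell1 0 f) (cell1 0 g) = cell1 0 (- r1 (d1 g) f)" "bra1 L (cell1 0 f)
    (cell1 0 g) = cell1 0 (r1 (d1 f) g)" for f g
  proof -
    have u: "comp10 L 0 (cell1 0 f) = cell1 0 f" "comp10 L (cell1 0 f) (cell1 (d1 f) 0) = cell1 0
      f" for f
      using comp10[of 0 0 0 f] comp10[of 0 f "d1 f" 0] d1_zero by simp_all
    show "bra1 L (cell1 0 f) (cell1 0 g) = cell1 0 (- r1 (d1 g) f)"
      using B.bracket_functor(7)[of 0 "cell1 0 f" "cell1 0 g" "cell1 (d1 g) 0"] d1_zero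
      by (simp add: u tgt1 bra1_10)
    show "bra1 L (cell1 0 f) (cell1 0 g) = cell1 0 (r1 (d1 f) g)"
      using B.bracket_functor(7)[of "cell1 0 f" "cell1 (d1 f) 0" 0 "cell1 0 g"] d1_zero
      by (simp add: u tgt1 bra1_01)
  qed
  have bra1: "bra1 L (cell1 x f) (cell1 y g) = cell1 (br x y) (r1 x g - r1 (y + d1 g) f)" for x f y
    g
  proof -
    have "bra1 L (cell1 x 0 + cell1 0 f) (cell1 y 0 + cell1 0 g) = cell1 (br x y) (r1 x g - (r1 y f
      + r1 (d1 g) f))"
      by (simp only: B.bracket_linear bra1_00 bra1_01 bra1_10 bra1_11(1)) (simp add: algebra_simps)
    then show ?thesis by (simp add: r1_add_left)
  qed
  have iid: "iid L x = cell2 x 0 0" for x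
    by (simp add: id)
  have bra2_0: "bra2 L (cell2 x f 0) (cell2 y g 0) = cell2 (br x y) (r1 x g - r1 (y + d1 g) f) 0"
    for x f y g
    using B.bracket_functor(6)[of "cell1 x f" "cell1 y g"] by (simp add: id bra1)
  have bra2_02: "bra2 L (cell2 x 0 0) (cell2 0 0 a) = cell2 0 0 (r2 x a)" for x a
    unfolding r2_def using B.bracket_functor(3)[of "cell2 x 0 0" "cell2 0 0 a"]
    by (intro cell2_ker) (simp add: fields)
  have u20: "comp20 L 0 (cell2 0 f a) = cell2 0 f a" "comp20 L (cell2 0 f a) (cell2 (d1 f) 0 0) =
    cell2 0 f a" for f a
    using comp20[of 0 0 0 0 f a] comp20[of 0 f a "d1 f" 0 0] d1_zero by simp_all
  \<comment> \<open>The cell of \<open>a\<close> starts and ends at the 0-cell 0, so it can be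
    padded with 0 on either side. One padding in the interchange law gives 0, the other the action
    of \<open>d1 f\<close> on \<open>a\<close>.\<close>
  have bra2_12: "bra2 L (cell2 0 f 0) (cell2 0 0 a) = 0" "r2 (d1 f) a = 0" for f a
  proof -
    show 0: "bra2 L (cell2 0 f 0) (cell2 0 0 a) = 0"
      using B.bracket_functor(8)[of 0 "cell2 0 f 0" "cell2 0 0 a" 0] u20(2)[of 0 a] d1_zero
        u20(1)[of 0 0]
      by (simp add: u20 tgt1 tgt2 d1_add d1_d2)
    have "bra2 L (cell2 0 f 0) (cell2 0 0 a) = cell2 0 0 (r2 (d1 f) a)"
      using B.bracket_functor(8)[of "cell2 0 f 0" "cell2 (d1 f) 0 0" 0 "cell2 0 0 a"] d1_zero
        u20(1)[of 0 "r2 (d1 f) a"]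
      by (simp add: u20 tgt1 tgt2 d1_add d1_d2 bra2_02)
    with 0 have "cell2 0 0 (r2 (d1 f) a) = cell2 0 0 0" by simp
    then show "r2 (d1 f) a = 0" by (simp only: cell_inject)
  qed
  have bra2_22: "bra2 L (cell2 0 0 a) (cell2 0 0 b) = 0" for a b
    using B.bracket_functor(8)[of 0 "cell2 0 0 a" "cell2 0 0 b" 0] u20(2)[of 0 b] d1_zero u20(1)[of
      0 0]
    by (simp add: u20 tgt1 tgt2 d1_add d1_d2)
  have bra2_01: "bra2 L (cell2 x f 0) (cell2 0 0 a) = cell2 0 0 (r2 x a)" for x f a
    using B.bracket_linear(5)[of "cell2 x 0 0" "cell2 0 f 0" "cell2 0 0 a"] by (simp add: bra2_02
      bra2_12)
  have bra2: "bra2 L (cell2 x f a) (cell2 y g b) = cell2 (br x y) (r1 x g - r1 (y + d1 g) f) (r2 x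
    b - r2 y a)"
    for x f a y g b
  proof -
    have "bra2 L (cell2 0 0 a) (cell2 y g 0) = cell2 0 0 (- r2 y a)"
      using bra2_swap[of "cell2 0 0 a" "cell2 y g 0"] by (simp add: bra2_01)
    then have "bra2 L (cell2 x f 0 + cell2 0 0 a) (cell2 y g 0 + cell2 0 0 b) =
        cell2 (br x y) (r1 x g - r1 (y + d1 g) f) (r2 x b - r2 y a)"
      by (simp only: B.bracket_linear bra2_0 bra2_01 bra2_22) simp
    then show ?thesis by simp
  qed

  note jac_facts = jacobi[unfolded linear_2_transformation_3 multilinear_on_triples
    Vector_Spaces.linear_iff
      jac_source_def jac_target_def]
  note ident_facts = ident[unfolded linear_2_modification_4 multilinear_on_quadruples
    Vector_Spaces.linear_iff]
  have jac: "jac L x y z = cell1 (br (br x y) z) (jj x y z)" for x y z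
    using jac_facts coord1[of "jac L x y z"] by (simp add: jj_def br_def fields)

  have zeros: "sc0 r 0 = 0" "sv1 r 0 = 0" "sv2 r 0 = 0" for r
    using V[THEN vector_space.vector_space_assms(1), of r 0 0] by simp_all
  have lin1: "d1 (sv1 r f) = sc0 r (d1 f)" "d2 (a + b) = d2 a + d2 b" "d2 (sv2 r a) = sv1 r (d2 a)"
    for r f a b
  proof -
    show "d1 (sv1 r f) = sc0 r (d1 f)"
      using B.scale_structure(2)[of r "cell1 0 f"]
      by (simp add: tgt1 zeros)
    show "d2 (a + b) = d2 a + d2 b"
      using B.linear_structure(4)[of "cell2 0 0 a" "cell2 0 0 b"] by (simp add: tgt2)
    show "d2 (sv2 r a) = sv1 r (d2 a)"
      using B.scale_structure(4)[of r "cell2 0 0 a"]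
      by (simp add: tgt2 zeros)
  qed
  have r_zero: "r1 0 f = 0" "r1 x 0 = 0" "r2 0 a = 0" "r2 x 0 = 0" for x f a
    by (simp_all add: r1_def r2_def)
  have br_zero: "br x 0 = 0" "br 0 x = 0" for x
    by (simp_all add: br_def bra0_zero)
  interpret skeleton sc0 sv1 sv2 d1 d2 br r1 r2 jj mm
  proof (rule skeleton.intro)
    show "Vector_Spaces.linear sv1 sc0 d1"
      by (simp add: Vector_Spaces.linear_iff V d1_add lin1)
    show "Vector_Spaces.linear sv2 sv1 d2"
      by (simp add: Vector_Spaces.linear_iff V lin1)
    show "Vector_Spaces.linear sc0 sc0 (br x)" for x
      by (simp add: Vector_Spaces.linear_iff V br_def)
    show "br x y = - br y x" for x y by (rule br_swap)
    show "Vector_Spaces.linear sv1 sv1 (r1 x)" for x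
      using B.bracket_linear(4)[of "cell1 x 0" "cell1 0 f" "cell1 0 g" for f g]
        B.bracket_linear(10)[of "cell1 x 0" r "cell1 0 f" for r f]
      by (simp add: Vector_Spaces.linear_iff V bra1 d1_zero r_zero br_zero zeros)
    show "Vector_Spaces.linear sc0 sv1 (\<lambda>x. r1 x f)" for f
      using B.bracket_linear(3)[of "cell1 x 0" "cell1 y 0" "cell1 0 f" for x y]
        B.bracket_linear(9)[of r "cell1 x 0" "cell1 0 f" for r x]
      by (simp add: Vector_Spaces.linear_iff V bra1 d1_zero r_zero br_zero zeros)
    show "Vector_Spaces.linear sv2 sv2 (r2 x)" for x
      using B.bracket_linear(6)[of "cell2 x 0 0" "cell2 0 0 a" "cell2 0 0 b" for a b]
        B.bracket_linear(12)[of "cell2 x 0 0" r "cell2 0 0 a" for r a]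
      by (simp add: Vector_Spaces.linear_iff V bra2 d1_zero r_zero br_zero zeros)
    show "Vector_Spaces.linear sc0 sv2 (\<lambda>x. r2 x a)" for a
      using B.bracket_linear(5)[of "cell2 x 0 0" "cell2 y 0 0" "cell2 0 0 a" for x y]
        B.bracket_linear(11)[of r "cell2 x 0 0" "cell2 0 0 a" for r x]
      by (simp add: Vector_Spaces.linear_iff V bra2 d1_zero r_zero br_zero zeros)
    show "Vector_Spaces.linear sc0 sv1 (jj x y)" for x y
      using jac_facts by (simp add: Vector_Spaces.linear_iff V jac br_def)
    show "jj x y z = - jj y x z" "jj x y z = - jj x z y" for x y z
      using anti(4)[unfolded antisymmetric_3 on_triples_def part1_def, THEN conjunct1, rule_format,
        of x y z]
        anti(4)[unfolded antisymmetric_3 on_triples_def part1_def, THEN conjunct2, rule_format, of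
          x y z]
      by (simp_all add: jac id)
    show "Vector_Spaces.linear sc0 sv2 (mm x y z)" for x y z
      using ident_facts by (simp add: Vector_Spaces.linear_iff V mm_def ker2_add ker2_scale)
    \<comment> \<open>Identity 2-cells have no component in \<open>V2\<close>, so the skew-symmetry
      required of \<open>part2\<close> passes to \<open>mm\<close>.\<close>
    have part2: "mm x y z u = ker2 (part2 L (ident L x y z u))" for x y z u
    proof -
      have "ker2 (id1 L F) = 0" for F
        using id(2)[of "s1 F" "ker1 F"] by (simp add: coord1)
      then show ?thesis
        using ker2_add[of "part2 L (ident L x y z u)" "id1 L (src2 L (ident L x y z u))"]
        by (simp add: mm_def part2_def)
    qed
    have ker2_minus: "ker2 (- \<alpha>) = - ker2 \<alpha>" for \<alpha>
      using ker2_add[of \<alpha> "- \<alpha>"] by (simp add: eq_neg_iff_add_eq_0 add.commute)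
    note part2_swap = anti(5)[unfolded antisymmetric_4 on_quadruples_def]
    show "mm x y z u = - mm y x z u" "mm x y z u = - mm x z y u" "mm x y z u = - mm x y u z" for x
      y z u
      using part2_swap[THEN conjunct1, rule_format, of x y z u]
        part2_swap[THEN conjunct2, THEN conjunct1, rule_format, of x y z u]
        part2_swap[THEN conjunct2, THEN conjunct2, rule_format, of x y z u]
      by (simp_all add: part2 ker2_minus)
  qed
  interpret pre_lie_skeleton sc0 sv1 sv2 d1 d2 br r1 r2 jj mm
  proof (intro pre_lie_skeleton.intro skeleton_axioms pre_lie_skeleton_axioms.intro)
    fix x y z :: 'a and f g :: 'v and a :: 'w
    show "d1 (d2 a) = 0" by (rule d1_d2)
    show "d1 (r1 x f) = br x (d1 f)"
      using B.bracket_functor(2)[of "cell1 x 0" "cell1 0 f"] by (simp add: bra1 tgt1 flip: br_def)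
    show "r1 (d1 f) g = - r1 (d1 g) f"
      using bra1_11[of f g] by simp
    show "d2 (r2 x a) = r1 x (d2 a)"
      using B.bracket_functor(4)[of "cell2 x 0 0" "cell2 0 0 a"] by (simp add: bra1 bra2 tgt2)
    show "r2 (d1 f) a = 0" by (rule bra2_12)
    have "tgt1 L (jac L x y z) = br (br x z) y + br x (br y z)"
      using jac_facts by (simp add: br_def)
    then show jj: "d1 (jj x y z) = br (br x z) y + br x (br y z) - br (br x y) z"
      by (simp add: jac tgt1 eq_diff_eq add.commute)
    have nat: "comp20 L (bra2 L (bra2 L \<alpha> \<beta>) \<gamma>) (id1 L (jac L (ttgt L \<alpha>)
      (ttgt L \<beta>) (ttgt L \<gamma>))) =
      comp20 L (id1 L (jac L (ssrc L \<alpha>) (ssrc L \<beta>) (ssrc L \<gamma>))) (bra2 L (bra2 L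
        \<alpha> \<gamma>) \<beta> + bra2 L \<alpha> (bra2 L \<beta> \<gamma>))"
      for \<alpha> \<beta> \<gamma>
      using jac_facts by blast
    have right: "d1 (r1 x f) = - br (d1 f) x" for x f
      using B.bracket_functor(2)[of "cell1 x 0" "cell1 0 f"] br_swap[of x "d1 f"] by (simp add:
        bra1 tgt1 flip: br_def)
    \<comment> \<open>Naturality of the Jacobiator with f in \<open>V1\<close> in the first slot and
      identities in the others: the Jacobiator at the source has a zero argument, the one at the
      target contributes \<open>jj (d1 f) x y\<close>. An element of \<open>V2\<close> in that slot
      gives the next equation.\<close>
    show "r1 (br x y) f = r1 x (r1 y f) - r1 y (r1 x f) - jj (d1 f) x y"
      using nat[of "cell2 0 f 0" "cell2 x 0 0" "cell2 y 0 0"]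
      by (simp add: bra2 tgt1 tgt2 jac id comp20 u20 right algebra_simps)
    show "r2 (br x y) a = r2 x (r2 y a) - r2 y (r2 x a)"
      using nat[of "cell2 0 0 a" "cell2 x 0 0" "cell2 y 0 0"]
      using u20(2)[of 0 "r2 y (r2 x a)"]
      by (simp add: bra2 tgt1 tgt2 jac id comp20 u20 right d1_d2 algebra_simps)
  qed
  interpret C: pre_cells sc0 sc1 sc2 sv1 sv2 s1 s2 i0 i1 j1 j2 d1 d2 br r1 r2 jj mm
    by unfold_locales
  \<comment> \<open>\<eta> is computed in \<open>L\<close> itself: the equality of \<open>L\<close>
    with \<open>C.L\<close> requires the coordinates of \<mu>, whose source is \<eta>.\<close>
  have then1_id: "lie3_cells.then1_id L (cell1 x f) (cell1 y g) = cell1 x (f + g)" for x f y g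
    by (simp add: lie3_cells.then1_id_def comp10 tgt1 id)
  have eta: "lie3_cells.eta L x y z u = cell1 (br (br (br x y) z) u) (eta_part x y z u)" for x y z u
    by (simp add: lie3_cells.eta_def then1_id eta_part_def C.d1_r1_right d1_jj comp10 bra1 jac id
      flip: br_def)
  have ident_coord: "ident L x y z u = cell2 (br (br (br x y) z) u) (eta_part x y z u) (mm x y z
    u)" for x y z u
    using ident_facts coord2[of "ident L x y z u"] by (simp add: mm_def fields eta)
  have L_cells: "L = C.L"
    by (rule lie3.equality)
      (simp_all add: fun_eq_iff all_cell1 all_cell2 tgt1 tgt2 id comp10 comp20 comp21 bra1 bra2 jac
        ident_coord flip: br_def)
  have "lie_skeleton sc0 sv1 sv2 d1 d2 br r1 r2 jj mm"
  proof (intro lie_skeleton.intro pre_lie_skeleton_axioms lie_skeleton_axioms.intro)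
    fix x y z u v :: 'a and f :: 'v
    have "tgt2 L (ident L x y z u) = lie3_cells.eps L x y z u"
      using ident_facts by blast
    then show "d2 (mm x y z u) = eps_part x y z u - eta_part x y z u"
      unfolding L_cells by (simp add: C.eps_cell1 eq_diff_eq add.commute)
    \<comment> \<open>Naturality of \<mu> with f in \<open>V1\<close> in the first slot. Neither
      functor has a component in \<open>V2\<close> at these cells, so comparing
      \<open>V2\<close>-components identifies \<open>mm\<close> at \<open>d1 f\<close> with
      \<open>mm\<close> at 0.\<close>
    let ?F = "ident_source (bra2 L) (cell2 0 f 0) (cell2 y 0 0) (cell2 z 0 0) (cell2 u 0 0)"
    let ?G = "ident_target (bra2 L) (cell2 0 f 0) (cell2 y 0 0) (cell2 z 0 0) (cell2 u 0 0)"
    have ker2_comp: "ker2 (comp20 L \<alpha> \<beta>) = ker2 \<alpha> + ker2 \<beta>" if "ttgt L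
      \<alpha> = ssrc L \<beta>" for \<alpha> \<beta>
      using that comp20[of "s1 (s2 \<alpha>)" "ker1 (s2 \<alpha>)" "ker2 \<alpha>" "s1 (s2
        \<beta>)" "ker1 (s2 \<beta>)" "ker2 \<beta>"]
        tgt2[of "s1 (s2 \<alpha>)" "ker1 (s2 \<alpha>)" "ker2 \<alpha>"]
      by (simp add: coord2 tgt1 d1_d2 fields)
    have "comp20 L (ident_source (bra2 L) \<alpha> \<beta> \<gamma> \<delta>) (ident L (ttgt L
      \<alpha>) (ttgt L \<beta>) (ttgt L \<gamma>) (ttgt L \<delta>)) =
      comp20 L (ident L (ssrc L \<alpha>) (ssrc L \<beta>) (ssrc L \<gamma>) (ssrc L \<delta>))
        (ident_target (bra2 L) \<alpha> \<beta> \<gamma> \<delta>)"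
      for \<alpha> \<beta> \<gamma> \<delta>
      using ident_facts by blast
    from this[of "cell2 0 f 0" "cell2 y 0 0" "cell2 z 0 0" "cell2 u 0 0"]
    have "comp20 L ?F (ident L (d1 f) y z u) = comp20 L (ident L 0 y z u) ?G"
      by (simp add: tgt1 tgt2)
    moreover have "ttgt L ?F = ssrc L (ident L (d1 f) y z u)" "ttgt L (ident L 0 y z u) = ssrc L ?G"
      by (simp_all add: ident_coord tgt1 tgt2 d1_d2 C.d1_eta_part ident_source_def ident_target_def
        flip: br_def)
    moreover have "ker2 ?F = 0" "ker2 ?G = 0"
      by (simp_all add: ident_source_def ident_target_def bra2)
    ultimately show "mm (d1 f) y z u = 0"
      using ker2_comp[of ?F "ident L (d1 f) y z u"] ker2_comp[of "ident L 0 y z u" ?G]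
      by (simp add: ident_coord)
    show "coherence_part x y z u v = 0"
      using coherence[unfolded lie3_cells.coherence_def, rule_format, of x y z u v,
          unfolded L_cells C.alpha1_cell2 C.alpha2_cell2 C.alpha3_cell2 C.alpha4_cell2
            C.inverse21_cell2 cell_add cell_inject,
          THEN conjunct2, THEN conjunct2]
      by (simp add: coherence_part_def algebra_simps)
  qed
  with L_cells show ?thesis by blast
qed

end

theorem theorem1:
  fixes sc0 :: "'k::field \<Rightarrow> 'a::ab_group_add \<Rightarrow> 'a"
    and sc1 :: "'k \<Rightarrow> 'b::ab_group_add \<Rightarrow> 'b"
    and sc2 :: "'k \<Rightarrow> 'c::ab_group_add \<Rightarrow> 'c"
    and sv1 :: "'k \<Rightarrow> 'v::ab_group_add \<Rightarrow> 'v"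
    and sv2 :: "'k \<Rightarrow> 'w::ab_group_add \<Rightarrow> 'w"
    and s1 :: "'b \<Rightarrow> 'a" and s2 :: "'c \<Rightarrow> 'b"
    and i0 :: "'a \<Rightarrow> 'b" and i1 :: "'b \<Rightarrow> 'c"
    and j1 :: "'v \<Rightarrow> 'b" and j2 :: "'w \<Rightarrow> 'c"
  assumes "kernel_identification sc0 sc1 sc2 sv1 sv2 s1 s2 i0 i1 j1 j2"
  shows "bij_betw (lie3_to_lie_infinity j1 j2)
           {L :: ('a, 'b, 'c) lie3. lie_3_algebra sc0 sc1 sc2 L \<and>
              src1 L = s1 \<and> src2 L = s2 \<and> id0 L = i0 \<and> id1 L = i1}
           {l. lie_infinity_3 sc0 sv1 sv2 l \<and> vanishing_2_3 l}"
    (is "bij_betw ?\<Phi> ?A ?B")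
proof -
  interpret coordinates sc0 sc1 sc2 sv1 sv2 s1 s2 i0 i1 j1 j2
    by unfold_locales fact
  have cells: "cells d1 d2 br r1 r2 jj mm \<in> ?A"
      "?\<Phi> (cells d1 d2 br r1 r2 jj mm) = ell_maps d1 d2 br r1 r2 jj mm"
      "ell_maps d1 d2 br r1 r2 jj mm \<in> ?B"
    if "lie_skeleton sc0 sv1 sv2 d1 d2 br r1 r2 jj mm" for d1 d2 br r1 r2 jj mm
  proof -
    interpret lie_skeleton sc0 sv1 sv2 d1 d2 br r1 r2 jj mm by fact
    interpret skeleton_cells sc0 sc1 sc2 sv1 sv2 s1 s2 i0 i1 j1 j2 d1 d2 br r1 r2 jj mm
      by unfold_locales
    show "cells d1 d2 br r1 r2 jj mm \<in> ?A"
      using cells_lie_3_algebra by (simp add: cells_def)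
    show "?\<Phi> (cells d1 d2 br r1 r2 jj mm) = ell_maps d1 d2 br r1 r2 jj mm"
      by (rule lie_infinity_cells)
    show "ell_maps d1 d2 br r1 r2 jj mm \<in> ?B"
      using lie_infinity_ell_maps vanishing_ell_maps by simp
  qed
  have skeleton: "\<exists>d1 d2 br r1 r2 jj mm.
      lie_skeleton sc0 sv1 sv2 d1 d2 br r1 r2 jj mm \<and> L = cells d1 d2 br r1 r2 jj mm" if "L
        \<in> ?A" for L
    using that lie_3_algebra_eq_cells by blast
  show ?thesis
  proof (rule bij_betwI')
    fix L L' assume "L \<in> ?A" "L' \<in> ?A"
    then obtain d1 d2 br r1 r2 jj mm d1' d2' br' r1' r2' jj' mm'
      where S: "lie_skeleton sc0 sv1 sv2 d1 d2 br r1 r2 jj mm" "lie_skeleton sc0 sv1 sv2 d1' d2'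
        br' r1' r2' jj' mm'"
        and L: "L = cells d1 d2 br r1 r2 jj mm" "L' = cells d1' d2' br' r1' r2' jj' mm'"
      using skeleton by meson
    \<comment> \<open>Both images are \<open>ell_maps\<close> of the respective skeletons, so equal
      images come from equal skeletons.\<close>
    have "L = L'" if "?\<Phi> L = ?\<Phi> L'"
      using ell_maps_inject[OF S] that unfolding L cells(2)[OF S(1)] cells(2)[OF S(2)] by simp
    then show "?\<Phi> L = ?\<Phi> L' \<longleftrightarrow> L = L'"
      by blast
  next
    fix L assume "L \<in> ?A"
    then obtain d1 d2 br r1 r2 jj mm
      where S: "lie_skeleton sc0 sv1 sv2 d1 d2 br r1 r2 jj mm" and L: "L = cells d1 d2 br r1 r2 jj
        mm"
      using skeleton by meson
    show "?\<Phi> L \<in> ?B"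
      unfolding L cells(2)[OF S] by (rule cells(3)[OF S])
  next
    fix l assume "l \<in> ?B"
    then obtain d1 d2 br r1 r2 jj mm
      where S: "lie_skeleton sc0 sv1 sv2 d1 d2 br r1 r2 jj mm" and l: "l = ell_maps d1 d2 br r1 r2
        jj mm"
      using lie_infinity_eq_ell_maps by blast
    show "\<exists>L \<in> ?A. l = ?\<Phi> L"
      unfolding l cells(2)[OF S, symmetric] by (rule bexI[OF refl cells(1)[OF S]])
  qed
qed

end
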